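(* Let $d\ge 1$ and let $(i_1,j_1),\ldots,(i_d,j_d)$ be pairs of real numbers with $0\le i_t,j_t\le 1$ and $i_t+j_t=1$ for each $t$. Let $\mathcal{C}\subset\mathbb{R}^2$ be a $C^{(2)}$ non-degenerate planar curve. Then $$\dim\Big(\bigcap_{t=1}^{d}\mathbf{Bad}(i_t,j_t)\cap\mathcal{C}\Big)=1,$$ where $\dim$ denotes Hausdorff dimension.
   Context: For real numbers $i,j$ with $0\le i,j\le1$ and $i+j=1$, $\mathbf{Bad}(i,j)$ is the set of points $(x,y)\in\mathbb{R}^2$ for which there exists a constant $c(x,y)>0$ such that $\max\{\|qx\|^{1/i},\|qy\|^{1/j}\}>c(x,y)\,q^{-1}$ for all $q\in\mathbb{N}$. Here $\|\cdot\|$ denotes distance to the nearest integer, and by convention $z^{1/0}:=0$, so that $\mathbf{Bad}(0,1)=\mathbb{R}\times\mathbf{Bad}$ and $\mathbf{Bad}(1,0)=\mathbf{Bad}\times\mathbb{R}$, where $\mathbf{Bad}$ is the set of badly approximable real numbers $x$ (those with $\|qx\|>c(x)q^{-1}$ for all $q\in\mathbb{N}$, some $c(x)>0$). A planar curve $\mathcal{C}$ is $C^{(2)}$ non-degenerate if (up to exchanging coordinates/choosing a graph parametrisation) $\mathcal{C}=\{(x,f(x)):x\in I\}$ for an interval $I\subset\mathbb{R}$ and $f\in C^{(2)}(I)$ with $f''(x)\neq0$ for at least one $x\in I$. *)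

theory Defs
  imports "HOL-Analysis.Analysis"
begin

definition nint_dist :: "real \<Rightarrow> real" where
  "nint_dist z = \<bar>z - of_int (round z)\<bar>"

definition root_conv :: "real \<Rightarrow> real \<Rightarrow> real" where
  "root_conv z e = (if e = 0 then 0 else z powr (1 / e))"

definition Bad :: "real \<Rightarrow> real \<Rightarrow> (real \<times> real) set" where
  "Bad i j = {(x, y). \<exists>c>0. \<forall>q::nat. q \<ge> 1 \<longrightarrow>
      max (root_conv (nint_dist (real q * x)) i) (root_conv (nint_dist (real q * y)) j) > c / real q}"

definition diam_pow :: "real \<Rightarrow> 'a::metric_space set \<Rightarrow> real" where
  "diam_pow s U = (if U = {} then 0 else if s = 0 then 1 else diameter U powr s)"

definition hausdorff_content :: "real \<Rightarrow> real \<Rightarrow> 'a::metric_space set \<Rightarrow> ennreal" where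
  "hausdorff_content s \<delta> E =
     Inf {(\<Sum>n. ennreal (diam_pow s (U n))) | U :: nat \<Rightarrow> 'a set.
            E \<subseteq> (\<Union>n. U n) \<and> (\<forall>n. bounded (U n) \<and> diameter (U n) \<le> \<delta>)}"

definition hausdorff_measure :: "real \<Rightarrow> 'a::metric_space set \<Rightarrow> ennreal" where
  "hausdorff_measure s E = (SUP \<delta>\<in>{0<..}. hausdorff_content s \<delta> E)"

definition hausdorff_dim :: "'a::metric_space set \<Rightarrow> real" where
  "hausdorff_dim E = Inf {s. s \<ge> 0 \<and> hausdorff_measure s E = 0}"

end

theory Submission
  imports Defs
begin

text \<open>
  By Khintchine transference it suffices to keep \<open>(x, f x)\<close> at distance at least \<open>c / H\<close>, in the
  sense \<open>\<bar>u x + v f x + w\<bar> \<ge> c / H\<close>, from every integer line, where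
  \<open>H = max (\<bar>u\<bar>\<^sup>1\<^sup>/\<^sup>i) (\<bar>v\<bar>\<^sup>1\<^sup>/\<^sup>j)\<close>. The parameter interval is divided into
  nested cells of length \<open>l / R\<^sup>n\<close>, and the cells near a line are removed at the level matching the
  length of the interval in which the curve is too close to that line. If every surviving cell of level
  \<open>p\<close> loses at most \<open>r\<close> cells of level \<open>q\<close> and the costs \<open>r / T\<^sup>q\<^sup>-\<^sup>1\<^sup>-\<^sup>p\<close> with
  \<open>T = R\<^sup>s\<close> add up to at most \<open>R - T\<close>, then the number of survivors grows at least by the factor
  \<open>T\<close> per level. The sets of a cover with small \<open>s\<close>-dimensional sum are cheap to remove as well, so no
  such cover exists, and several weights are treated at once by adding their costs.

  The lines in a transversal class (\<open>\<bar>u + v f' x\<bar>\<close> of a given order of magnitude) that meet one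
  cell span a plane, since their determinants are integers below 1; were there too many of them, the
  pigeonhole principle in this plane would give a line of smaller height whose removed interval swallows
  the whole cell, so that the cell would not have survived. Lines almost tangent to the curve are much
  rarer: the determinant of three of them, touching at well separated points, would be a nonzero integer
  below 1 because \<open>f''\<close> does not vanish.
\<close>


section \<open>Removal schemes on nested grids\<close>

text \<open>Let \<open>M\<close> be the larger weight. A transversal class removed \<open>k\<close>
  levels below the cells in which it is counted takes about \<open>G ^ 2\<close> cells from each of
  them, while survivors multiply by about \<open>T ^ k = R powr (s * k)\<close>. The line found by
  pigeonhole is closer to the curve by a factor \<open>G\<close> and lower by a factor
  \<open>G powr (1 / M)\<close>, so it traps the cell once \<open>G powr (1 + 1 / M)\<close> beats
  \<open>R ^ k\<close> up to constants. Hence \<open>G\<close> is about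
  \<open>R powr (k * M / (1 + M))\<close>, and the cost decays in \<open>k\<close> exactly when
  \<open>s > 2 * M / (1 + M)\<close>. This threshold is below 1 only for \<open>M < 1\<close>; the
  weights (0, 1) and (1, 0) therefore need a separate, one-dimensional argument. Pigeonholing in
  space instead of a plane would give \<open>3 * M / (1 + M)\<close>, which is at least 1 because
  \<open>M\<close> is at least 1/2: without the plane no \<open>s < 1\<close> could be reached.

  With \<open>R\<close> and \<open>s\<close> fixed, the cost of one weight can still be made
  arbitrarily small through \<open>k0\<close>, \<open>h0\<close> and \<open>q1\<close>. So the
  \<open>d\<close> weights only have to share \<open>R\<close> and \<open>s\<close>, and each may
  receive any share of the budget \<open>R - T\<close>.\<close>

locale grid =
  fixes a l :: real and R :: nat
  assumes l_pos: "l > 0" and R_ge_2: "R \<ge> 2"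
begin

text \<open>Closed cells, so that finite unions of them are compact. The price is that neighbours
  share an endpoint.\<close>

definition cell :: "nat \<Rightarrow> nat \<Rightarrow> real set" where
  "cell n k = {a + l * real k / real R ^ n .. a + l * (real k + 1) / real R ^ n}"

definition hits :: "real set \<Rightarrow> nat \<Rightarrow> nat set" where
  "hits B n = {k. k < R ^ n \<and> cell n k \<inter> B \<noteq> {}}"

text \<open>\<open>k div R ^ (n - Q \<iota>)\<close> is the index of the ancestor at level
  \<open>Q \<iota>\<close>; classes acting deeper than level \<open>n\<close> have no say
  yet.\<close>

definition alive :: "'c set \<Rightarrow> ('c \<Rightarrow> nat) \<Rightarrow> ('c \<Rightarrow> real set) \<Rightarrow> nat \<Rightarrow> nat \<Rightarrow> bool" where
  "alive A Q B n k \<longleftrightarrow>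
     k < R ^ n \<and> (\<forall>\<iota>\<in>A. Q \<iota> \<le> n \<longrightarrow> cell (Q \<iota>) (k div R ^ (n - Q \<iota>)) \<inter> B \<iota> = {})"

text \<open>A class \<open>\<iota>\<close> removes the cells of level \<open>Q \<iota>\<close> that meet \<open>B \<iota>\<close>; the count \<open>r \<iota>\<close> refers to a
  cell of the earlier level \<open>P \<iota>\<close> and is only required if that cell has survived all removals up to
  its own level.\<close>

definition scheme ::
    "real \<Rightarrow> real \<Rightarrow> 'c set \<Rightarrow> ('c \<Rightarrow> nat) \<Rightarrow> ('c \<Rightarrow> nat) \<Rightarrow> ('c \<Rightarrow> real) \<Rightarrow> ('c \<Rightarrow> real set) \<Rightarrow> bool"
  where
  "scheme T e A P Q r B \<longleftrightarrow>
     (\<forall>\<iota>\<in>A. P \<iota> < Q \<iota> \<and> 0 \<le> r \<iota> \<and>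
        (\<forall>k. alive A Q B (P \<iota>) k \<longrightarrow>
           real (card {k' \<in> hits (B \<iota>) (Q \<iota>). k' div R ^ (Q \<iota> - P \<iota>) = k}) \<le> r \<iota>)) \<and>
     (\<forall>q. finite {\<iota>\<in>A. Q \<iota> = q} \<and> (\<Sum>\<iota> | \<iota> \<in> A \<and> Q \<iota> = q. r \<iota> / T ^ (q - 1 - P \<iota>)) \<le> e)"

lemma R_pos: "R > 0" "real R > 0" "real R \<ge> 2" "real R > 1"
  using R_ge_2 by auto

lemma cell_0: "cell 0 0 = {a..a + l}"
  by (simp add: cell_def)

lemma cell_ne: "cell n k \<noteq> {}"
  using l_pos R_pos by (simp add: cell_def divide_right_mono)

lemma compact_cell: "compact (cell n k)"
  by (simp add: cell_def)

lemma div_less_power: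
  assumes "k < R ^ n" "p \<le> n"
  shows "k div R ^ (n - p) < R ^ p"
proof -
  have "R ^ n = R ^ p * R ^ (n - p)"
    using assms(2) by (simp flip: power_add)
  then show ?thesis
    using assms R_pos by (simp add: less_mult_imp_div_less)
qed

lemma cell_subset:
  assumes "p \<le> n"
  shows "cell n k \<subseteq> cell p (k div R ^ (n - p))"
proof -
  define m where "m = R ^ (n - p)"
  have m: "m > 0" using R_pos by (simp add: m_def)
  have Rn: "real R ^ n = real R ^ p * real m"
    using assms by (simp add: m_def flip: power_add)
  have 1: "real (k div m) * real m \<le> real k"
    by (metis of_nat_le_iff of_nat_mult div_times_less_eq_dividend)
  have 2: "real k + 1 \<le> (real (k div m) + 1) * real m"
  proof -
    have "k < (k div m + 1) * m"
      using m by (metis add.commute dividend_less_div_times mult.commute mult_Suc_right plus_1_eq_Suc)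
    then have "k + 1 \<le> (k div m + 1) * m" by simp
    then have "real (k + 1) \<le> real ((k div m + 1) * m)" by (rule of_nat_mono)
    then show ?thesis by (simp add: algebra_simps)
  qed
  have p0: "real R ^ p > 0" using R_pos by simp
  have "l * real (k div m) / real R ^ p = l * (real (k div m) * real m) / real R ^ n"
    using m p0 by (simp add: Rn)
  also have "\<dots> \<le> l * real k / real R ^ n"
    using 1 l_pos R_pos by (intro divide_right_mono mult_left_mono) auto
  finally have A: "l * real (k div m) / real R ^ p \<le> l * real k / real R ^ n" .
  have "l * (real k + 1) / real R ^ n \<le> l * ((real (k div m) + 1) * real m) / real R ^ n"
    using 2 l_pos R_pos by (intro divide_right_mono mult_left_mono) auto
  also have "\<dots> = l * (real (k div m) + 1) / real R ^ p"
    using m p0 by (simp add: Rn)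
  finally have B: "l * (real k + 1) / real R ^ n \<le> l * (real (k div m) + 1) / real R ^ p" .
  show ?thesis
    using A B by (auto simp: cell_def m_def)
qed

lemma alive_ancestor:
  assumes "alive A Q B n k" "p \<le> n"
  shows "alive A Q B p (k div R ^ (n - p))"
proof -
  have "(k div R ^ (n - p)) div R ^ (p - Q \<iota>) = k div R ^ (n - Q \<iota>)" if "Q \<iota> \<le> p" for \<iota>
    using that assms(2) by (simp add: div_mult2_eq[symmetric] flip: power_add)
  then show ?thesis
    using assms div_less_power by (auto simp: alive_def)
qed

lemma alive_Suc:
  assumes "alive A Q B n (k div R)" "k < R ^ Suc n"
    and "\<And>\<iota>. \<iota> \<in> A \<Longrightarrow> Q \<iota> = Suc n \<Longrightarrow> k \<notin> hits (B \<iota>) (Suc n)"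
  shows "alive A Q B (Suc n) k"
  unfolding alive_def
proof (intro conjI ballI impI)
  fix \<iota> assume \<iota>: "\<iota> \<in> A" "Q \<iota> \<le> Suc n"
  show "cell (Q \<iota>) (k div R ^ (Suc n - Q \<iota>)) \<inter> B \<iota> = {}"
  proof (cases "Q \<iota> = Suc n")
    case True
    then show ?thesis using assms(2,3) \<iota> by (auto simp: hits_def)
  next
    case False
    then have le: "Q \<iota> \<le> n" using \<iota> by simp
    have "k div R div R ^ (n - Q \<iota>) = k div R ^ (Suc n - Q \<iota>)"
      using le by (simp add: Suc_diff_le div_mult2_eq)
    then show ?thesis using assms(1) \<iota> le by (metis alive_def)
  qed
qed fact

lemma finite_alive: "finite {k. alive A Q B n k}"
  by (rule finite_subset[of _ "{..<R ^ n}"]) (auto simp: alive_def)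

text \<open>Each alive cell has \<open>R\<close> children. A class acting at level
  \<open>n + 1\<close> removes at most \<open>r\<close> of them per alive cell of level
  \<open>P\<close>, and by \<open>prev\<close> there are at most
  \<open>card (N n) / T ^ (n - P)\<close> such cells. Measured in units of
  \<open>card (N n)\<close>, the losses are exactly the costs in \<open>scheme\<close>, so at least
  a factor \<open>T\<close> remains.\<close>

lemma alive_growth:
  assumes S: "scheme T (real R - T) A P Q r B" and T: "T > 0"
    and prev: "\<And>p. p \<le> n \<Longrightarrow>
       T ^ (n - p) * real (card {k. alive A Q B p k}) \<le> real (card {k. alive A Q B n k})"
  shows "T * real (card {k. alive A Q B n k}) \<le> real (card {k. alive A Q B (Suc n) k})"
proof -
  define N where "N p = {k. alive A Q B p k}" for p
  define I where "I = {\<iota>\<in>A. Q \<iota> = Suc n}"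
  define Z where "Z = {k. k < R ^ Suc n \<and> alive A Q B n (k div R)}"
  define W where "W \<iota> = {k \<in> hits (B \<iota>) (Suc n). alive A Q B n (k div R)}" for \<iota>
  have fI: "finite I" using S by (simp add: scheme_def I_def)
  have fW: "finite (W \<iota>)" for \<iota>
    by (rule finite_subset[of _ "{..<R ^ Suc n}"]) (auto simp: W_def hits_def)
  have cardZ: "card Z = R * card (N n)"
  proof -
    have "Z = (\<lambda>(k, j). k * R + j) ` (N n \<times> {..<R})"
    proof (intro set_eqI iffI)
      fix k assume "k \<in> Z"
      then have "(k div R, k mod R) \<in> N n \<times> {..<R}"
        using R_pos by (auto simp: Z_def N_def)
      moreover have "k = (\<lambda>(k, j). k * R + j) (k div R, k mod R)" by simp
      ultimately show "k \<in> (\<lambda>(k, j). k * R + j) ` (N n \<times> {..<R})" by blast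
    next
      fix k assume "k \<in> (\<lambda>(k, j). k * R + j) ` (N n \<times> {..<R})"
      then obtain u v where uv: "u \<in> N n" "v < R" "k = u * R + v" by auto
      have "k div R = u" using uv by simp
      moreover have "k < R ^ Suc n"
      proof -
        have "u + 1 \<le> R ^ n" using uv(1) by (simp add: N_def alive_def)
        then have "(u + 1) * R \<le> R ^ n * R" by (rule mult_le_mono1)
        then show ?thesis using uv by (simp add: mult.commute)
      qed
      ultimately show "k \<in> Z" using uv by (simp add: Z_def N_def)
    qed
    moreover have "inj_on (\<lambda>(k, j). k * R + j) (N n \<times> {..<R})"
    proof (rule inj_onI, clarify)
      fix u v u' v' assume h: "v < R" "v' < R" "u * R + v = u' * R + v'"
      have "u = (u * R + v) div R" "u' = (u' * R + v') div R" using h(1,2) by simp_all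
      with h(3) have "u = u'" by metis
      with h(3) show "u = u' \<and> v = v'" by simp
    qed
    ultimately show ?thesis by (simp add: card_image card_cartesian_product mult.commute)
  qed
  have sub: "Z \<subseteq> N (Suc n) \<union> (\<Union>\<iota>\<in>I. W \<iota>)"
    using alive_Suc[of A Q B n] by (fastforce simp: Z_def N_def W_def I_def)
  have cW: "real (card (W \<iota>)) \<le> r \<iota> * real (card (N (P \<iota>)))" if "\<iota> \<in> I" for \<iota>
  proof -
    have \<iota>: "\<iota> \<in> A" "Q \<iota> = Suc n" using that by (auto simp: I_def)
    then have P: "P \<iota> < Suc n" and b: "\<And>k. alive A Q B (P \<iota>) k \<Longrightarrow>
        real (card {k' \<in> hits (B \<iota>) (Suc n). k' div R ^ (Suc n - P \<iota>) = k}) \<le> r \<iota>"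
      using S by (auto simp: scheme_def)
    have sub: "W \<iota> \<subseteq> (\<Union>k\<in>N (P \<iota>). {k' \<in> hits (B \<iota>) (Suc n). k' div R ^ (Suc n - P \<iota>) = k})"
    proof
      fix k assume k: "k \<in> W \<iota>"
      then have "alive A Q B (P \<iota>) (k div R div R ^ (n - P \<iota>))"
        using alive_ancestor[of A Q B n "k div R" "P \<iota>"] P by (auto simp: W_def)
      moreover have "k div R div R ^ (n - P \<iota>) = k div R ^ (Suc n - P \<iota>)"
        using P by (simp add: Suc_diff_le div_mult2_eq)
      ultimately show "k \<in> (\<Union>k\<in>N (P \<iota>). {k' \<in> hits (B \<iota>) (Suc n). k' div R ^ (Suc n - P \<iota>) = k})"
        using k by (auto simp: N_def W_def)
    qed
    have fin: "finite (\<Union>k\<in>N (P \<iota>). {k' \<in> hits (B \<iota>) (Suc n). k' div R ^ (Suc n - P \<iota>) = k})"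
      by (rule finite_subset[of _ "{..<R ^ Suc n}"]) (auto simp: hits_def)
    have "card (W \<iota>) \<le> card (\<Union>k\<in>N (P \<iota>). {k' \<in> hits (B \<iota>) (Suc n). k' div R ^ (Suc n - P \<iota>) = k})"
      by (rule card_mono[OF fin sub])
    also have "\<dots> \<le> (\<Sum>k\<in>N (P \<iota>). card {k' \<in> hits (B \<iota>) (Suc n). k' div R ^ (Suc n - P \<iota>) = k})"
      by (intro card_UN_le) (simp add: N_def finite_alive)
    finally have "real (card (W \<iota>)) \<le>
        (\<Sum>k\<in>N (P \<iota>). real (card {k' \<in> hits (B \<iota>) (Suc n). k' div R ^ (Suc n - P \<iota>) = k}))"
      unfolding of_nat_sum[symmetric] of_nat_le_iff .
    also have "\<dots> \<le> (\<Sum>k\<in>N (P \<iota>). r \<iota>)"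
      using b by (intro sum_mono) (simp add: N_def)
    finally show ?thesis by (simp add: mult.commute)
  qed
  have "card Z \<le> card (N (Suc n) \<union> (\<Union>\<iota>\<in>I. W \<iota>))"
    using sub fI fW by (intro card_mono) (auto simp: N_def finite_alive)
  also have "\<dots> \<le> card (N (Suc n)) + card (\<Union>\<iota>\<in>I. W \<iota>)" by (rule card_Un_le)
  also have "card (\<Union>\<iota>\<in>I. W \<iota>) \<le> (\<Sum>\<iota>\<in>I. card (W \<iota>))" by (rule card_UN_le[OF fI])
  finally have "R * card (N n) \<le> card (N (Suc n)) + (\<Sum>\<iota>\<in>I. card (W \<iota>))"
    by (simp add: cardZ)
  then have "real R * card (N n) \<le> card (N (Suc n)) + (\<Sum>\<iota>\<in>I. real (card (W \<iota>)))"
    unfolding of_nat_sum[symmetric] of_nat_mult[symmetric] of_nat_add[symmetric] of_nat_le_iff .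
  moreover have "(\<Sum>\<iota>\<in>I. real (card (W \<iota>))) \<le> (\<Sum>\<iota>\<in>I. r \<iota> / T ^ (Suc n - 1 - P \<iota>)) * card (N n)"
    unfolding sum_distrib_right
  proof (rule sum_mono)
    fix \<iota> assume \<iota>: "\<iota> \<in> I"
    then have r: "0 \<le> r \<iota>" and P: "P \<iota> \<le> n" using S by (auto simp: I_def scheme_def)
    have "real (card (N (P \<iota>))) \<le> real (card (N n)) / T ^ (n - P \<iota>)"
      using prev[OF P] T by (simp add: N_def field_simps)
    then have "r \<iota> * real (card (N (P \<iota>))) \<le> r \<iota> * (real (card (N n)) / T ^ (n - P \<iota>))"
      using r by (rule mult_left_mono)
    with cW[OF \<iota>] show "real (card (W \<iota>)) \<le> r \<iota> / T ^ (Suc n - 1 - P \<iota>) * real (card (N n))"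
      by simp
  qed
  moreover have "(\<Sum>\<iota>\<in>I. r \<iota> / T ^ (Suc n - 1 - P \<iota>)) * card (N n) \<le> (real R - T) * card (N n)"
  proof (rule mult_right_mono)
    show "(\<Sum>\<iota>\<in>I. r \<iota> / T ^ (Suc n - 1 - P \<iota>)) \<le> real R - T"
      using S unfolding scheme_def I_def by blast
  qed simp
  ultimately show ?thesis by (simp add: N_def algebra_simps)
qed

text \<open>The alive cells never die out, so their unions are a nested sequence of nonempty compact
  sets. A common point lies, at level \<open>Q \<iota>\<close>, in an alive cell, and that cell
  misses \<open>B \<iota>\<close>.\<close>

theorem survivor:
  assumes S: "scheme T (real R - T) A P Q r B" and T: "T > 0"
  obtains x where "x \<in> {a..a + l}" "\<And>\<iota>. \<iota> \<in> A \<Longrightarrow> x \<notin> B \<iota>"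
proof -
  define N where "N p = {k. alive A Q B p k}" for p
  have Q: "Q \<iota> > 0" if "\<iota> \<in> A" for \<iota> using S that by (auto simp: scheme_def)
  have N0: "N 0 = {0}" using Q by (force simp: N_def alive_def)
  \<comment> \<open>The induction has to carry all \<open>p \<le> n\<close> at once, because a class
    may be counted at any earlier level.\<close>
  have growth: "\<forall>p\<le>n. T ^ (n - p) * real (card (N p)) \<le> real (card (N n))" for n
  proof (induction n)
    case (Suc n)
    have step: "T * real (card (N n)) \<le> real (card (N (Suc n)))"
      using alive_growth[OF S T, of n] Suc.IH by (simp add: N_def)
    show ?case
    proof (intro allI impI)
      fix p assume p: "p \<le> Suc n"
      show "T ^ (Suc n - p) * real (card (N p)) \<le> real (card (N (Suc n)))"
      proof (cases "p = Suc n")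
        case False
        then have "p \<le> n" using p by simp
        then have "T ^ (Suc n - p) * real (card (N p)) = T * (T ^ (n - p) * real (card (N p)))"
          by (simp add: Suc_diff_le)
        also have "\<dots> \<le> T * real (card (N n))"
          using Suc.IH \<open>p \<le> n\<close> T by (intro mult_left_mono) auto
        finally show ?thesis using step by linarith
      qed simp
    qed
  qed simp
  have ne: "N n \<noteq> {}" for n
  proof
    assume e: "N n = {}"
    have "T ^ (n - 0) * real (card (N 0)) \<le> real (card (N n))"
      using growth[of n] by blast
    with e N0 zero_less_power[OF T, of n] show False by simp
  qed
  define F where "F n = (\<Union>k\<in>N n. cell n k)" for n
  have "\<Inter> (range F) \<noteq> {}"
  proof (rule compact_nest)
    show "compact (F n)" for n
      using compact_cell by (auto simp: F_def N_def finite_alive intro!: compact_UN)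
    show "F n \<noteq> {}" for n
      using ne[of n] cell_ne by (auto simp: F_def)
  next
    fix p n :: nat assume "p \<le> n"
    then show "F n \<subseteq> F p"
      using cell_subset[of p n] alive_ancestor[of A Q B n _ p] by (fastforce simp: F_def N_def)
  qed
  then obtain x where x: "x \<in> F n" for n by blast
  show thesis
  proof
    show "x \<in> {a..a + l}" using x[of 0] by (simp add: F_def N0 cell_0)
    fix \<iota> assume \<iota>: "\<iota> \<in> A"
    obtain k where "alive A Q B (Q \<iota>) k" "x \<in> cell (Q \<iota>) k"
      using x[of "Q \<iota>"] by (auto simp: F_def N_def)
    moreover from this(1) \<iota> have "cell (Q \<iota>) (k div R ^ (Q \<iota> - Q \<iota>)) \<inter> B \<iota> = {}"
      unfolding alive_def by blast
    ultimately show "x \<notin> B \<iota>" by auto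
  qed
qed


section \<open>Levels of lengths, and how many cells a small set can hit\<close>

definition level :: "real \<Rightarrow> nat" where
  "level y = nat \<lfloor>log (real R) (l / y)\<rfloor>"

text \<open>\<open>level y\<close> is the deepest level whose cells still have length at least
  \<open>y\<close>, so \<open>y\<close> and that length agree up to a factor
  \<open>R\<close>.\<close>

lemma level_bounds:
  assumes "0 < y" "y \<le> l"
  shows le_level_size: "y \<le> l / real R ^ level y"
    and level_size_less: "l / real R ^ level y < real R * y"
proof -
  define u where "u = log (real R) (l / y)"
  have u0: "0 \<le> u" using assms l_pos R_pos by (simp add: u_def)
  then have n: "real (level y) \<le> u" "u < real (level y) + 1"
    by (simp_all add: level_def u_def)
  have e: "real R powr u = l / y" using assms l_pos R_pos by (simp add: u_def)
  have "real R ^ level y = real R powr real (level y)" using R_pos by (simp add: powr_realpow)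
  also have "\<dots> \<le> real R powr u" using n(1) R_pos by (intro powr_mono) auto
  finally show "y \<le> l / real R ^ level y"
    using assms R_pos e by (simp add: field_simps)
  have "l / y < real R powr (real (level y) + 1)"
    unfolding e[symmetric] using n(2) R_pos by (intro powr_less_mono) auto
  also have "\<dots> = real R ^ level y * real R"
    using R_pos by (simp add: powr_add powr_realpow)
  finally show "l / real R ^ level y < real R * y"
    using assms R_pos by (simp add: field_simps)
qed

lemma le_level:
  assumes "0 < y" "y \<le> l / real R ^ q"
  shows "q \<le> level y"
proof -
  have "l / real R ^ q \<le> l / 1"
    using R_pos l_pos by (intro divide_left_mono) auto
  then have y: "y \<le> l" using assms by simp
  have "l / real R ^ level y < l * real R / real R ^ q"
    using level_size_less[OF assms(1) y] mult_left_mono[OF assms(2), of "real R"] R_pos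
    by (simp add: mult.commute)
  then have "real R ^ q < real R ^ Suc (level y)"
    using l_pos R_pos by (simp add: field_simps)
  then have "q < Suc (level y)" using R_pos power_less_imp_less_exp by blast
  then show ?thesis by simp
qed

lemma level_le:
  assumes "y \<le> l" "l / real R ^ p \<le> y"
  shows "level y \<le> p"
proof -
  have y: "0 < y" using assms(2) l_pos R_pos
    by (meson divide_pos_pos less_le_trans zero_less_power)
  have "l / real R ^ p \<le> l / real R ^ level y"
    using le_level_size[OF y assms(1)] assms by linarith
  then have "real R ^ level y \<le> real R ^ p"
    using l_pos R_pos by (simp add: field_simps)
  then show ?thesis using R_pos power_le_imp_le_exp by blast
qed

lemma level_Suc_le:
  assumes "0 < y'" "real R * y' \<le> y" "y \<le> l"
  shows "level y < level y'"
proof -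
  have "0 < y" using assms R_pos by (meson less_le_trans mult_pos_pos)
  then have "real R * y' \<le> l / real R ^ level y"
    using le_level_size[OF _ assms(3)] assms(2) by fastforce
  then have "y' \<le> l / real R ^ Suc (level y)"
    using R_pos by (simp add: field_simps)
  then show ?thesis using le_level[OF assms(1)] by fastforce
qed

lemma finite_hits: "finite (hits B n)"
  by (rule finite_subset[of _ "{..<R ^ n}"]) (auto simp: hits_def)

lemma hits_gap:
  assumes "k \<in> hits B n" "k' \<in> hits B n"
  obtains x y where "x \<in> B" "x \<in> cell n k" "y \<in> B" "y \<in> cell n k'"
    "y - x \<ge> (real k' - real k - 1) * (l / real R ^ n)"
proof -
  obtain x y where xy: "x \<in> B" "x \<in> cell n k" "y \<in> B" "y \<in> cell n k'"
    using assms by (auto simp: hits_def)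
  have "(real k' - real k - 1) * (l / real R ^ n) = l * real k' / real R ^ n - l * (real k + 1) / real R ^ n"
    by (simp add: algebra_simps add_divide_distrib)
  also have "\<dots> \<le> y - x" using xy by (simp add: cell_def)
  finally show thesis using that xy by blast
qed

text \<open>Three rather than two because cells are closed: cells \<open>m\<close> and
  \<open>m + 2\<close> are exactly one cell length apart.\<close>

lemma card_hits_le_3:
  assumes "\<And>x y. x \<in> B \<Longrightarrow> y \<in> B \<Longrightarrow> y - x \<le> w" "w \<le> l / real R ^ n"
  shows "card (hits B n) \<le> 3"
proof (cases "hits B n = {}")
  case False
  define m where "m = Min (hits B n)"
  have m: "m \<in> hits B n" using False finite_hits by (simp add: m_def)
  have "hits B n \<subseteq> {m..m + 2}"
  proof
    fix k assume k: "k \<in> hits B n"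
    then have "m \<le> k" using finite_hits by (simp add: m_def)
    moreover have "k \<le> m + 2"
    proof (rule ccontr)
      assume "\<not> k \<le> m + 2"
      then have 2: "real k - real m - 1 \<ge> 2" by simp
      obtain x y where xy: "x \<in> B" "y \<in> B" "y - x \<ge> (real k - real m - 1) * (l / real R ^ n)"
        using hits_gap[OF m k] by metis
      have "2 * (l / real R ^ n) \<le> (real k - real m - 1) * (l / real R ^ n)"
        using 2 l_pos R_pos by (intro mult_right_mono) auto
      moreover have "l / real R ^ n > 0" using l_pos R_pos by simp
      ultimately show False using xy assms(1)[OF xy(1,2)] assms(2) by linarith
    qed
    ultimately show "k \<in> {m..m + 2}" by simp
  qed
  then have "card (hits B n) \<le> card {m..m + 2}" by (intro card_mono) auto
  then show ?thesis by simp
qed simp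

lemma card_hits_point: "card (hits {z} n) \<le> 2"
proof (cases "hits {z} n = {}")
  case False
  define m where "m = Min (hits {z} n)"
  have m: "m \<in> hits {z} n" using False finite_hits by (simp add: m_def)
  have "hits {z} n \<subseteq> {m..m + 1}"
  proof
    fix k assume k: "k \<in> hits {z} n"
    then have "m \<le> k" using finite_hits by (simp add: m_def)
    moreover have "k \<le> m + 1"
    proof (rule ccontr)
      assume "\<not> k \<le> m + 1"
      then have 2: "real k - real m - 1 \<ge> 1" by simp
      obtain x y where xy: "x \<in> {z}" "y \<in> {z}" "y - x \<ge> (real k - real m - 1) * (l / real R ^ n)"
        using hits_gap[OF m k] by metis
      have "1 * (l / real R ^ n) \<le> (real k - real m - 1) * (l / real R ^ n)"
        using 2 l_pos R_pos by (intro mult_right_mono) auto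
      moreover have "l / real R ^ n > 0" using l_pos R_pos by simp
      ultimately show False using xy by auto
    qed
    ultimately show "k \<in> {m..m + 1}" by simp
  qed
  then have "card (hits {z} n) \<le> card {m..m + 1}" by (intro card_mono) auto
  then show ?thesis by simp
qed simp

text \<open>Points in cells whose indices differ by at least 2 are a cell length apart. With
  \<open>m\<close> the first index hit and \<open>m'\<close> the first one from \<open>m + 2\<close>
  on, an index from \<open>m' + 2\<close> on would give three separated points; so the hits form two
  pairs of neighbours.\<close>

lemma card_hits_le_4:
  assumes no3: "\<And>x y z. x \<in> B \<Longrightarrow> y \<in> B \<Longrightarrow> z \<in> B \<Longrightarrow> y - x \<ge> w \<Longrightarrow> z - y \<ge> w \<Longrightarrow> False"
    and w: "w \<le> l / real R ^ n"
  shows "card (hits B n) \<le> 4"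
proof (cases "hits B n = {}")
  case False
  have pos: "l / real R ^ n > 0" using l_pos R_pos by simp
  have sep: "y - x \<ge> w" if "x \<in> cell n k" "y \<in> cell n k'" "k + 2 \<le> k'" for x y k k'
  proof -
    have "1 * (l / real R ^ n) \<le> (real k' - real k - 1) * (l / real R ^ n)"
      using that(3) pos by (intro mult_right_mono) auto
    also have "\<dots> = l * real k' / real R ^ n - l * (real k + 1) / real R ^ n"
      by (simp add: algebra_simps add_divide_distrib)
    also have "\<dots> \<le> y - x" using that by (simp add: cell_def)
    finally show ?thesis using w by simp
  qed
  define m where "m = Min (hits B n)"
  have m: "m \<in> hits B n" using False finite_hits by (simp add: m_def)
  have m_le: "m \<le> k" if "k \<in> hits B n" for k using that finite_hits by (simp add: m_def)
  define S where "S = {k \<in> hits B n. m + 2 \<le> k}"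
  have fS: "finite S" using finite_hits by (simp add: S_def)
  have "\<exists>m'. hits B n \<subseteq> {m, m + 1, m', m' + 1}"
  proof (cases "S = {}")
    case True
    have "k \<in> {m, m + 1, m, m + 1}" if "k \<in> hits B n" for k
      using m_le[OF that] True that by (force simp: S_def)
    then show ?thesis by blast
  next
    case False
    define m' where "m' = Min S"
    have m': "m' \<in> S" using False fS by (simp add: m'_def)
    have m'_le: "m' \<le> k" if "k \<in> S" for k using that fS by (simp add: m'_def)
    have "k \<in> {m, m + 1, m', m' + 1}" if k: "k \<in> hits B n" for k
    proof (cases "k \<in> S")
      case False
      then show ?thesis using m_le[OF k] k by (force simp: S_def)
    next
      case True
      have "\<not> m' + 2 \<le> k"
      proof
        assume "m' + 2 \<le> k"
        moreover have "m + 2 \<le> m'" "m' \<in> hits B n" using m' by (auto simp: S_def)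
        moreover obtain x where "x \<in> B" "x \<in> cell n m" using m by (auto simp: hits_def)
        moreover obtain y where "y \<in> B" "y \<in> cell n m'"
          using \<open>m' \<in> hits B n\<close> by (auto simp: hits_def)
        moreover obtain z where "z \<in> B" "z \<in> cell n k" using k by (auto simp: hits_def)
        ultimately show False using no3 sep by metis
      qed
      then show ?thesis using m'_le[OF True] by auto
    qed
    then show ?thesis by blast
  qed
  then obtain m' where "hits B n \<subseteq> {m, m + 1, m', m' + 1}" by blast
  then have "card (hits B n) \<le> card {m, m + 1, m', m' + 1}" by (intro card_mono) auto
  also have "\<dots> \<le> 4" by (simp add: card_insert_if)
  finally show ?thesis .
qed simp

lemma hits_in_cell:
  assumes "p \<le> q"
  shows "{k' \<in> hits B q. k' div R ^ (q - p) = k} \<subseteq> hits (B \<inter> cell p k) q"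
  using cell_subset[OF assms] by (fastforce simp: hits_def)

lemma card_hits_in_cell:
  assumes "p \<le> q"
  shows "card {k' \<in> hits B q. k' div R ^ (q - p) = k} \<le> card (hits (B \<inter> cell p k) q)"
  using hits_in_cell[OF assms] finite_hits by (intro card_mono) auto

section \<open>Combining schemes, and removing the sets of a cover\<close>

lemma scheme_Plus:
  assumes 1: "scheme T e1 A1 P1 Q1 r1 B1" and 2: "scheme T e2 A2 P2 Q2 r2 B2"
  shows "scheme T (e1 + e2) (A1 <+> A2)
           (case_sum P1 P2) (case_sum Q1 Q2) (case_sum r1 r2) (case_sum B1 B2)"
proof -
  let ?Q = "case_sum Q1 Q2" and ?P = "case_sum P1 P2" and ?r = "case_sum r1 r2"
  \<comment> \<open>A cell alive for the union is alive for each part. Since counts are only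
    required of alive cells, those of the parts remain valid.\<close>
  have al1: "alive A1 Q1 B1 n k" if "alive (A1 <+> A2) ?Q (case_sum B1 B2) n k" for n k
    using that unfolding alive_def by (metis InlI sum.case(1))
  have al2: "alive A2 Q2 B2 n k" if "alive (A1 <+> A2) ?Q (case_sum B1 B2) n k" for n k
    using that unfolding alive_def by (metis InrI sum.case(2))
  have eq: "{\<iota> \<in> A1 <+> A2. ?Q \<iota> = q} = {\<iota>\<in>A1. Q1 \<iota> = q} <+> {\<iota>\<in>A2. Q2 \<iota> = q}" for q
    by auto
  have f: "finite {\<iota>\<in>A1. Q1 \<iota> = q}" "finite {\<iota>\<in>A2. Q2 \<iota> = q}" for q
    using 1 2 by (auto simp: scheme_def)
  have "(\<Sum>\<iota> | \<iota> \<in> A1 <+> A2 \<and> ?Q \<iota> = q. ?r \<iota> / T ^ (q - 1 - ?P \<iota>)) \<le> e1 + e2" for q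
  proof -
    have "(\<Sum>\<iota> | \<iota> \<in> A1 <+> A2 \<and> ?Q \<iota> = q. ?r \<iota> / T ^ (q - 1 - ?P \<iota>)) =
      (\<Sum>\<iota> | \<iota> \<in> A1 \<and> Q1 \<iota> = q. r1 \<iota> / T ^ (q - 1 - P1 \<iota>)) +
      (\<Sum>\<iota> | \<iota> \<in> A2 \<and> Q2 \<iota> = q. r2 \<iota> / T ^ (q - 1 - P2 \<iota>))"
      unfolding eq by (subst sum.Plus) (use f in auto)
    also have "\<dots> \<le> e1 + e2" using 1 2 by (intro add_mono) (auto simp: scheme_def)
    finally show ?thesis .
  qed
  moreover have "?P \<iota> < ?Q \<iota> \<and> 0 \<le> ?r \<iota> \<and>
        (\<forall>k. alive (A1 <+> A2) ?Q (case_sum B1 B2) (?P \<iota>) k \<longrightarrow>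
           real (card {k' \<in> hits (case_sum B1 B2 \<iota>) (?Q \<iota>). k' div R ^ (?Q \<iota> - ?P \<iota>) = k}) \<le> ?r \<iota>)"
    if "\<iota> \<in> A1 <+> A2" for \<iota>
  proof (cases \<iota>)
    case (Inl x)
    then have "x \<in> A1" using that by auto
    then show ?thesis using 1 al1 Inl by (simp add: scheme_def)
  next
    case (Inr y)
    then have "y \<in> A2" using that by auto
    then show ?thesis using 2 al2 Inr by (simp add: scheme_def)
  qed
  moreover have "finite {\<iota> \<in> A1 <+> A2. ?Q \<iota> = q}" for q
    unfolding eq using f by (intro finite_Plus)
  ultimately show ?thesis
    unfolding scheme_def by blast
qed

lemma scheme_Sigma:
  assumes "\<And>t. t < (d::nat) \<Longrightarrow> scheme T e (A t) (P t) (Q t) (r t) (B t)"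
  shows "scheme T (real d * e) (SIGMA t:{..<d}. A t)
           (\<lambda>(t, \<iota>). P t \<iota>) (\<lambda>(t, \<iota>). Q t \<iota>) (\<lambda>(t, \<iota>). r t \<iota>) (\<lambda>(t, \<iota>). B t \<iota>)"
proof -
  let ?A = "SIGMA t:{..<d}. A t" and ?Q = "\<lambda>(t, \<iota>). Q t \<iota>" and ?P = "\<lambda>(t, \<iota>). P t \<iota>"
  let ?r = "\<lambda>(t, \<iota>). r t \<iota>" and ?B = "\<lambda>(t, \<iota>). B t \<iota>"
  have al: "alive (A t) (Q t) (B t) n k" if "t < d" "alive ?A ?Q ?B n k" for t n k
    using that by (auto simp: alive_def)
  have eq: "{\<iota> \<in> ?A. ?Q \<iota> = q} = (SIGMA t:{..<d}. {\<iota>\<in>A t. Q t \<iota> = q})" for q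
    by auto
  have f: "finite {\<iota>\<in>A t. Q t \<iota> = q}" if "t < d" for q t
    using assms that by (auto simp: scheme_def)
  have "(\<Sum>\<iota> | \<iota> \<in> ?A \<and> ?Q \<iota> = q. ?r \<iota> / T ^ (q - 1 - ?P \<iota>)) \<le> real d * e" for q
  proof -
    have "(\<Sum>\<iota> | \<iota> \<in> ?A \<and> ?Q \<iota> = q. ?r \<iota> / T ^ (q - 1 - ?P \<iota>)) =
      (\<Sum>t<d. \<Sum>\<iota> | \<iota> \<in> A t \<and> Q t \<iota> = q. r t \<iota> / T ^ (q - 1 - P t \<iota>))"
      unfolding eq by (subst sum.Sigma) (use f in \<open>auto intro!: sum.cong\<close>)
    also have "\<dots> \<le> (\<Sum>t<d. e)" using assms by (intro sum_mono) (auto simp: scheme_def)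
    finally show ?thesis by simp
  qed
  moreover have "finite {\<iota> \<in> ?A. ?Q \<iota> = q}" for q
    unfolding eq using f by (intro finite_SigmaI) auto
  moreover have "?P \<iota> < ?Q \<iota> \<and> 0 \<le> ?r \<iota> \<and>
        (\<forall>k. alive ?A ?Q ?B (?P \<iota>) k \<longrightarrow>
           real (card {k' \<in> hits (?B \<iota>) (?Q \<iota>). k' div R ^ (?Q \<iota> - ?P \<iota>) = k}) \<le> ?r \<iota>)"
    if "\<iota> \<in> ?A" for \<iota>
  proof -
    obtain t x where x: "\<iota> = (t, x)" "t < d" "x \<in> A t" using \<open>\<iota> \<in> ?A\<close> by blast
    then show ?thesis using assms[OF x(2)] al[OF x(2)] by (auto simp: scheme_def)
  qed
  ultimately show ?thesis unfolding scheme_def by blast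
qed

text \<open>All counting is done from the root, base level 0. A set of diameter at most
  \<open>l * w n powr (1 / s)\<close> is removed at the level \<open>q\<close> of that length, where
  it hits at most 3 cells. There \<open>1 / T ^ q < T * w n\<close>, so its cost
  \<open>3 / T ^ (q - 1)\<close> is at most \<open>3 * T\<^sup>2 * w n\<close>, and these sum to a
  multiple of \<open>W\<close>. The upper bound on \<open>w n\<close> ensures
  \<open>q \<ge> 1\<close>.\<close>

lemma scheme_cover:
  fixes V :: "nat \<Rightarrow> real set" and w :: "nat \<Rightarrow> real"
  assumes s: "0 < s" and w: "\<And>n. 0 < w n" "\<And>n. w n \<le> 1 / real R powr s" "summable w" "suminf w \<le> W"
    and V: "\<And>n x y. x \<in> V n \<Longrightarrow> y \<in> V n \<Longrightarrow> y - x \<le> l * w n powr (1 / s)"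
  shows "scheme (real R powr s) (3 * (real R powr s)\<^sup>2 * W) UNIV
           (\<lambda>_. 0) (\<lambda>n. level (l * w n powr (1 / s))) (\<lambda>_. 3) V"
proof -
  define T where "T = real R powr s"
  define y where "y n = l * w n powr (1 / s)" for n
  have T: "T > 0" using R_pos by (simp add: T_def)
  have y0: "0 < y n" for n using w(1)[of n] l_pos by (simp add: y_def)
  have yR: "y n \<le> l / real R ^ 1" for n
  proof -
    have "w n powr (1 / s) \<le> (1 / real R powr s) powr (1 / s)"
      using w(1,2)[of n] s by (intro powr_mono2) auto
    also have "\<dots> = 1 / real R" using s R_pos by (simp add: powr_divide powr_powr)
    finally have "l * w n powr (1 / s) \<le> l * (1 / real R)" using l_pos by (intro mult_left_mono) auto
    then show ?thesis by (simp add: y_def)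
  qed
  have yl: "y n \<le> l" for n
  proof -
    have "l / real R \<le> l / 1" using l_pos R_pos by (intro divide_left_mono) auto
    then show ?thesis using yR[of n] by simp
  qed
  have Q1: "1 \<le> level (y n)" for n by (rule le_level[OF y0 yR])
  have cost: "1 / T ^ level (y n) < T * w n" for n
  proof -
    have "l / real R ^ level (y n) < real R * y n" by (rule level_size_less[OF y0 yl])
    then have "l * (1 / real R ^ level (y n)) < l * (real R * w n powr (1 / s))"
      by (simp add: y_def mult_ac)
    then have "1 / real R ^ level (y n) < real R * w n powr (1 / s)"
      using l_pos by (simp only: mult_less_cancel_left_pos)
    then have "(1 / real R ^ level (y n)) powr s < (real R * w n powr (1 / s)) powr s"
      using s R_pos by (intro powr_less_mono2) auto
    moreover have "(1 / real R ^ level (y n)) powr s = 1 / T ^ level (y n)"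
      using R_pos by (simp add: T_def powr_divide powr_powr powr_realpow[symmetric] mult.commute)
    moreover have "(real R * w n powr (1 / s)) powr s = T * w n"
      using s w(1)[of n] R_pos by (simp add: T_def powr_mult powr_powr)
    ultimately show ?thesis by simp
  qed
  have fin: "finite {n. level (y n) = q}" for q
  proof -
    have "w \<longlonglongrightarrow> 0" using w(3) by (rule summable_LIMSEQ_zero)
    then have "eventually (\<lambda>n. w n < 1 / T ^ Suc q) sequentially"
      using T by (intro order_tendstoD) auto
    then obtain N where N: "\<And>n. n \<ge> N \<Longrightarrow> w n < 1 / T ^ Suc q"
      by (auto simp: eventually_sequentially)
    have "n < N" if "level (y n) = q" for n
    proof (rule ccontr)
      assume "\<not> n < N"
      then have "w n < 1 / T ^ Suc q" using N by simp
      then have "T * w n < 1 / T ^ q" using T by (simp add: field_simps)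
      then show False using cost[of n] that by simp
    qed
    then show ?thesis by (auto intro: finite_subset[of _ "{..<N}"])
  qed
  have "(\<Sum>n | level (y n) = q. 3 / T ^ (q - 1)) \<le> 3 * T\<^sup>2 * W" for q
  proof -
    have "(\<Sum>n | level (y n) = q. 3 / T ^ (q - 1)) \<le> (\<Sum>n | level (y n) = q. 3 * T\<^sup>2 * w n)"
    proof (rule sum_mono)
      fix n assume n: "n \<in> {n. level (y n) = q}"
      then have "T ^ q = T * T ^ (q - 1)" using Q1[of n] by (cases q) auto
      then have "3 / T ^ (q - 1) = 3 * T * (1 / T ^ q)" using T by (simp add: field_simps)
      also have "\<dots> \<le> 3 * T * (T * w n)"
        using cost[of n] n T by (intro mult_left_mono) auto
      finally show "3 / T ^ (q - 1) \<le> 3 * T\<^sup>2 * w n" by (simp add: power2_eq_square)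
    qed
    also have "\<dots> = 3 * T\<^sup>2 * (\<Sum>n | level (y n) = q. w n)" by (simp add: sum_distrib_left)
    also have "\<dots> \<le> 3 * T\<^sup>2 * suminf w"
      using w T fin by (intro mult_left_mono sum_le_suminf) (auto simp: less_imp_le)
    also have "\<dots> \<le> 3 * T\<^sup>2 * W" using w(4) T by (intro mult_left_mono) auto
    finally show ?thesis .
  qed
  moreover have "real (card {k' \<in> hits (V n) (level (y n)). k' div R ^ (level (y n) - 0) = k}) \<le> 3" for n k
  proof -
    have "card {k' \<in> hits (V n) (level (y n)). k' div R ^ (level (y n) - 0) = k} \<le> card (hits (V n) (level (y n)))"
      by (intro card_mono finite_hits) auto
    also have "\<dots> \<le> 3"
      using V le_level_size[OF y0 yl] by (intro card_hits_le_3[of _ "y n"]) (auto simp: y_def)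
    finally show ?thesis by simp
  qed
  moreover have "0 < level (y n)" for n using Q1[of n] by linarith
  ultimately show ?thesis
    using fin unfolding scheme_def T_def[symmetric] y_def[symmetric] by simp
qed

end

text \<open>One fixed index type, since \<open>removable\<close> cannot quantify over index types.
  The degenerate weights reuse \<open>Tangential\<close> as a mere tag carrying a natural
  number.\<close>

datatype removal = Transversal nat nat | Tangential nat | Low

section \<open>Removable sets and lower bounds for Hausdorff measure\<close>

context grid
begin

lemma scheme_mono: "scheme T e A P Q r B \<Longrightarrow> e \<le> e' \<Longrightarrow> scheme T e' A P Q r B"
  unfolding scheme_def by (meson order_trans)

text \<open>Every positive cost must be attainable, so that several sets and a cover can be paid
  from a single budget.\<close>

definition removable :: "real \<Rightarrow> real set \<Rightarrow> bool" where
  "removable s X \<longleftrightarrow> (\<forall>e>0. \<exists>(A :: removal set) P Q r B.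
     scheme (real R powr s) e A P Q r B \<and> X \<inter> {a..a + l} \<subseteq> (\<Union>\<iota>\<in>A. B \<iota>))"

text \<open>The budget \<open>R - T \<ge> 1\<close> is halved: one half for the \<open>d\<close>
  removable sets, the other for the sets \<open>V n\<close>.\<close>

lemma avoid_removable:
  assumes s: "0 < s" and X: "\<And>t. t < (d::nat) \<Longrightarrow> removable s (X t)"
    and RT: "1 \<le> real R - real R powr s"
  shows "\<exists>\<eta>>0. \<forall>(V :: nat \<Rightarrow> real set) D.
       (\<forall>n. 0 \<le> D n \<and> (\<forall>x\<in>V n. \<forall>y\<in>V n. y - x \<le> D n)) \<and>
       summable (\<lambda>n. D n powr s) \<and> (\<Sum>n. D n powr s) \<le> \<eta> \<longrightarrow>
       (\<exists>x\<in>{a..a + l}. (\<forall>n. x \<notin> V n) \<and> (\<forall>t<d. x \<notin> X t))"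
proof -
  define T where "T = real R powr s"
  define M where "M = 1 / l powr s + 2"
  \<comment> \<open>Solves \<open>3 * T\<^sup>2 * (\<eta> * M) = 1 / 2\<close>, where
    \<open>\<eta> * M\<close> bounds the sum of the weights \<open>w\<close> below.\<close>
  define \<eta> where "\<eta> = 1 / (6 * T\<^sup>2 * M)"
  have T: "1 \<le> T" using R_pos s by (simp add: T_def ge_one_powr_ge_zero)
  have M: "M > 0" using l_pos by (simp add: M_def add_nonneg_pos)
  have \<eta>: "\<eta> > 0" using T M by (simp add: \<eta>_def)
  have \<eta>M: "3 * T\<^sup>2 * (\<eta> * M) = 1 / 2" using T M by (simp add: \<eta>_def)
  define e where "e = 1 / (2 * (real d + 1))"
  have e: "e > 0" "real d * e \<le> 1 / 2" by (simp_all add: e_def field_simps)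
  have "\<forall>t<d. \<exists>(A :: removal set) P Q r B. scheme T e A P Q r B \<and> X t \<inter> {a..a + l} \<subseteq> (\<Union>\<iota>\<in>A. B \<iota>)"
    using X e(1) by (auto simp: removable_def T_def)
  then obtain A :: "nat \<Rightarrow> removal set" and P Q r B where
    S: "\<And>t. t < d \<Longrightarrow> scheme T e (A t) (P t) (Q t) (r t) (B t)"
    and XB: "\<And>t. t < d \<Longrightarrow> X t \<inter> {a..a + l} \<subseteq> (\<Union>\<iota>\<in>A t. B t \<iota>)"
    by metis
  show ?thesis
  proof (intro exI[of _ \<eta>] conjI \<eta> allI impI, elim conjE)
    fix V :: "nat \<Rightarrow> real set" and D
    assume "\<forall>n. 0 \<le> D n \<and> (\<forall>x\<in>V n. \<forall>y\<in>V n. y - x \<le> D n)"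
      and sm: "summable (\<lambda>n. D n powr s)" "(\<Sum>n. D n powr s) \<le> \<eta>"
    then have V: "\<And>n x y. x \<in> V n \<Longrightarrow> y \<in> V n \<Longrightarrow> y - x \<le> D n" and D: "\<And>n. 0 \<le> D n"
      by blast+
    \<comment> \<open>The geometric summand keeps the weights positive when some \<open>D n\<close>
      is 0, as \<open>scheme_cover\<close> demands. Its total \<open>2 * \<eta>\<close> is the 2 in
      \<open>M\<close>.\<close>
    define w where "w n = (D n / l) powr s + \<eta> * (1 / 2) ^ n" for n
    have eq: "(D n / l) powr s = D n powr s / l powr s" for n
      using D l_pos by (simp add: powr_divide)
    have geo: "summable (\<lambda>n. \<eta> * (1 / 2 :: real) ^ n)" "(\<Sum>n. \<eta> * (1 / 2 :: real) ^ n) = 2 * \<eta>"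
      by (auto simp: suminf_mult suminf_geometric)
    have sw: "summable w"
      unfolding w_def eq using sm(1) geo(1) by (intro summable_add summable_divide)
    have "suminf w = (\<Sum>n. D n powr s) / l powr s + 2 * \<eta>"
      unfolding w_def eq using sm(1) geo
      by (subst suminf_add[symmetric]) (auto intro!: summable_divide simp: suminf_divide)
    also have "\<dots> \<le> \<eta> / l powr s + 2 * \<eta>"
      using sm(2) l_pos by (intro add_right_mono divide_right_mono) auto
    finally have W: "suminf w \<le> \<eta> * M" by (simp add: M_def algebra_simps)
    have w0: "0 < w n" for n using \<eta> by (simp add: w_def add_nonneg_pos)
    have w1: "w n \<le> 1 / T" for n
    proof -
      have "w n \<le> suminf w"
        using sum_le_suminf[OF sw, of "{n}"] w0 by (auto simp: less_imp_le)
      also have "\<dots> \<le> \<eta> * M" by (rule W)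
      also have "\<dots> = 1 / (6 * T\<^sup>2)" using M by (simp add: \<eta>_def)
      also have "\<dots> \<le> 1 / T"
      proof (rule divide_left_mono)
        have "T * 1 \<le> T * (6 * T)" using T by (intro mult_left_mono) auto
        then show "T \<le> 6 * T\<^sup>2" by (simp add: power2_eq_square)
      qed (use T in auto)
      finally show ?thesis .
    qed
    have Dw: "D n \<le> l * w n powr (1 / s)" for n
    proof -
      have "D n / l = ((D n / l) powr s) powr (1 / s)"
        using D l_pos s by (simp add: powr_powr)
      also have "\<dots> \<le> w n powr (1 / s)"
        using s \<eta> by (intro powr_mono2) (auto simp: w_def)
      finally show ?thesis using l_pos by (simp add: field_simps)
    qed
    have C: "scheme T (3 * T\<^sup>2 * (\<eta> * M)) UNIV (\<lambda>_. 0) (\<lambda>n. level (l * w n powr (1 / s))) (\<lambda>_. 3) V"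
      unfolding T_def
    proof (rule scheme_cover[OF s w0 _ sw W])
      show "w n \<le> 1 / real R powr s" for n using w1 by (simp add: T_def)
      show "y - x \<le> l * w n powr (1 / s)" if "x \<in> V n" "y \<in> V n" for n x y
        using V[OF that] Dw[of n] by linarith
    qed
    have "real d * e + 3 * T\<^sup>2 * (\<eta> * M) \<le> real R - T"
      using e(2) \<eta>M RT by (simp add: T_def)
    note le = this
    have "scheme T (real d * e) (SIGMA t:{..<d}. A t)
        (\<lambda>(t, \<iota>). P t \<iota>) (\<lambda>(t, \<iota>). Q t \<iota>) (\<lambda>(t, \<iota>). r t \<iota>) (\<lambda>(t, \<iota>). B t \<iota>)"
      by (rule scheme_Sigma[OF S])
    note sch = scheme_mono[OF scheme_Plus[OF this C] le]
    have "0 < T" using T by simp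
    from survivor[OF sch this] obtain x where x: "x \<in> {a..a + l}"
      "\<And>\<iota>. \<iota> \<in> (SIGMA t:{..<d}. A t) <+> UNIV \<Longrightarrow> x \<notin> case_sum (\<lambda>(t, \<iota>). B t \<iota>) V \<iota>"
      by blast
    have "x \<notin> V n" for n using x(2)[of "Inr n"] by auto
    moreover have "x \<notin> X t" if td: "t < d" for t
    proof
      assume "x \<in> X t"
      then obtain \<iota> where \<iota>: "\<iota> \<in> A t" "x \<in> B t \<iota>" using XB[OF td] x(1) by auto
      then show False using x(2)[of "Inl (t, \<iota>)"] td by auto
    qed
    ultimately show "\<exists>x\<in>{a..a + l}. (\<forall>n. x \<notin> V n) \<and> (\<forall>t<d. x \<notin> X t)" using x(1) by blast
  qed
qed

text \<open>A cover of \<open>E\<close> is pulled back along \<open>\<gamma>\<close>. As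
  \<open>\<gamma>\<close> does not contract distances, preimages are no longer than the covering
  sets, and a cover with small sum would miss a point \<open>\<gamma> x\<close> of
  \<open>E\<close>.\<close>

lemma hausdorff_measure_pos:
  fixes E :: "'b::metric_space set" and \<gamma> :: "real \<Rightarrow> 'b"
  assumes s: "0 < s" "0 \<le> s'" "s' \<le> s" and X: "\<And>t. t < (d::nat) \<Longrightarrow> removable s (X t)"
    and RT: "1 \<le> real R - real R powr s"
    and expand: "\<And>x y. \<bar>x - y\<bar> \<le> dist (\<gamma> x) (\<gamma> y)"
    and E: "\<And>x. x \<in> {a..a + l} \<Longrightarrow> (\<And>t. t < d \<Longrightarrow> x \<notin> X t) \<Longrightarrow> \<gamma> x \<in> E"
  shows "hausdorff_measure s' E \<noteq> 0"
proof
  assume H: "hausdorff_measure s' E = 0"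
  have "\<exists>\<eta>>0. \<forall>(V :: nat \<Rightarrow> real set) D.
       (\<forall>n. 0 \<le> D n \<and> (\<forall>x\<in>V n. \<forall>y\<in>V n. y - x \<le> D n)) \<and>
       summable (\<lambda>n. D n powr s) \<and> (\<Sum>n. D n powr s) \<le> \<eta> \<longrightarrow>
       (\<exists>x\<in>{a..a + l}. (\<forall>n. x \<notin> V n) \<and> (\<forall>t<d. x \<notin> X t))"
    by (rule avoid_removable[where d = d]) (use s X RT in auto)
  then obtain \<eta> where \<eta>: "\<eta> > 0" and av: "\<forall>(V :: nat \<Rightarrow> real set) D.
       (\<forall>n. 0 \<le> D n \<and> (\<forall>x\<in>V n. \<forall>y\<in>V n. y - x \<le> D n)) \<and>
       summable (\<lambda>n. D n powr s) \<and> (\<Sum>n. D n powr s) \<le> \<eta> \<longrightarrow>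
       (\<exists>x\<in>{a..a + l}. (\<forall>n. x \<notin> V n) \<and> (\<forall>t<d. x \<notin> X t))"
    by (elim exE conjE) (rule that)
  have "hausdorff_content s' 1 E \<le> hausdorff_measure s' E"
    unfolding hausdorff_measure_def by (rule SUP_upper) simp
  then have "hausdorff_content s' 1 E < ennreal \<eta>" using H \<eta> by simp
  then obtain U :: "nat \<Rightarrow> 'b set" where U: "E \<subseteq> (\<Union>n. U n)"
    "\<And>n. bounded (U n)" "\<And>n. diameter (U n) \<le> 1"
    "(\<Sum>n. ennreal (diam_pow s' (U n))) < ennreal \<eta>"
    unfolding hausdorff_content_def Inf_less_iff by blast
  have d0: "0 \<le> diameter (U n)" for n using U(2) by (rule diameter_ge_0)
  have p0: "0 \<le> diam_pow s' (U n)" for n by (simp add: diam_pow_def)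
  \<comment> \<open>Passing from exponent \<open>s'\<close> to the larger \<open>s\<close> needs
    diameters at most 1. The case \<open>s' = 0\<close> fits in because \<open>diam_pow 0\<close> is
    1 on nonempty sets.\<close>
  have le: "diameter (U n) powr s \<le> diam_pow s' (U n)" for n
  proof (cases "diameter (U n) = 0")
    case False
    then have "diameter (U n) powr s \<le> diameter (U n) powr s'"
      using d0[of n] U(3)[of n] s by (intro powr_mono') auto
    moreover have "U n \<noteq> {}" using False by auto
    moreover have "diameter (U n) powr s \<le> 1 powr s"
      using d0[of n] U(3)[of n] s by (intro powr_mono2) auto
    ultimately show ?thesis by (simp add: diam_pow_def)
  qed (use p0 in simp)
  have sp: "summable (\<lambda>n. diam_pow s' (U n))"
    using U(4) p0 by (intro summable_suminf_not_top) (auto simp: less_top[symmetric])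
  have "ennreal (\<Sum>n. diam_pow s' (U n)) < ennreal \<eta>"
    using U(4) suminf_ennreal2[OF p0 sp] by simp
  then have sp\<eta>: "(\<Sum>n. diam_pow s' (U n)) < \<eta>"
    using \<eta> by (simp add: ennreal_less_iff suminf_nonneg sp p0)
  have sd: "summable (\<lambda>n. diameter (U n) powr s)"
    by (rule summable_comparison_test'[OF sp, of 0]) (use le in simp)
  have "\<exists>x\<in>{a..a + l}. (\<forall>n. x \<notin> \<gamma> -` U n) \<and> (\<forall>t<d. x \<notin> X t)"
  proof (rule av[rule_format, where V = "\<lambda>n. \<gamma> -` U n" and D = "\<lambda>n. diameter (U n)"], intro conjI allI ballI)
    show "(\<Sum>n. diameter (U n) powr s) \<le> \<eta>"
      using suminf_le[OF le sd sp] sp\<eta> by linarith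
    show "y - x \<le> diameter (U n)" if "x \<in> \<gamma> -` U n" "y \<in> \<gamma> -` U n" for n x y
      using expand[of x y] diameter_bounded_bound[OF U(2)[of n], of "\<gamma> x" "\<gamma> y"] that by simp
  qed (use d0 sd in auto)
  then obtain x where "x \<in> {a..a + l}" "\<And>n. \<gamma> x \<notin> U n" "\<And>t. t < d \<Longrightarrow> x \<notin> X t" by auto
  then show False using E U(1) by blast
qed

end

section \<open>Dimension one from its two bounds; measure zero of curves above exponent 1\<close>

lemma hausdorff_dim_eq_1I:
  fixes E :: "'a::metric_space set"
  assumes "\<And>s. 0 \<le> s \<Longrightarrow> s < 1 \<Longrightarrow> hausdorff_measure s E \<noteq> 0"
    and "\<And>s. s > 1 \<Longrightarrow> hausdorff_measure s E = 0"
  shows "hausdorff_dim E = 1"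
proof (rule antisym)
  let ?S = "{s. s \<ge> 0 \<and> hausdorff_measure s E = 0}"
  have bdd: "bdd_below ?S" by (auto intro: bdd_belowI[of _ 0])
  show "hausdorff_dim E \<le> 1"
  proof (rule dense_ge)
    fix s :: real assume "1 < s"
    then have "s \<in> ?S" using assms(2) by auto
    then show "hausdorff_dim E \<le> s"
      unfolding hausdorff_dim_def by (rule cInf_lower[OF _ bdd])
  qed
  have "2 \<in> ?S" using assms(2)[of 2] by simp
  then have "?S \<noteq> {}" by blast
  then show "1 \<le> hausdorff_dim E"
    unfolding hausdorff_dim_def using assms(1) by (intro cInf_greatest) force+
qed

text \<open>No uniform Lipschitz constant is available, as \<open>I\<close> may be unbounded or not
  closed. The sets \<open>S N\<close>, on which both constant and scale are controlled by
  \<open>N + 1\<close>, exhaust \<open>I\<close>. Cutting \<open>S N\<close> into pieces of length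
  \<open>1 / p\<close> gives a sum of order \<open>p powr (1 - s)\<close>, which tends to 0.\<close>

lemma hausdorff_measure_curve_eq_0:
  fixes \<gamma> :: "real \<Rightarrow> 'a::metric_space"
  assumes lip: "\<And>x. x \<in> I \<Longrightarrow> \<exists>K \<delta>. \<delta> > 0 \<and> (\<forall>y\<in>I. \<bar>y - x\<bar> < \<delta> \<longrightarrow> dist (\<gamma> y) (\<gamma> x) \<le> K * \<bar>y - x\<bar>)"
    and E: "E \<subseteq> \<gamma> ` I" and s: "s > 1"
  shows "hausdorff_measure s E = 0"
proof -
  have small: "hausdorff_content s \<delta> E \<le> ennreal \<epsilon>" if \<delta>: "\<delta> > 0" and \<epsilon>: "\<epsilon> > 0" for \<delta> \<epsilon>
  proof -
    define S where "S N = {x\<in>I. \<bar>x\<bar> \<le> real N + 1 \<and>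
        (\<forall>y\<in>I. \<bar>y - x\<bar> < 1 / (real N + 1) \<longrightarrow> dist (\<gamma> y) (\<gamma> x) \<le> (real N + 1) * \<bar>y - x\<bar>)}" for N :: nat
    have cover: "\<exists>N. x \<in> S N" if xI: "x \<in> I" for x
    proof -
      obtain K \<delta>' where K: "\<delta>' > 0" "\<And>y. y \<in> I \<Longrightarrow> \<bar>y - x\<bar> < \<delta>' \<Longrightarrow> dist (\<gamma> y) (\<gamma> x) \<le> K * \<bar>y - x\<bar>"
        using lip[OF xI] by blast
      obtain N :: nat where N: "real N > max (max \<bar>x\<bar> K) (1 / \<delta>')" using reals_Archimedean2 by blast
      have "1 / \<delta>' < real N + 1" using N by simp
      then have "1 / (real N + 1) < \<delta>'" using K(1) by (simp add: field_simps)
      moreover have "K * \<bar>y - x\<bar> \<le> (real N + 1) * \<bar>y - x\<bar>" for y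
        using N by (intro mult_right_mono) auto
      ultimately have "dist (\<gamma> y) (\<gamma> x) \<le> (real N + 1) * \<bar>y - x\<bar>"
        if "y \<in> I" "\<bar>y - x\<bar> < 1 / (real N + 1)" for y
        using K(2)[of y] that by (meson less_trans order_trans)
      then have "x \<in> S N" using xI N by (simp add: S_def)
      then show ?thesis ..
    qed
    \<comment> \<open>The factor \<open>2 * (N + 1) * p + 1\<close> counts the pieces of length
      \<open>1 / p\<close> needed for \<open>[-(N + 1), N + 1]\<close>. All pieces of
      \<open>S N\<close> together may use \<open>\<epsilon> / 2 ^ (N + 1)\<close>.\<close>
    have "\<exists>p>0. real N + 1 < real p \<and> (real N + 1) / real p \<le> \<delta> \<and>
        (2 * (real N + 1) * real p + 1) * ((real N + 1) / real p) powr s \<le> \<epsilon> * (1 / 2) ^ Suc N" for N :: nat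
    proof -
      define C where "C = 3 * (real N + 1) * (real N + 1) powr s"
      have "((\<lambda>p::nat. C * real p powr (1 - s)) \<longlongrightarrow> C * 0) sequentially"
        using s by (intro tendsto_mult_left tendsto_neg_powr filterlim_real_sequentially) auto
      then have "eventually (\<lambda>p::nat. C * real p powr (1 - s) < \<epsilon> * (1 / 2) ^ Suc N) sequentially"
        using \<epsilon> by (intro order_tendstoD(2)) auto
      moreover have "eventually (\<lambda>p::nat. max (real N + 1) ((real N + 1) / \<delta>) < real p) sequentially"
        using filterlim_real_sequentially unfolding filterlim_at_top_dense by blast
      ultimately have "eventually (\<lambda>p::nat. C * real p powr (1 - s) < \<epsilon> * (1 / 2) ^ Suc N \<and>
          max (real N + 1) ((real N + 1) / \<delta>) < real p) sequentially"
        by (rule eventually_conj)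
      then obtain p :: nat where p: "C * real p powr (1 - s) < \<epsilon> * (1 / 2) ^ Suc N"
          "real N + 1 < real p" "(real N + 1) / \<delta> < real p"
        by (metis (no_types, lifting) eventually_happens max_less_iff_conj sequentially_bot)
      have p0: "real p > 0" using p(2) by linarith
      have "1 \<le> (real N + 1) * real p"
        using mult_mono[of 1 "real N + 1" 1 "real p"] p(2) by simp
      then have "(2 * (real N + 1) * real p + 1) * ((real N + 1) / real p) powr s
          \<le> (3 * ((real N + 1) * real p)) * ((real N + 1) / real p) powr s"
        by (intro mult_right_mono) (auto simp: algebra_simps)
      also have "\<dots> = C * real p powr (1 - s)"
        using p0 by (simp add: C_def powr_divide powr_diff field_simps)
      finally have "(2 * (real N + 1) * real p + 1) * ((real N + 1) / real p) powr s \<le> \<epsilon> * (1 / 2) ^ Suc N"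
        using p(1) by linarith
      moreover have "(real N + 1) / real p \<le> \<delta>" using p(3) p0 \<delta> by (simp add: field_simps)
      moreover have "p > 0" using p0 by simp
      ultimately show ?thesis using p(2) by blast
    qed
    then obtain p :: "nat \<Rightarrow> nat" where p: "\<And>N. p N > 0" "\<And>N. real N + 1 < real (p N)"
        "\<And>N. (real N + 1) / real (p N) \<le> \<delta>"
        "\<And>N. (2 * (real N + 1) * real (p N) + 1) * ((real N + 1) / real (p N)) powr s \<le> \<epsilon> * (1 / 2) ^ Suc N"
      by metis
    define piece where "piece N k = {x \<in> S N. real k \<le> (x + (real N + 1)) * real (p N) \<and>
        (x + (real N + 1)) * real (p N) \<le> real k + 1}" for N k :: nat
    define U where "U m = (case prod_decode m of (N, k) \<Rightarrow>
        if k \<le> 2 * (N + 1) * p N then \<gamma> ` piece N k else {})" for m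
    have dist_piece: "dist (\<gamma> x) (\<gamma> y) \<le> (real N + 1) / real (p N)"
      if "x \<in> piece N k" "y \<in> piece N k" for x y N k
    proof -
      have "x * real (p N) - y * real (p N) \<le> 1" "y * real (p N) - x * real (p N) \<le> 1"
        using that by (auto simp: piece_def algebra_simps)
      then have "\<bar>x - y\<bar> * real (p N) \<le> 1"
        by (simp add: abs_if left_diff_distrib)
      then have xy: "\<bar>x - y\<bar> \<le> 1 / real (p N)" using p(1)[of N] by (simp add: field_simps)
      also have "\<dots> < 1 / (real N + 1)" using p(2)[of N] by (intro divide_strict_left_mono) auto
      finally have "dist (\<gamma> x) (\<gamma> y) \<le> (real N + 1) * \<bar>x - y\<bar>"
        using that by (auto simp: piece_def S_def)
      also have "\<dots> \<le> (real N + 1) * (1 / real (p N))" using xy by (intro mult_left_mono) auto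
      finally show ?thesis by simp
    qed
    have diam_piece: "diameter (\<gamma> ` piece N k) \<le> (real N + 1) / real (p N)" for N k
      unfolding diameter_def using dist_piece by (auto intro!: cSUP_least)
    have bdd_piece: "bounded (\<gamma> ` piece N k)" for N k
    proof (cases "piece N k = {}")
      case False
      then obtain x where "x \<in> piece N k" by blast
      then show ?thesis
        unfolding bounded_def using dist_piece[of x N k]
        by (intro exI[of _ "\<gamma> x"] exI[of _ "(real N + 1) / real (p N)"]) auto
    qed simp
    have bU: "bounded (U m)" "diameter (U m) \<le> \<delta>" for m
    proof -
      obtain N k where Nk: "prod_decode m = (N, k)" by fastforce
      show "bounded (U m)" using bdd_piece[of N k] by (simp add: U_def Nk)
      show "diameter (U m) \<le> \<delta>"
        using order_trans[OF diam_piece[of N k] p(3)[of N]] \<delta> by (simp add: U_def Nk)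
    qed
    have EU: "E \<subseteq> (\<Union>m. U m)"
    proof
      fix e assume "e \<in> E"
      then obtain x where x: "x \<in> I" "e = \<gamma> x" using E by blast
      obtain N where N: "x \<in> S N" using cover[OF x(1)] by blast
      define k where "k = nat \<lfloor>(x + (real N + 1)) * real (p N)\<rfloor>"
      have xN: "0 \<le> x + (real N + 1)" "x + (real N + 1) \<le> 2 * (real N + 1)" using N by (auto simp: S_def)
      then have "0 \<le> (x + (real N + 1)) * real (p N)" by simp
      then have k: "real k \<le> (x + (real N + 1)) * real (p N)" "(x + (real N + 1)) * real (p N) \<le> real k + 1"
        by (auto simp: k_def)
      have "real k \<le> 2 * (real N + 1) * real (p N)"
        using k(1) mult_right_mono[OF xN(2), of "real (p N)"] by simp
      then have "real k \<le> real (2 * (N + 1) * p N)" by (simp add: algebra_simps)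
      then have "k \<le> 2 * (N + 1) * p N" by (simp only: of_nat_le_iff)
      then have "e \<in> U (prod_encode (N, k))"
        using k N x by (auto simp: U_def piece_def)
      then show "e \<in> (\<Union>m. U m)" by blast
    qed
    define g where "g = (\<lambda>(N, k). ennreal (diam_pow s (if k \<le> 2 * (N + 1) * p N then \<gamma> ` piece N k else {})))"
    have inner: "(\<Sum>k. g (N, k)) \<le> ennreal (\<epsilon> * (1 / 2) ^ Suc N)" for N
    proof -
      have "(\<Sum>k. g (N, k)) = (\<Sum>k\<le>2 * (N + 1) * p N. g (N, k))"
        by (rule suminf_finite) (auto simp: g_def diam_pow_def)
      also have "\<dots> \<le> (\<Sum>k\<le>2 * (N + 1) * p N. ennreal (((real N + 1) / real (p N)) powr s))"
      proof (rule sum_mono)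
        fix k assume "k \<in> {..2 * (N + 1) * p N}"
        then show "g (N, k) \<le> ennreal (((real N + 1) / real (p N)) powr s)"
          using diam_piece[of N k] diameter_ge_0[OF bdd_piece, of N k] s
          by (auto simp: g_def diam_pow_def intro!: ennreal_leI powr_mono2)
      qed
      also have "\<dots> = ennreal ((2 * (real N + 1) * real (p N) + 1) * ((real N + 1) / real (p N)) powr s)"
        by (subst sum_ennreal) (simp_all add: algebra_simps)
      also have "\<dots> \<le> ennreal (\<epsilon> * (1 / 2) ^ Suc N)" using p(4) by (intro ennreal_leI)
      finally show ?thesis .
    qed
    have "(\<Sum>m. ennreal (diam_pow s (U m))) = (\<Sum>m. g (prod_decode m))"
      by (intro suminf_cong) (auto simp: U_def g_def split: prod.splits)
    also have "\<dots> = (\<Sum>N. \<Sum>k. g (N, k))" by (rule suminf_ennreal_2dimen) simp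
    also have "\<dots> \<le> (\<Sum>N. ennreal (\<epsilon> * (1 / 2) ^ Suc N))" using inner by (intro suminf_le) auto
    also have "\<dots> = ennreal \<epsilon>"
    proof (rule suminf_ennreal_eq)
      show "(\<lambda>N. \<epsilon> * (1 / 2) ^ Suc N) sums \<epsilon>" using sums_mult[OF power_half_series, of \<epsilon>] by simp
    qed (use \<epsilon> in simp)
    finally have "(\<Sum>m. ennreal (diam_pow s (U m))) \<le> ennreal \<epsilon>" .
    moreover have "hausdorff_content s \<delta> E \<le> (\<Sum>m. ennreal (diam_pow s (U m)))"
      unfolding hausdorff_content_def using EU bU
      by (intro Inf_lower CollectI exI[of _ U] conjI refl allI)
    ultimately show ?thesis by (rule order_trans[rotated])
  qed
  have "hausdorff_content s \<delta> E \<le> 0" if "\<delta> > 0" for \<delta>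
  proof (rule ennreal_le_epsilon)
    fix e :: real assume "e > 0"
    then show "hausdorff_content s \<delta> E \<le> 0 + ennreal e" using small[OF that] by simp
  qed
  then have "hausdorff_measure s E \<le> 0"
    unfolding hausdorff_measure_def by (intro SUP_least) auto
  then show ?thesis by simp
qed

section \<open>Transference from integer lines to simultaneous approximation\<close>

definition height :: "real \<Rightarrow> real \<Rightarrow> int \<Rightarrow> int \<Rightarrow> real" where
  "height i j u v = max (\<bar>real_of_int u\<bar> powr (1 / i)) (\<bar>real_of_int v\<bar> powr (1 / j))"

text \<open>The box principle modulo \<open>q\<close>: the box has more than \<open>q\<close>
  integer points, two of them have equal residues, and their difference is the witness.\<close>

lemma small_dvd_combination:
  fixes p r :: int and q :: nat
  assumes q: "q \<ge> 1" and xy: "0 \<le> x" "0 \<le> y" "real q \<le> x * y"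
  obtains u v :: int where "(u, v) \<noteq> (0, 0)" "\<bar>real_of_int u\<bar> \<le> x" "\<bar>real_of_int v\<bar> \<le> y" "int q dvd u * p + v * r"
proof -
  define A where "A = {0..\<lfloor>x\<rfloor>} \<times> {0..\<lfloor>y\<rfloor>}"
  define g where "g = (\<lambda>(u, v). (u * p + v * r) mod int q)"
  have "real (card A) = (real_of_int \<lfloor>x\<rfloor> + 1) * (real_of_int \<lfloor>y\<rfloor> + 1)"
    using xy by (simp add: A_def card_cartesian_product)
  also have "\<dots> > x * y" using xy by (intro mult_strict_mono) linarith+
  finally have "card A > q" using xy by linarith
  moreover have "g ` A \<subseteq> {0..<int q}" using q by (auto simp: g_def)
  then have "card (g ` A) \<le> card {0..<int q}" by (intro card_mono) auto
  ultimately have "card (g ` A) < card A" by simp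
  then have "\<not> inj_on g A" by (rule pigeonhole)
  then obtain u v u' v' where h: "(u, v) \<in> A" "(u', v') \<in> A" "(u, v) \<noteq> (u', v')" "g (u, v) = g (u', v')"
    unfolding inj_on_def by auto
  show thesis
  proof
    show "(u - u', v - v') \<noteq> (0, 0)" using h(3) by auto
    have "\<bar>u - u'\<bar> \<le> \<lfloor>x\<rfloor>" "\<bar>v - v'\<bar> \<le> \<lfloor>y\<rfloor>" using h(1,2) by (auto simp: A_def)
    then show "\<bar>real_of_int (u - u')\<bar> \<le> x" "\<bar>real_of_int (v - v')\<bar> \<le> y" by linarith+
    have "int q dvd (u * p + v * r) - (u' * p + v' * r)"
      using h(4) by (simp add: g_def mod_eq_dvd_iff)
    then show "int q dvd (u - u') * p + (v - v') * r" by (simp add: algebra_simps)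
  qed
qed

text \<open>Suppose \<open>q\<close> violates the claim, with \<open>p\<close>, \<open>r\<close> the
  integers nearest to \<open>q x\<close>, \<open>q y\<close>. Choose \<open>(u, v)\<close> with
  \<open>|u| \<le> q powr i\<close>, \<open>|v| \<le> q powr j\<close> and \<open>q\<close> dividing
  \<open>u p + v r\<close>. Then \<open>q\<close> times the form at \<open>(x, y)\<close> equals
  \<open>u (q x - p) + v (q y - r)\<close>, at most \<open>c' powr i + c' powr j < c\<close>,
  although the height is at most \<open>q\<close>.\<close>

lemma Bad_if_dual:
  fixes x y :: real
  assumes ij: "0 < i" "0 < j" "i + j = 1" and c: "0 < c" "c \<le> 1"
    and dual: "\<And>u v w :: int. (u, v) \<noteq> (0, 0) \<Longrightarrow> c / height i j u v \<le> \<bar>u * x + v * y + w\<bar>"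
  shows "(x, y) \<in> Bad i j"
proof -
  define m where "m = min i j"
  \<comment> \<open>Makes both \<open>c' powr i\<close> and \<open>c' powr j\<close> at most
    \<open>c / 3\<close>, so their sum stays strictly below \<open>c\<close>.\<close>
  define c' where "c' = (c / 3) powr (1 / m)"
  have m: "0 < m" using ij by (simp add: m_def)
  have c': "0 < c'" using c by (simp add: c'_def)
  have c'1: "c' \<le> 1" using c m by (simp add: c'_def powr_le1)
  have c'm: "c' powr m = c / 3" using c m by (simp add: c'_def powr_powr)
  have c'ij: "c' powr i \<le> c / 3" "c' powr j \<le> c / 3"
    using c' c'1 unfolding c'm[symmetric] by (intro powr_mono'; simp add: m_def)+
  have "c' / real q < max (root_conv (nint_dist (real q * x)) i) (root_conv (nint_dist (real q * y)) j)"
    if q: "q \<ge> 1" for q :: nat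
  proof (rule ccontr)
    assume "\<not> ?thesis"
    then have n: "nint_dist (real q * x) powr (1 / i) \<le> c' / real q"
      "nint_dist (real q * y) powr (1 / j) \<le> c' / real q"
      using ij by (auto simp: root_conv_def)
    have q0: "real q > 0" using q by simp
    have nn: "0 \<le> nint_dist z" for z by (simp add: nint_dist_def)
    have bound: "nint_dist z \<le> c' powr e / real q powr e"
      if "nint_dist z powr (1 / e) \<le> c' / real q" "0 < e" for z e
    proof -
      have "(nint_dist z powr (1 / e)) powr e \<le> (c' / real q) powr e"
        using that by (intro powr_mono2) auto
      then show ?thesis using that(2) nn[of z] c' q0 by (simp add: powr_powr powr_divide)
    qed
    have "real q powr i * real q powr j = real q" using ij q0 by (simp flip: powr_add)
    then obtain u v where uv: "(u, v) \<noteq> (0, 0)" "\<bar>real_of_int u\<bar> \<le> real q powr i"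
        "\<bar>real_of_int v\<bar> \<le> real q powr j" "int q dvd u * round (real q * x) + v * round (real q * y)"
      using small_dvd_combination[OF q, of "real q powr i" "real q powr j"
          "round (real q * x)" "round (real q * y)"] by (metis order_refl powr_ge_zero)
    then obtain w where w: "u * round (real q * x) + v * round (real q * y) = int q * w" by blast
    have w': "real_of_int u * real_of_int (round (real q * x)) + real_of_int v * real_of_int (round (real q * y)) = real q * real_of_int w"
      using arg_cong[OF w, of real_of_int] by simp
    have "real q * (u * x + v * y + - w) =
        u * (real q * x - round (real q * x)) + v * (real q * y - round (real q * y))"
      using w' by (simp add: algebra_simps)
    then have "\<bar>real q * (u * x + v * y + - w)\<bar> \<le>
        \<bar>real_of_int u\<bar> * nint_dist (real q * x) + \<bar>real_of_int v\<bar> * nint_dist (real q * y)"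
      by (simp add: nint_dist_def flip: abs_mult)
    also have "\<dots> \<le> real q powr i * (c' powr i / real q powr i) + real q powr j * (c' powr j / real q powr j)"
      using uv bound[OF n(1)] bound[OF n(2)] ij nn by (intro add_mono mult_mono) auto
    also have "\<dots> < c" using c'ij c q0 by simp
    finally have "real q * \<bar>u * x + v * y + - w\<bar> < c"
      using q0 by (simp only: abs_mult abs_of_pos)
    then have small: "\<bar>u * x + v * y + - w\<bar> < c / real q"
      using q0 by (simp only: pos_less_divide_eq mult.commute)
    have root: "\<bar>real_of_int k\<bar> powr (1 / e) \<le> real q" if "\<bar>real_of_int k\<bar> \<le> real q powr e" "0 < e" for k e
      using powr_mono2[OF _ _ that(1), of "1 / e"] that(2) q0 by (simp add: powr_powr)
    have "height i j u v \<le> real q" using root uv ij by (simp add: height_def)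
    moreover have "height i j u v > 0" using uv(1) by (auto simp: height_def less_max_iff_disj)
    ultimately have "c / real q \<le> c / height i j u v" using c by (intro divide_left_mono) auto
    also have "\<dots> \<le> \<bar>u * x + v * y + - w\<bar>" using dual[OF uv(1), of "- w"] by simp
    finally show False using small by simp
  qed
  then show ?thesis using c' by (auto simp: Bad_def)
qed

section \<open>Lines close to a curve\<close>

definition det3 :: "'a::comm_ring \<Rightarrow> 'a \<Rightarrow> 'a \<Rightarrow> 'a \<Rightarrow> 'a \<Rightarrow> 'a \<Rightarrow> 'a \<Rightarrow> 'a \<Rightarrow> 'a \<Rightarrow> 'a" where
  "det3 x1 y1 z1 x2 y2 z2 x3 y3 z3 =
     x1 * (y2 * z3 - y3 * z2) - y1 * (x2 * z3 - x3 * z2) + z1 * (x2 * y3 - x3 * y2)"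

text \<open>If two of the vectors have a nonzero cross product, it is the normal. Otherwise all are
  parallel, and a nonzero vector orthogonal to one of them serves for all.\<close>

lemma plane_through_degenerate:
  fixes A B C :: "'a \<Rightarrow> real"
  assumes "\<And>x y z. x \<in> S \<Longrightarrow> y \<in> S \<Longrightarrow> z \<in> S \<Longrightarrow>
    det3 (A x) (B x) (C x) (A y) (B y) (C y) (A z) (B z) (C z) = 0"
  obtains \<alpha> \<beta> \<gamma> where "(\<alpha>, \<beta>, \<gamma>) \<noteq> (0, 0, 0)" "\<And>x. x \<in> S \<Longrightarrow> \<alpha> * A x + \<beta> * B x + \<gamma> * C x = 0"
proof (cases "\<exists>y\<in>S. \<exists>z\<in>S. (B y * C z - B z * C y, A z * C y - A y * C z, A y * B z - A z * B y) \<noteq> (0, 0, 0)")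
  case True
  then obtain y z where yz: "y \<in> S" "z \<in> S"
    "(B y * C z - B z * C y, A z * C y - A y * C z, A y * B z - A z * B y) \<noteq> (0, 0, 0)" by blast
  show thesis
  proof (rule that[OF yz(3)])
    fix x assume "x \<in> S"
    then show "(B y * C z - B z * C y) * A x + (A z * C y - A y * C z) * B x + (A y * B z - A z * B y) * C x = 0"
      using assms[OF _ yz(1,2), of x] by (simp add: det3_def algebra_simps)
  qed
next
  case False
  then have cross: "B y * C z = B z * C y" "A z * C y = A y * C z" "A y * B z = A z * B y"
    if "y \<in> S" "z \<in> S" for y z using that by auto
  show thesis
  proof (cases "\<exists>y\<in>S. A y \<noteq> 0 \<or> B y \<noteq> 0")
    case True
    then obtain y where y: "y \<in> S" "A y \<noteq> 0 \<or> B y \<noteq> 0" by blast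
    show thesis
      by (rule that[of "- B y" "A y" 0]) (use y cross in \<open>auto simp: mult.commute\<close>)
  next
    case False
    then show thesis by (intro that[of 1 0 0]) auto
  qed
qed

text \<open>In the plane \<open>C\<close> is a combination of \<open>A\<close> and \<open>B\<close>
  with coefficients of modulus at most 1. So it is enough to pigeonhole \<open>(A, B)\<close> into
  \<open>G * G\<close> boxes; closeness of \<open>C\<close> follows.\<close>

lemma close_pair_in_plane:
  fixes A B C :: "'a \<Rightarrow> real"
  assumes fin: "finite S" and card: "card S > G\<^sup>2" and G: "G \<ge> 1"
    and bnd: "\<And>x. x \<in> S \<Longrightarrow> \<bar>A x\<bar> < 1 \<and> \<bar>B x\<bar> < 1"
    and plane: "\<And>x. x \<in> S \<Longrightarrow> \<alpha> * A x + \<beta> * B x + \<gamma> * C x = 0"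
    and \<gamma>: "\<gamma> \<noteq> 0" "\<bar>\<alpha>\<bar> \<le> \<bar>\<gamma>\<bar>" "\<bar>\<beta>\<bar> \<le> \<bar>\<gamma>\<bar>"
  obtains x y where "x \<in> S" "y \<in> S" "x \<noteq> y"
    "\<bar>A x - A y\<bar> \<le> 4 / G" "\<bar>B x - B y\<bar> \<le> 4 / G" "\<bar>C x - C y\<bar> \<le> 4 / G"
proof -
  have G0: "real G > 0" using G by simp
  define c where "c t = \<lfloor>(t + 1) / 2 * real G\<rfloor>" for t :: real
  have c_range: "c t \<in> {0..<int G}" if "\<bar>t\<bar> < 1" for t
  proof -
    have "0 \<le> (t + 1) / 2 * real G" "(t + 1) / 2 * real G < 1 * real G"
      using that G0 by (auto simp: mult_strict_right_mono intro!: mult_nonneg_nonneg mult_strict_right_mono)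
    then show ?thesis by (simp add: c_def floor_less_iff)
  qed
  have c_close: "\<bar>t - t'\<bar> \<le> 2 / G" if "c t = c t'" for t t'
  proof -
    have "\<bar>(t + 1) / 2 * real G - (t' + 1) / 2 * real G\<bar> \<le> 1"
      using that unfolding c_def by linarith
    moreover have "(t + 1) / 2 * real G - (t' + 1) / 2 * real G = (t - t') * (G / 2)"
      by (simp add: field_simps)
    ultimately have "\<bar>t - t'\<bar> * (G / 2) \<le> 1" using G0 by (simp add: abs_mult)
    then show ?thesis using G0 by (simp add: field_simps)
  qed
  define g where "g x = (c (A x), c (B x))" for x
  have "g ` S \<subseteq> {0..<int G} \<times> {0..<int G}" using c_range bnd by (auto simp: g_def)
  then have "card (g ` S) \<le> card ({0..<int G} \<times> {0..<int G})" by (intro card_mono) auto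
  also have "\<dots> = G\<^sup>2" by (simp add: card_cartesian_product power2_eq_square)
  finally have "card (g ` S) < card S" using card by simp
  then have "\<not> inj_on g S" by (rule pigeonhole)
  then obtain x y where xy: "x \<in> S" "y \<in> S" "x \<noteq> y" "g x = g y" unfolding inj_on_def by blast
  have a: "\<bar>A x - A y\<bar> \<le> 2 / G" and b: "\<bar>B x - B y\<bar> \<le> 2 / G"
    using xy(4) c_close by (auto simp: g_def)
  have "\<gamma> * (C x - C y) = - \<alpha> * (A x - A y) - \<beta> * (B x - B y)"
    using plane[OF xy(1)] plane[OF xy(2)] by (simp add: algebra_simps)
  then have "\<bar>\<gamma>\<bar> * \<bar>C x - C y\<bar> \<le> \<bar>\<alpha>\<bar> * \<bar>A x - A y\<bar> + \<bar>\<beta>\<bar> * \<bar>B x - B y\<bar>"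
    by (simp only: abs_mult[symmetric])
  also have "\<dots> \<le> \<bar>\<gamma>\<bar> * (2 / G) + \<bar>\<gamma>\<bar> * (2 / G)"
    using \<gamma> a b by (intro add_mono mult_mono) auto
  finally have "\<bar>\<gamma>\<bar> * \<bar>C x - C y\<bar> \<le> \<bar>\<gamma>\<bar> * (4 / G)" by (simp add: algebra_simps)
  then have "\<bar>C x - C y\<bar> \<le> 4 / G" by (rule mult_left_le_imp_le) (use \<gamma>(1) in simp)
  moreover have "2 / real G \<le> 4 / G" using G0 by (simp add: divide_right_mono)
  ultimately show thesis using that xy a b by force
qed

lemma close_pair_if_degenerate:
  fixes A B C :: "'a \<Rightarrow> real"
  assumes fin: "finite S" and card: "card S > G\<^sup>2" and G: "G \<ge> 1"
    and bnd: "\<And>x. x \<in> S \<Longrightarrow> \<bar>A x\<bar> < 1 \<and> \<bar>B x\<bar> < 1 \<and> \<bar>C x\<bar> < 1"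
    and deg: "\<And>x y z. x \<in> S \<Longrightarrow> y \<in> S \<Longrightarrow> z \<in> S \<Longrightarrow>
      det3 (A x) (B x) (C x) (A y) (B y) (C y) (A z) (B z) (C z) = 0"
  obtains x y where "x \<in> S" "y \<in> S" "x \<noteq> y"
    "\<bar>A x - A y\<bar> \<le> 4 / G" "\<bar>B x - B y\<bar> \<le> 4 / G" "\<bar>C x - C y\<bar> \<le> 4 / G"
proof -
  obtain \<alpha> \<beta> \<gamma> where n: "(\<alpha>, \<beta>, \<gamma>) \<noteq> (0, 0, 0)"
    and pl: "\<And>x. x \<in> S \<Longrightarrow> \<alpha> * A x + \<beta> * B x + \<gamma> * C x = 0"
    using plane_through_degenerate[where A = A and B = B and C = C, OF deg] by blast
  consider "\<gamma> \<noteq> 0" "\<bar>\<alpha>\<bar> \<le> \<bar>\<gamma>\<bar>" "\<bar>\<beta>\<bar> \<le> \<bar>\<gamma>\<bar>" | "\<beta> \<noteq> 0" "\<bar>\<alpha>\<bar> \<le> \<bar>\<beta>\<bar>" "\<bar>\<gamma>\<bar> \<le> \<bar>\<beta>\<bar>"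
    | "\<alpha> \<noteq> 0" "\<bar>\<beta>\<bar> \<le> \<bar>\<alpha>\<bar>" "\<bar>\<gamma>\<bar> \<le> \<bar>\<alpha>\<bar>"
    using n by fastforce
  then show thesis
  proof cases
    case 1
    show thesis
      by (rule close_pair_in_plane[where A = A and B = B and C = C, OF fin card G _ pl 1])
         (use bnd that in auto)
  next
    case 2
    have pl': "\<alpha> * A x + \<gamma> * C x + \<beta> * B x = 0" if "x \<in> S" for x using pl[OF that] by simp
    show thesis
      by (rule close_pair_in_plane[where A = A and B = C and C = B, OF fin card G _ pl' 2])
         (use bnd that in auto)
  next
    case 3
    have pl': "\<beta> * B x + \<gamma> * C x + \<alpha> * A x = 0" if "x \<in> S" for x using pl[OF that] by simp
    show thesis
      by (rule close_pair_in_plane[where A = B and B = C and C = A, OF fin card G _ pl' 3])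
         (use bnd that in auto)
  qed
qed

type_synonym line = "int \<times> int \<times> int"

text \<open>A compact piece of the curve. The second derivative survives only in
  \<open>lipschitz\<close> and \<open>curved\<close>. The lower bound \<open>\<nu>\<close> on
  \<open>f'\<close> makes either coefficient of a line recoverable from the other one and the
  slope.\<close>

locale curve =
  fixes a l :: real and f f' :: "real \<Rightarrow> real" and K \<nu> \<mu> :: real
  assumes l_gt_0: "0 < l" and K_ge_1: "1 \<le> K" and \<nu>: "0 < \<nu>" "\<nu> \<le> 1" and \<mu>: "0 < \<mu>"
    and deriv: "\<And>x. x \<in> {a..a + l} \<Longrightarrow> (f has_real_derivative f' x) (at x within {a..a + l})"
    and slope_bounds: "\<And>x. x \<in> {a..a + l} \<Longrightarrow> \<nu> \<le> \<bar>f' x\<bar> \<and> \<bar>f' x\<bar> \<le> K"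
    and lipschitz: "\<And>x y. x \<in> {a..a + l} \<Longrightarrow> y \<in> {a..a + l} \<Longrightarrow> \<bar>f' y - f' x\<bar> \<le> K * \<bar>y - x\<bar>"
    and curved: "(\<forall>x\<in>{a..a + l}. \<forall>y\<in>{a..a + l}. x \<le> y \<longrightarrow> \<mu> * (y - x) \<le> f' y - f' x) \<or>
      (\<forall>x\<in>{a..a + l}. \<forall>y\<in>{a..a + l}. x \<le> y \<longrightarrow> \<mu> * (y - x) \<le> f' x - f' y)"
begin

definition lin :: "line \<Rightarrow> real \<Rightarrow> real" where
  "lin L x = (case L of (u, v, w) \<Rightarrow> of_int u * x + of_int v * f x + of_int w)"

definition slope :: "line \<Rightarrow> real \<Rightarrow> real" where
  "slope L x = (case L of (u, v, w) \<Rightarrow> of_int u + of_int v * f' x)"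

lemma lin_simp [simp]: "lin (u, v, w) x = of_int u * x + of_int v * f x + of_int w"
  by (simp add: lin_def)

lemma slope_simp [simp]: "slope (u, v, w) x = of_int u + of_int v * f' x"
  by (simp add: slope_def)

lemma lin_deriv:
  "x \<in> {a..a + l} \<Longrightarrow> (lin L has_real_derivative slope L x) (at x within {a..a + l})"
  by (cases L) (auto simp: lin_def[abs_def] intro!: derivative_eq_intros deriv)

lemma lin_mvt:
  assumes "x \<in> {a..a + l}" "y \<in> {a..a + l}" "x < y"
  obtains t where "x < t" "t < y" "lin L y - lin L x = slope L t * (y - x)"
proof -
  have "(lin L has_derivative (*) (slope L t)) (at t within {x..y})" if "t \<in> {x..y}" for t
    using has_derivative_subset[of "lin L" "(*) (slope L t)" t "{a..a + l}" "{x..y}"]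
      lin_deriv[of t L] that assms by (auto simp: has_field_derivative_def)
  then obtain t where "t \<in> {x<..<y}" "lin L y - lin L x = slope L t * (y - x)"
    using mvt_simple[OF assms(3), of "lin L" "\<lambda>t. (*) (slope L t)"] by auto
  then show thesis using that by auto
qed

lemma f_mvt:
  assumes "x \<in> {a..a + l}" "y \<in> {a..a + l}" "x < y"
  obtains t where "x < t" "t < y" "f y - f x = f' t * (y - x)"
  using lin_mvt[OF assms, of "(0, 1, 0)"] by auto

lemma lin_lipschitz:
  assumes "x \<in> {p..q}" "y \<in> {p..q}" "{p..q} \<subseteq> {a..a + l}"
    and "\<And>t. t \<in> {p..q} \<Longrightarrow> \<bar>slope L t\<bar> \<le> B"
  shows "\<bar>lin L y - lin L x\<bar> \<le> B * \<bar>y - x\<bar>"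
proof -
  have *: "\<bar>lin L y - lin L x\<bar> \<le> B * \<bar>y - x\<bar>" if "x < y" "x \<in> {p..q}" "y \<in> {p..q}" for x y
  proof -
    have "x \<in> {a..a + l}" "y \<in> {a..a + l}" using that assms(3) by blast+
    from lin_mvt[OF this that(1), of L]
    obtain t where t: "x < t" "t < y" "lin L y - lin L x = slope L t * (y - x)" .
    have "\<bar>slope L t\<bar> * \<bar>y - x\<bar> \<le> B * \<bar>y - x\<bar>"
      using t that assms(4)[of t] by (intro mult_right_mono) auto
    then show ?thesis using t(3) by (simp add: abs_mult)
  qed
  consider "x < y" | "x = y" | "y < x" by linarith
  then show ?thesis
  proof cases
    case 3
    then show ?thesis using *[of y x] assms by (simp add: abs_minus_commute)
  qed (use * assms in auto)
qed

lemma slope_lipschitz: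
  assumes "x \<in> {a..a + l}" "y \<in> {a..a + l}"
  shows "\<bar>slope (u, v, w) y - slope (u, v, w) x\<bar> \<le> \<bar>of_int v\<bar> * K * \<bar>y - x\<bar>"
proof -
  have "\<bar>slope (u, v, w) y - slope (u, v, w) x\<bar> = \<bar>of_int v\<bar> * \<bar>f' y - f' x\<bar>"
    by (simp add: right_diff_distrib[symmetric] abs_mult)
  also have "\<dots> \<le> \<bar>of_int v\<bar> * (K * \<bar>y - x\<bar>)"
    using lipschitz[OF assms] by (intro mult_left_mono) auto
  finally show ?thesis by (simp add: mult.assoc)
qed

section \<open>Second-order remainders and triples of nearly tangent lines\<close>

lemma remainder_upper:
  assumes "x \<in> {a..a + l}" "y \<in> {a..a + l}"
  shows "\<bar>f y - f x - f' x * (y - x)\<bar> \<le> K * (y - x)\<^sup>2"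
proof -
  have "\<exists>t\<in>{a..a + l}. \<bar>t - x\<bar> \<le> \<bar>y - x\<bar> \<and> f y - f x = f' t * (y - x)"
  proof -
    consider "x < y" | "x = y" | "y < x" by linarith
    then show ?thesis
    proof cases
      case 1
      obtain t where t: "x < t" "t < y" "f y - f x = f' t * (y - x)" using f_mvt[OF assms 1] .
      moreover have "t \<in> {a..a + l}" "\<bar>t - x\<bar> \<le> \<bar>y - x\<bar>" using t assms by auto
      ultimately show ?thesis by blast
    next
      case 2
      then show ?thesis using assms by auto
    next
      case 3
      obtain t where t: "y < t" "t < x" "f x - f y = f' t * (x - y)" using f_mvt[OF assms(2,1) 3] .
      have "f y - f x = f' t * (y - x)" using t(3) by (simp add: algebra_simps)
      moreover have "t \<in> {a..a + l}" "\<bar>t - x\<bar> \<le> \<bar>y - x\<bar>" using t assms by auto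
      ultimately show ?thesis by blast
    qed
  qed
  then obtain t where t: "t \<in> {a..a + l}" "\<bar>t - x\<bar> \<le> \<bar>y - x\<bar>" "f y - f x = f' t * (y - x)" by blast
  have "\<bar>f' t - f' x\<bar> \<le> K * \<bar>y - x\<bar>"
    using lipschitz[OF assms(1) t(1)] t(2) K_ge_1 mult_left_mono[OF t(2), of K] by linarith
  then have "\<bar>f' t - f' x\<bar> * \<bar>y - x\<bar> \<le> K * \<bar>y - x\<bar> * \<bar>y - x\<bar>" by (intro mult_right_mono) auto
  moreover have "f y - f x - f' x * (y - x) = (f' t - f' x) * (y - x)"
    using t(3) by (simp add: algebra_simps)
  ultimately show ?thesis by (simp add: abs_mult power2_eq_square)
qed

text \<open>Split at the midpoint. On the half next to \<open>x\<close> the slope difference has the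
  right sign; on the far half it is at least \<open>\<mu> * \<bar>y - x\<bar> / 2\<close>, over a
  length \<open>\<bar>y - x\<bar> / 2\<close>. This yields \<open>\<mu> / 4\<close> from
  monotonicity of \<open>f'\<close> alone.\<close>

lemma signed_remainder_lower:
  assumes inc: "\<And>x y. x \<in> {a..a + l} \<Longrightarrow> y \<in> {a..a + l} \<Longrightarrow> x \<le> y \<Longrightarrow> \<mu> * (y - x) \<le> \<sigma> * (f' y - f' x)"
    and x: "x \<in> {a..a + l}" "y \<in> {a..a + l}"
  shows "\<mu> / 4 * (y - x)\<^sup>2 \<le> \<sigma> * (f y - f x - f' x * (y - x))"
proof -
  define z where "z = (x + y) / 2"
  have z: "z \<in> {a..a + l}" using x by (auto simp: z_def)
  consider "x < y" | "x = y" | "y < x" by linarith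
  then show ?thesis
  proof cases
    case 1
    then have zz: "x < z" "z < y" by (auto simp: z_def)
    obtain s where s: "x < s" "s < z" "f z - f x = f' s * (z - x)" using f_mvt[OF x(1) z zz(1)] .
    obtain t where t: "z < t" "t < y" "f y - f z = f' t * (y - z)" using f_mvt[OF z x(2) zz(2)] .
    have "0 \<le> \<mu> * (s - x)" using s \<mu> by simp
    also have "\<dots> \<le> \<sigma> * (f' s - f' x)" using s x z by (intro inc) auto
    finally have 1: "0 \<le> \<sigma> * (f' s - f' x) * (z - x)" using zz by simp
    have "\<mu> * (z - x) \<le> \<mu> * (t - x)" using t \<mu> by (intro mult_left_mono) auto
    also have "\<dots> \<le> \<sigma> * (f' t - f' x)" using t zz x z by (intro inc) auto
    finally have 2: "\<mu> * (z - x) * (y - z) \<le> \<sigma> * (f' t - f' x) * (y - z)"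
      using zz by (intro mult_right_mono) auto
    have "\<mu> * (z - x) * (y - z) = \<mu> / 4 * (y - x)\<^sup>2"
      by (simp add: z_def power2_eq_square field_simps)
    moreover have "\<sigma> * (f y - f x - f' x * (y - x)) =
        \<sigma> * (f' s - f' x) * (z - x) + \<sigma> * (f' t - f' x) * (y - z)"
    proof -
      have "f y - f x = f' s * (z - x) + f' t * (y - z)" using s t by linarith
      then have "f y - f x - f' x * (y - x) = (f' s - f' x) * (z - x) + (f' t - f' x) * (y - z)"
        by (simp add: algebra_simps)
      then show ?thesis by (simp only: distrib_left mult.assoc)
    qed
    ultimately show ?thesis using 1 2 by linarith
  next
    case 3
    then have zz: "y < z" "z < x" by (auto simp: z_def)
    obtain s where s: "z < s" "s < x" "f x - f z = f' s * (x - z)" using f_mvt[OF z x(1) zz(2)] .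
    obtain t where t: "y < t" "t < z" "f z - f y = f' t * (z - y)" using f_mvt[OF x(2) z zz(1)] .
    have "0 \<le> \<mu> * (x - s)" using s \<mu> by simp
    also have "\<dots> \<le> \<sigma> * (f' x - f' s)" using s x z by (intro inc) auto
    finally have 1: "0 \<le> \<sigma> * (f' x - f' s) * (x - z)" using zz by simp
    have "\<mu> * (x - z) \<le> \<mu> * (x - t)" using t \<mu> by (intro mult_left_mono) auto
    also have "\<dots> \<le> \<sigma> * (f' x - f' t)" using t zz x z by (intro inc) auto
    finally have 2: "\<mu> * (x - z) * (z - y) \<le> \<sigma> * (f' x - f' t) * (z - y)"
      using zz by (intro mult_right_mono) auto
    have "\<mu> * (x - z) * (z - y) = \<mu> / 4 * (y - x)\<^sup>2"
      by (simp add: z_def power2_eq_square field_simps)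
    moreover have "\<sigma> * (f y - f x - f' x * (y - x)) =
        \<sigma> * (f' x - f' s) * (x - z) + \<sigma> * (f' x - f' t) * (z - y)"
    proof -
      have "f y - f x = - f' s * (x - z) - f' t * (z - y)" using s t by linarith
      then have "f y - f x - f' x * (y - x) = (f' x - f' s) * (x - z) + (f' x - f' t) * (z - y)"
        by (simp add: algebra_simps)
      then show ?thesis by (simp only: distrib_left mult.assoc)
    qed
    ultimately show ?thesis using 1 2 by linarith
  qed simp
qed


lemma curved_sign:
  "\<exists>\<sigma>::real. \<bar>\<sigma>\<bar> = 1 \<and>
    (\<forall>x\<in>{a..a + l}. \<forall>y\<in>{a..a + l}. x \<le> y \<longrightarrow> \<mu> * (y - x) \<le> \<sigma> * (f' y - f' x))"
  using curved
proof
  assume "\<forall>x\<in>{a..a + l}. \<forall>y\<in>{a..a + l}. x \<le> y \<longrightarrow> \<mu> * (y - x) \<le> f' y - f' x"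
  then show ?thesis by (intro exI[of _ 1]) auto
next
  assume "\<forall>x\<in>{a..a + l}. \<forall>y\<in>{a..a + l}. x \<le> y \<longrightarrow> \<mu> * (y - x) \<le> f' x - f' y"
  then show ?thesis by (intro exI[of _ "-1"]) auto
qed

lemma remainder_lower:
  assumes "x \<in> {a..a + l}" "y \<in> {a..a + l}"
  shows "\<mu> / 4 * (y - x)\<^sup>2 \<le> \<bar>f y - f x - f' x * (y - x)\<bar>"
proof -
  obtain \<sigma> :: real where \<sigma>: "\<bar>\<sigma>\<bar> = 1"
    "\<And>x y. x \<in> {a..a + l} \<Longrightarrow> y \<in> {a..a + l} \<Longrightarrow> x \<le> y \<Longrightarrow> \<mu> * (y - x) \<le> \<sigma> * (f' y - f' x)"
    using curved_sign by blast
  have "\<mu> / 4 * (y - x)\<^sup>2 \<le> \<sigma> * (f y - f x - f' x * (y - x))"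
    by (rule signed_remainder_lower[OF \<sigma>(2) assms])
  also have "\<dots> \<le> \<bar>\<sigma> * (f y - f x - f' x * (y - x))\<bar>" by (rule abs_ge_self)
  finally show ?thesis using \<sigma>(1) by (simp add: abs_mult)
qed

text \<open>Evaluated at the middle point, with the sign \<open>\<sigma>\<close> of the curvature,
  both remainders and both slope differences become nonnegative. The determinant turns into a sum of
  two nonnegative products, so nothing cancels.\<close>

lemma wronskian_lower:
  assumes x: "x1 \<in> {a..a + l}" "x2 \<in> {a..a + l}" "x3 \<in> {a..a + l}"
    and \<delta>: "0 \<le> \<delta>" "\<delta> \<le> x2 - x1" "\<delta> \<le> x3 - x2"
  shows "\<mu>\<^sup>2 * \<delta> ^ 3 / 2 \<le> \<bar>(f x2 - f x1 - f' x1 * (x2 - x1)) * (f' x2 - f' x3)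
     - (f' x2 - f' x1) * (f x2 - f x3 - f' x3 * (x2 - x3))\<bar>"
proof -
  obtain \<sigma> :: real where \<sigma>: "\<bar>\<sigma>\<bar> = 1"
    "\<And>x y. x \<in> {a..a + l} \<Longrightarrow> y \<in> {a..a + l} \<Longrightarrow> x \<le> y \<Longrightarrow> \<mu> * (y - x) \<le> \<sigma> * (f' y - f' x)"
    using curved_sign by blast
  define e1 where "e1 = \<sigma> * (f x2 - f x1 - f' x1 * (x2 - x1))"
  define e3 where "e3 = \<sigma> * (f x2 - f x3 - f' x3 * (x2 - x3))"
  define g1 where "g1 = \<sigma> * (f' x2 - f' x1)"
  define g3 where "g3 = \<sigma> * (f' x3 - f' x2)"
  have e1: "\<mu> / 4 * \<delta>\<^sup>2 \<le> e1"
  proof -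
    have "\<mu> / 4 * \<delta>\<^sup>2 \<le> \<mu> / 4 * (x2 - x1)\<^sup>2"
      using \<delta> \<mu> by (intro mult_left_mono power_mono) auto
    also have "\<dots> \<le> e1" unfolding e1_def by (rule signed_remainder_lower[OF \<sigma>(2) x(1,2)])
    finally show ?thesis .
  qed
  have "\<delta>\<^sup>2 \<le> (x2 - x3)\<^sup>2"
    using power_mono[OF \<delta>(3,1), of 2] by (simp add: power2_commute)
  then have e3: "\<mu> / 4 * \<delta>\<^sup>2 \<le> e3"
  proof -
    have "\<mu> / 4 * \<delta>\<^sup>2 \<le> \<mu> / 4 * (x2 - x3)\<^sup>2"
      using \<open>\<delta>\<^sup>2 \<le> (x2 - x3)\<^sup>2\<close> \<mu> by (intro mult_left_mono) auto
    also have "\<dots> \<le> e3" unfolding e3_def by (rule signed_remainder_lower[OF \<sigma>(2) x(3,2)])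
    finally show ?thesis .
  qed
  have g1: "\<mu> * \<delta> \<le> g1"
    unfolding g1_def using \<sigma>(2)[OF x(1,2)] \<delta> mult_left_mono[OF \<delta>(2), of \<mu>] \<mu> by linarith
  have g3: "\<mu> * \<delta> \<le> g3"
    unfolding g3_def using \<sigma>(2)[OF x(2,3)] \<delta> mult_left_mono[OF \<delta>(3), of \<mu>] \<mu> by linarith
  have "\<mu>\<^sup>2 * \<delta> ^ 3 / 2 = (\<mu> / 4 * \<delta>\<^sup>2) * (\<mu> * \<delta>) + (\<mu> * \<delta>) * (\<mu> / 4 * \<delta>\<^sup>2)"
    by (simp add: power2_eq_square power3_eq_cube)
  also have "\<dots> \<le> e1 * g3 + g1 * e3"
  proof -
    have nn: "0 \<le> \<mu> / 4 * \<delta>\<^sup>2" "0 \<le> \<mu> * \<delta>" using \<mu> \<delta> by auto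
    then show ?thesis using e1 e3 g1 g3
      by (intro add_mono mult_mono) linarith+
  qed
  also have "\<dots> \<le> \<bar>e1 * g3 + g1 * e3\<bar>" by simp
  also have "e1 * g3 + g1 * e3 = - (\<sigma> * \<sigma>) * ((f x2 - f x1 - f' x1 * (x2 - x1)) * (f' x2 - f' x3)
     - (f' x2 - f' x1) * (f x2 - f x3 - f' x3 * (x2 - x3)))"
    unfolding e1_def e3_def g1_def g3_def by (simp add: algebra_simps)
  also have "\<sigma> * \<sigma> = 1" using \<sigma>(1) by (metis abs_mult_self_eq mult_1)
  finally show ?thesis by (simp only: abs_mult abs_minus_cancel abs_one mult_1)
qed

text \<open>\<open>(lin, slope, v)\<close> arises from \<open>(w, u, v)\<close> by a triangular
  matrix with ones on the diagonal, whatever the point \<open>x\<close>.\<close>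

lemma det_lin_slope:
  "det3 (lin (u1, v1, w1) x) (slope (u1, v1, w1) x) (of_int v1)
        (lin (u2, v2, w2) x) (slope (u2, v2, w2) x) (of_int v2)
        (lin (u3, v3, w3) x) (slope (u3, v3, w3) x) (of_int v3) = of_int (det3 w1 u1 v1 w2 u2 v2 w3 u3 v3)"
  by (simp add: det3_def algebra_simps)

text \<open>At the middle point the second row is nearly \<open>(0, 0, v2)\<close>, and rows 1 and 3
  are nearly \<open>v1 * (e1, g1, 1)\<close> and \<open>v3 * (e3, g3, 1)\<close>. The determinant is
  \<open>- v2 * X + Y\<close> with \<open>X = F1 * S3 - S1 * F3\<close> and an error
  \<open>Y\<close>. With \<open>\<theta>\<close> a common bound for \<open>B * \<rho>\<close>,
  \<open>\<epsilon>2\<close> and the square root of \<open>\<epsilon>1 * B\<close>, every term has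
  order \<open>\<theta> ^ 3\<close>, so the integer vanishes. Then \<open>v2 * X = Y\<close> bounds
  the main term \<open>v1 * v2 * v3 * (e1 * g3 - g1 * e3)\<close> by errors only.\<close>

lemma tangential_algebra:
  fixes F1 F2 F3 S1 S2 S3 v1 v2 v3 e1 e3 g1 g3 :: real
  assumes v: "\<bar>v1\<bar> \<le> B" "\<bar>v2\<bar> \<le> B" "\<bar>v3\<bar> \<le> B" "b \<le> \<bar>v1\<bar>" "b \<le> \<bar>v2\<bar>" "b \<le> \<bar>v3\<bar>" "0 < b"
    and F2: "\<bar>F2\<bar> \<le> \<epsilon>1" and S2: "\<bar>S2\<bar> \<le> \<epsilon>2"
    and F13: "\<bar>F1 - v1 * e1\<bar> \<le> \<epsilon>1 + \<epsilon>2 * \<rho>" "\<bar>F3 - v3 * e3\<bar> \<le> \<epsilon>1 + \<epsilon>2 * \<rho>"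
    and S13: "\<bar>S1 - v1 * g1\<bar> \<le> \<epsilon>2" "\<bar>S3 - v3 * g3\<bar> \<le> \<epsilon>2"
    and e: "\<bar>e1\<bar> \<le> K * \<rho>\<^sup>2" "\<bar>e3\<bar> \<le> K * \<rho>\<^sup>2" and g: "\<bar>g1\<bar> \<le> K * \<rho>" "\<bar>g3\<bar> \<le> K * \<rho>"
    and \<theta>: "B * \<rho> \<le> \<theta>" "\<theta> \<le> 1" "\<epsilon>2 \<le> \<theta>" "\<epsilon>1 * B \<le> \<theta>\<^sup>2" "6 * (K + 1)\<^sup>2 * \<theta> ^ 3 < 1"
    and \<rho>: "0 \<le> \<rho>"
    and int: "det3 F1 S1 v1 F2 S2 v2 F3 S3 v3 = of_int n"
  shows "b ^ 3 * \<bar>e1 * g3 - g1 * e3\<bar> \<le> 10 * (K + 1) * (\<epsilon>1 * B + \<epsilon>2)"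
proof -
  have B0: "0 < B" using v by linarith
  have \<epsilon>0: "0 \<le> \<epsilon>1" "0 \<le> \<epsilon>2" using F2 S2 by linarith+
  have \<theta>0: "0 \<le> \<theta>" using \<theta>(3) \<epsilon>0 by linarith
  have K0: "0 \<le> K" using K_ge_1 by linarith
  define \<eta> where "\<eta> = \<epsilon>1 * B + \<epsilon>2"
  have \<eta>: "0 \<le> \<epsilon>1 * B" "\<epsilon>1 * B \<le> \<eta>" "\<epsilon>2 \<le> \<eta>" "0 \<le> \<eta>" using \<epsilon>0 B0 by (auto simp: \<eta>_def)
  have \<theta>2: "\<theta>\<^sup>2 \<le> 1" using \<theta>0 \<theta>(2) by (simp add: power_le_one)
  have B\<rho>2: "(B * \<rho>)\<^sup>2 \<le> \<theta>\<^sup>2" using \<theta>(1) B0 \<rho> by (intro power_mono) auto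
  have B\<phi>: "B * (\<epsilon>1 + \<epsilon>2 * \<rho>) \<le> \<epsilon>1 * B + \<epsilon>2 * \<theta>"
    using mult_left_mono[OF \<theta>(1) \<epsilon>0(2)] by (simp add: algebra_simps)
  have \<epsilon>2\<theta>: "\<epsilon>2 * \<theta> \<le> \<epsilon>2" using \<epsilon>0(2) \<theta>(2) by (simp add: mult_left_le)
  have B\<phi>\<eta>: "B * (\<epsilon>1 + \<epsilon>2 * \<rho>) \<le> \<eta>" using B\<phi> \<epsilon>2\<theta> by (simp add: \<eta>_def)
  have B\<phi>\<theta>: "B * (\<epsilon>1 + \<epsilon>2 * \<rho>) \<le> 2 * \<theta>\<^sup>2"
    using B\<phi> \<theta>(4) mult_right_mono[OF \<theta>(3) \<theta>0] by (simp add: power2_eq_square)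
  have Bve: "B * \<bar>v * x\<bar> \<le> K * \<theta>\<^sup>2" if "\<bar>v\<bar> \<le> B" "\<bar>x\<bar> \<le> K * \<rho>\<^sup>2" for v x
  proof -
    have "B * \<bar>v * x\<bar> \<le> B * (B * (K * \<rho>\<^sup>2))"
      using that B0 by (simp add: abs_mult mult_mono)
    also have "\<dots> = K * (B * \<rho>)\<^sup>2" by (simp add: power2_eq_square algebra_simps)
    also have "\<dots> \<le> K * \<theta>\<^sup>2" using B\<rho>2 K0 by (intro mult_left_mono)
    finally show ?thesis .
  qed
  have BF: "B * \<bar>F\<bar> \<le> (K + 2) * \<theta>\<^sup>2"
    if "\<bar>v\<bar> \<le> B" "\<bar>x\<bar> \<le> K * \<rho>\<^sup>2" "\<bar>F - v * x\<bar> \<le> \<epsilon>1 + \<epsilon>2 * \<rho>" for F v x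
  proof -
    have "\<bar>F\<bar> \<le> \<bar>v * x\<bar> + (\<epsilon>1 + \<epsilon>2 * \<rho>)" using that(3) by linarith
    then have "B * \<bar>F\<bar> \<le> B * (\<bar>v * x\<bar> + (\<epsilon>1 + \<epsilon>2 * \<rho>))" using B0 by (intro mult_left_mono) auto
    also have "\<dots> = B * \<bar>v * x\<bar> + B * (\<epsilon>1 + \<epsilon>2 * \<rho>)" by (simp add: distrib_left)
    also have "\<dots> \<le> K * \<theta>\<^sup>2 + 2 * \<theta>\<^sup>2" using Bve[OF that(1,2)] B\<phi>\<theta> by linarith
    finally show ?thesis by (simp add: algebra_simps)
  qed
  note BF1 = BF[OF v(1) e(1) F13(1)] and BF3 = BF[OF v(3) e(2) F13(2)]
  have vg: "\<bar>v * x\<bar> \<le> K * \<theta>" if "\<bar>v\<bar> \<le> B" "\<bar>x\<bar> \<le> K * \<rho>" for v x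
  proof -
    have "\<bar>v * x\<bar> \<le> B * (K * \<rho>)" using that B0 by (simp add: abs_mult mult_mono)
    also have "\<dots> = K * (B * \<rho>)" by simp
    also have "\<dots> \<le> K * \<theta>" using \<theta>(1) K0 by (intro mult_left_mono)
    finally show ?thesis .
  qed
  have S: "\<bar>S\<bar> \<le> (K + 1) * \<theta>" if "\<bar>v\<bar> \<le> B" "\<bar>x\<bar> \<le> K * \<rho>" "\<bar>S - v * x\<bar> \<le> \<epsilon>2" for S v x
    using vg[OF that(1,2)] that(3) \<theta>(3) by (simp add: distrib_right)
  note S1 = S[OF v(1) g(1) S13(1)] and S3 = S[OF v(3) g(2) S13(2)]
  define X where "X = F1 * S3 - S1 * F3"
  define Y where "Y = S2 * (F1 * v3 - F3 * v1) + F2 * (v1 * S3 - S1 * v3)"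
  have det: "of_int n = - v2 * X + Y"
    unfolding int[symmetric] by (simp add: det3_def X_def Y_def algebra_simps)
  have prod: "B * (\<bar>F\<bar> * \<bar>S\<bar>) \<le> (K + 2) * \<theta>\<^sup>2 * ((K + 1) * \<theta>)"
    if "B * \<bar>F\<bar> \<le> (K + 2) * \<theta>\<^sup>2" "\<bar>S\<bar> \<le> (K + 1) * \<theta>" for F S
  proof -
    have "(B * \<bar>F\<bar>) * \<bar>S\<bar> \<le> ((K + 2) * \<theta>\<^sup>2) * ((K + 1) * \<theta>)"
      by (rule mult_mono) (use that K0 in auto)
    then show ?thesis by (simp add: mult.assoc)
  qed
  have vX: "\<bar>v2 * X\<bar> \<le> 2 * ((K + 2) * (K + 1) * \<theta> ^ 3)"
  proof -
    have "\<bar>v2 * X\<bar> \<le> B * (\<bar>F1\<bar> * \<bar>S3\<bar> + \<bar>F3\<bar> * \<bar>S1\<bar>)"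
      unfolding X_def abs_mult using v(2) B0
      by (intro mult_mono) (auto simp flip: abs_mult simp: mult.commute)
    also have "\<dots> = B * (\<bar>F1\<bar> * \<bar>S3\<bar>) + B * (\<bar>F3\<bar> * \<bar>S1\<bar>)" by (rule distrib_left)
    also have "\<dots> \<le> 2 * ((K + 2) * \<theta>\<^sup>2 * ((K + 1) * \<theta>))"
      using prod[OF BF1 S3] prod[OF BF3 S1] by linarith
    also have "\<dots> = 2 * ((K + 2) * (K + 1) * \<theta> ^ 3)"
      by (simp add: power2_eq_square power3_eq_cube)
    finally show ?thesis .
  qed
  have Fv: "\<bar>F1 * v3 - F3 * v1\<bar> \<le> 2 * ((K + 2) * \<theta>\<^sup>2)"
  proof -
    have "\<bar>F1 * v3 - F3 * v1\<bar> \<le> \<bar>F1\<bar> * \<bar>v3\<bar> + \<bar>F3\<bar> * \<bar>v1\<bar>"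
      by (metis abs_mult abs_triangle_ineq4)
    also have "\<dots> \<le> \<bar>F1\<bar> * B + \<bar>F3\<bar> * B" using v by (intro add_mono mult_left_mono) auto
    finally show ?thesis using BF1 BF3 by (simp add: mult.commute)
  qed
  have vS: "B * (2 * ((K + 1) * \<theta>)) \<ge> \<bar>v1 * S3 - S1 * v3\<bar>"
  proof -
    have "\<bar>v1 * S3 - S1 * v3\<bar> \<le> \<bar>v1\<bar> * \<bar>S3\<bar> + \<bar>v3\<bar> * \<bar>S1\<bar>"
      by (metis abs_mult abs_triangle_ineq4 mult.commute)
    also have "\<dots> \<le> B * ((K + 1) * \<theta>) + B * ((K + 1) * \<theta>)"
      using v S1 S3 B0 by (intro add_mono mult_mono) auto
    finally show ?thesis by (simp add: mult_ac)
  qed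
  have Y: "\<bar>Y\<bar> \<le> \<epsilon>2 * (2 * ((K + 2) * \<theta>\<^sup>2)) + (\<epsilon>1 * B) * (2 * ((K + 1) * \<theta>))"
  proof -
    have "\<bar>Y\<bar> \<le> \<bar>S2\<bar> * \<bar>F1 * v3 - F3 * v1\<bar> + \<bar>F2\<bar> * \<bar>v1 * S3 - S1 * v3\<bar>"
      unfolding Y_def by (metis abs_mult abs_triangle_ineq)
    also have "\<dots> \<le> \<epsilon>2 * (2 * ((K + 2) * \<theta>\<^sup>2)) + \<epsilon>1 * (B * (2 * ((K + 1) * \<theta>)))"
      using S2 F2 Fv vS \<epsilon>0 by (intro add_mono mult_mono) auto
    finally show ?thesis by (simp add: mult.assoc)
  qed
  have n0: "n = 0"
  proof -
    have "\<bar>real_of_int n\<bar> \<le> \<bar>v2 * X\<bar> + \<bar>Y\<bar>" unfolding det by linarith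
    also have "\<dots> \<le> 2 * ((K + 2) * (K + 1) * \<theta> ^ 3) + (\<theta> * (2 * ((K + 2) * \<theta>\<^sup>2)) + \<theta>\<^sup>2 * (2 * ((K + 1) * \<theta>)))"
    proof -
      have "\<epsilon>2 * (2 * ((K + 2) * \<theta>\<^sup>2)) \<le> \<theta> * (2 * ((K + 2) * \<theta>\<^sup>2))"
        using \<theta>(3) K0 by (intro mult_right_mono) auto
      moreover have "\<epsilon>1 * B * (2 * ((K + 1) * \<theta>)) \<le> \<theta>\<^sup>2 * (2 * ((K + 1) * \<theta>))"
        using \<theta>(4) K0 \<theta>0 by (intro mult_right_mono) auto
      ultimately show ?thesis using vX Y by linarith
    qed
    also have "\<dots> = (2 * ((K + 2) * (K + 1)) + 2 * (K + 2) + 2 * (K + 1)) * \<theta> ^ 3"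
      by (simp add: power2_eq_square power3_eq_cube algebra_simps)
    also have "\<dots> \<le> (6 * (K + 1)\<^sup>2) * \<theta> ^ 3"
    proof (rule mult_right_mono)
      have "1 \<le> K * K" using mult_mono[OF K_ge_1 K_ge_1] K_ge_1 by simp
      then show "2 * ((K + 2) * (K + 1)) + 2 * (K + 2) + 2 * (K + 1) \<le> 6 * (K + 1)\<^sup>2"
        using K_ge_1 unfolding power2_eq_square by (simp add: algebra_simps)
    qed (use \<theta>0 in simp)
    finally have "\<bar>real_of_int n\<bar> < 1" using \<theta>(5) by linarith
    then show ?thesis by linarith
  qed
  have Y\<eta>: "\<bar>Y\<bar> \<le> (4 * K + 6) * \<eta>"
  proof -
    have "\<epsilon>2 * (2 * ((K + 2) * \<theta>\<^sup>2)) \<le> \<eta> * (2 * ((K + 2) * 1))"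
      using \<eta> \<theta>2 K0 by (intro mult_mono) auto
    moreover have "(\<epsilon>1 * B) * (2 * ((K + 1) * \<theta>)) \<le> \<eta> * (2 * ((K + 1) * 1))"
      using \<eta> \<theta>0 \<theta>(2) K0 by (intro mult_mono) auto
    ultimately show ?thesis using Y by (simp add: algebra_simps)
  qed
  have vXY: "v2 * X = Y" using det n0 by simp
  \<comment> \<open>Telescopes \<open>X\<close> against its main term, so that each summand contains
    one of the small errors.\<close>
  define Z where "Z = (F1 - v1 * e1) * S3 + v1 * e1 * (S3 - v3 * g3) - (S1 - v1 * g1) * F3 - v1 * g1 * (F3 - v3 * e3)"
  have XZ: "X = v1 * v3 * (e1 * g3 - g1 * e3) + Z"
    by (simp add: X_def Z_def algebra_simps)
  have Z: "B * \<bar>Z\<bar> \<le> (4 * K + 3) * \<eta>"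
  proof -
    have K\<theta>: "K * \<theta>\<^sup>2 \<le> K" "(K + 2) * \<theta>\<^sup>2 \<le> K + 2" "(K + 1) * \<theta> \<le> K + 1" "K * \<theta> \<le> K"
      using K0 \<theta>0 \<theta>(2) \<theta>2 by (auto intro: mult_left_le)
    have "B * \<bar>(F1 - v1 * e1) * S3\<bar> \<le> (B * (\<epsilon>1 + \<epsilon>2 * \<rho>)) * ((K + 1) * \<theta>)"
      using F13 S3 B0 \<epsilon>0 \<rho> by (simp add: abs_mult mult.assoc mult_mono)
    also have "\<dots> \<le> \<eta> * ((K + 1) * 1)"
      by (rule mult_mono) (use K\<theta> B\<phi>\<eta> \<theta>(2) \<theta>0 K0 \<eta> in auto)
    finally have 1: "B * \<bar>(F1 - v1 * e1) * S3\<bar> \<le> \<eta> * (K + 1)" by simp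
    have "B * \<bar>v1 * e1 * (S3 - v3 * g3)\<bar> = (B * \<bar>v1 * e1\<bar>) * \<bar>S3 - v3 * g3\<bar>"
      by (simp add: abs_mult)
    also have "\<dots> \<le> (K * \<theta>\<^sup>2) * \<epsilon>2"
      by (rule mult_mono) (use Bve[OF v(1) e(1)] S13 K0 in auto)
    also have "\<dots> \<le> (K * 1) * \<eta>" by (rule mult_mono) (use K\<theta> \<theta>2 \<eta> K0 \<epsilon>0 in auto)
    finally have 2: "B * \<bar>v1 * e1 * (S3 - v3 * g3)\<bar> \<le> \<eta> * K" by (simp add: mult.commute)
    have "B * \<bar>(S1 - v1 * g1) * F3\<bar> = \<bar>S1 - v1 * g1\<bar> * (B * \<bar>F3\<bar>)" by (simp add: abs_mult)
    also have "\<dots> \<le> \<epsilon>2 * ((K + 2) * \<theta>\<^sup>2)" by (rule mult_mono) (use S13 BF3 \<epsilon>0 B0 in auto)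
    also have "\<dots> \<le> \<eta> * ((K + 2) * 1)" by (rule mult_mono) (use K\<theta> \<theta>2 \<eta> K0 in auto)
    finally have 3: "B * \<bar>(S1 - v1 * g1) * F3\<bar> \<le> \<eta> * (K + 2)" by simp
    have "B * \<bar>v1 * g1 * (F3 - v3 * e3)\<bar> = \<bar>v1 * g1\<bar> * (B * \<bar>F3 - v3 * e3\<bar>)" by (simp add: abs_mult)
    also have "\<dots> \<le> (K * \<theta>) * (B * (\<epsilon>1 + \<epsilon>2 * \<rho>))"
      by (rule mult_mono) (use vg[OF v(1) g(1)] F13 B0 K0 \<theta>0 in \<open>auto intro!: mult_left_mono\<close>)
    also have "\<dots> \<le> (K * 1) * \<eta>" by (rule mult_mono) (use K\<theta> B\<phi>\<eta> \<theta> K0 \<theta>0 B0 \<epsilon>0 \<rho> in auto)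
    finally have 4: "B * \<bar>v1 * g1 * (F3 - v3 * e3)\<bar> \<le> \<eta> * K" by (simp add: mult.commute)
    have "\<bar>Z\<bar> \<le> \<bar>(F1 - v1 * e1) * S3\<bar> + \<bar>v1 * e1 * (S3 - v3 * g3)\<bar> + \<bar>(S1 - v1 * g1) * F3\<bar> + \<bar>v1 * g1 * (F3 - v3 * e3)\<bar>"
      unfolding Z_def by linarith
    then have "B * \<bar>Z\<bar> \<le> B * (\<bar>(F1 - v1 * e1) * S3\<bar> + \<bar>v1 * e1 * (S3 - v3 * g3)\<bar> + \<bar>(S1 - v1 * g1) * F3\<bar> + \<bar>v1 * g1 * (F3 - v3 * e3)\<bar>)"
      using B0 by (intro mult_left_mono) auto
    also have "\<dots> \<le> \<eta> * (K + 1) + \<eta> * K + \<eta> * (K + 2) + \<eta> * K"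
      using 1 2 3 4 by (simp only: distrib_left)
    finally show ?thesis by (simp add: algebra_simps)
  qed
  have "b ^ 3 * \<bar>e1 * g3 - g1 * e3\<bar> \<le> (\<bar>v2\<bar> * \<bar>v1\<bar> * \<bar>v3\<bar>) * \<bar>e1 * g3 - g1 * e3\<bar>"
    unfolding power3_eq_cube using v by (intro mult_right_mono mult_mono) auto
  also have "\<dots> = \<bar>v2 * X - v2 * Z\<bar>"
    unfolding XZ by (simp add: abs_mult[symmetric] algebra_simps)
  also have "\<dots> \<le> \<bar>Y\<bar> + \<bar>v2\<bar> * \<bar>Z\<bar>"
    unfolding vXY by (metis abs_mult abs_triangle_ineq4)
  also have "\<bar>v2\<bar> * \<bar>Z\<bar> \<le> B * \<bar>Z\<bar>" using v by (intro mult_right_mono) auto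
  also have "\<bar>Y\<bar> + B * \<bar>Z\<bar> \<le> (4 * K + 6) * \<eta> + (4 * K + 3) * \<eta>" using Y\<eta> Z by linarith
  also have "\<dots> = (8 * K + 9) * \<eta>" by (simp add: algebra_simps)
  also have "\<dots> \<le> 10 * (K + 1) * \<eta>" using K0 \<eta>(4) by (intro mult_right_mono) auto
  finally show ?thesis by (simp add: \<eta>_def)
qed

text \<open>Used in reverse: when \<open>b * \<delta>\<close> is too large for this inequality,
  three tangency points that are \<open>\<delta>\<close>-separated cannot exist.\<close>

lemma tangential_triple:
  assumes x: "x1 \<in> {a..a + l}" "x2 \<in> {a..a + l}" "x3 \<in> {a..a + l}"
    and \<delta>: "0 < \<delta>" "\<delta> \<le> x2 - x1" "\<delta> \<le> x3 - x2" "x3 - x1 \<le> \<rho>"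
    and v: "\<bar>real_of_int v1\<bar> \<le> B" "\<bar>real_of_int v2\<bar> \<le> B" "\<bar>real_of_int v3\<bar> \<le> B"
      "b \<le> \<bar>real_of_int v1\<bar>" "b \<le> \<bar>real_of_int v2\<bar>" "b \<le> \<bar>real_of_int v3\<bar>" "0 < b"
    and lin: "\<bar>lin (u1, v1, w1) x1\<bar> \<le> \<epsilon>1" "\<bar>lin (u2, v2, w2) x2\<bar> \<le> \<epsilon>1" "\<bar>lin (u3, v3, w3) x3\<bar> \<le> \<epsilon>1"
    and slope: "\<bar>slope (u1, v1, w1) x1\<bar> \<le> \<epsilon>2" "\<bar>slope (u2, v2, w2) x2\<bar> \<le> \<epsilon>2" "\<bar>slope (u3, v3, w3) x3\<bar> \<le> \<epsilon>2"
    and \<theta>: "B * \<rho> \<le> \<theta>" "\<theta> \<le> 1" "\<epsilon>2 \<le> \<theta>" "\<epsilon>1 * B \<le> \<theta>\<^sup>2" "6 * (K + 1)\<^sup>2 * \<theta> ^ 3 < 1"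
  shows "\<mu>\<^sup>2 * (b * \<delta>) ^ 3 \<le> 20 * (K + 1) * (\<epsilon>1 * B + \<epsilon>2)"
proof -
  define e1 where "e1 = f x2 - f x1 - f' x1 * (x2 - x1)"
  define e3 where "e3 = f x2 - f x3 - f' x3 * (x2 - x3)"
  define g1 where "g1 = f' x2 - f' x1"
  define g3 where "g3 = f' x2 - f' x3"
  have \<rho>: "0 \<le> \<rho>" "\<bar>x2 - x1\<bar> \<le> \<rho>" "\<bar>x2 - x3\<bar> \<le> \<rho>" using \<delta> by auto
  have K0: "0 \<le> K" using K_ge_1 by linarith
  have \<epsilon>2: "0 \<le> \<epsilon>2" using slope by linarith
  have sq: "(x2 - y)\<^sup>2 \<le> \<rho>\<^sup>2" if "\<bar>x2 - y\<bar> \<le> \<rho>" for y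
    using power_mono[OF that, of 2] by simp
  have e: "\<bar>e1\<bar> \<le> K * \<rho>\<^sup>2" "\<bar>e3\<bar> \<le> K * \<rho>\<^sup>2"
    unfolding e1_def e3_def
    using remainder_upper[OF x(1,2)] remainder_upper[OF x(3,2)]
      mult_left_mono[OF sq[OF \<rho>(2)] K0] mult_left_mono[OF sq[OF \<rho>(3)] K0] by linarith+
  have g: "\<bar>g1\<bar> \<le> K * \<rho>" "\<bar>g3\<bar> \<le> K * \<rho>"
    unfolding g1_def g3_def
    using lipschitz[OF x(1,2)] lipschitz[OF x(3,2)]
      mult_left_mono[OF \<rho>(2) K0] mult_left_mono[OF \<rho>(3) K0] by linarith+
  have F: "\<bar>lin (u, v, w) x2 - v * (f x2 - f y - f' y * (x2 - y))\<bar> \<le> \<epsilon>1 + \<epsilon>2 * \<rho>"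
    if "\<bar>lin (u, v, w) y\<bar> \<le> \<epsilon>1" "\<bar>slope (u, v, w) y\<bar> \<le> \<epsilon>2" "\<bar>x2 - y\<bar> \<le> \<rho>" for u v w y
  proof -
    have "lin (u, v, w) x2 - v * (f x2 - f y - f' y * (x2 - y)) = lin (u, v, w) y + slope (u, v, w) y * (x2 - y)"
      by (simp add: algebra_simps)
    moreover have "\<bar>slope (u, v, w) y * (x2 - y)\<bar> \<le> \<epsilon>2 * \<rho>"
      unfolding abs_mult using that \<epsilon>2 by (intro mult_mono) auto
    ultimately show ?thesis using that(1) by linarith
  qed
  have "b ^ 3 * \<bar>e1 * g3 - g1 * e3\<bar> \<le> 10 * (K + 1) * (\<epsilon>1 * B + \<epsilon>2)"
  proof (rule tangential_algebra[OF v lin(2) slope(2) _ _ _ _ e g \<theta> \<rho>(1) det_lin_slope])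
    show "\<bar>lin (u1, v1, w1) x2 - v1 * e1\<bar> \<le> \<epsilon>1 + \<epsilon>2 * \<rho>"
      unfolding e1_def by (rule F[OF lin(1) slope(1) \<rho>(2)])
    show "\<bar>lin (u3, v3, w3) x2 - v3 * e3\<bar> \<le> \<epsilon>1 + \<epsilon>2 * \<rho>"
      unfolding e3_def by (rule F[OF lin(3) slope(3) \<rho>(3)])
    show "\<bar>slope (u1, v1, w1) x2 - v1 * g1\<bar> \<le> \<epsilon>2"
      using slope(1) by (simp add: g1_def algebra_simps)
    show "\<bar>slope (u3, v3, w3) x2 - v3 * g3\<bar> \<le> \<epsilon>2"
      using slope(3) by (simp add: g3_def algebra_simps)
  qed
  moreover have "\<mu>\<^sup>2 * \<delta> ^ 3 / 2 \<le> \<bar>e1 * g3 - g1 * e3\<bar>"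
    unfolding e1_def e3_def g1_def g3_def using wronskian_lower[OF x _ \<delta>(2,3)] \<delta> by simp
  then have "b ^ 3 * (\<mu>\<^sup>2 * \<delta> ^ 3 / 2) \<le> b ^ 3 * \<bar>e1 * g3 - g1 * e3\<bar>"
    using v by (intro mult_left_mono) auto
  ultimately have "b ^ 3 * (\<mu>\<^sup>2 * \<delta> ^ 3 / 2) \<le> 10 * (K + 1) * (\<epsilon>1 * B + \<epsilon>2)" by linarith
  also have "b ^ 3 * (\<mu>\<^sup>2 * \<delta> ^ 3 / 2) = \<mu>\<^sup>2 * (b * \<delta>) ^ 3 / 2"
    by (simp add: power_mult_distrib)
  finally show ?thesis by linarith
qed

end

section \<open>Heights, coordinates of lines, and crowded cells\<close>

lemma det3_bound:
  fixes x1 :: real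
  assumes "\<bar>x1\<bar> \<le> X" "\<bar>x2\<bar> \<le> X" "\<bar>x3\<bar> \<le> X" "\<bar>y1\<bar> \<le> Y" "\<bar>y2\<bar> \<le> Y" "\<bar>y3\<bar> \<le> Y"
    "\<bar>z1\<bar> \<le> Z" "\<bar>z2\<bar> \<le> Z" "\<bar>z3\<bar> \<le> Z"
  shows "\<bar>det3 x1 y1 z1 x2 y2 z2 x3 y3 z3\<bar> \<le> 6 * (X * Y * Z)"
proof -
  have *: "\<bar>x * y * z\<bar> \<le> X * Y * Z" if "\<bar>x\<bar> \<le> X" "\<bar>y\<bar> \<le> Y" "\<bar>z\<bar> \<le> Z" for x y z
  proof -
    have "0 \<le> X" "0 \<le> Y" "0 \<le> Z" using that by linarith+
    then show ?thesis unfolding abs_mult using that by (intro mult_mono) auto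
  qed
  have "det3 x1 y1 z1 x2 y2 z2 x3 y3 z3 =
      x1 * y2 * z3 - x1 * y3 * z2 - x2 * y1 * z3 + x3 * y1 * z2 + x2 * y3 * z1 - x3 * y2 * z1"
    by (simp add: det3_def algebra_simps)
  also have "\<bar>\<dots>\<bar> \<le> \<bar>x1 * y2 * z3\<bar> + \<bar>x1 * y3 * z2\<bar> + \<bar>x2 * y1 * z3\<bar> + \<bar>x3 * y1 * z2\<bar> + \<bar>x2 * y3 * z1\<bar> + \<bar>x3 * y2 * z1\<bar>"
    by linarith
  also have "\<dots> \<le> 6 * (X * Y * Z)"
    using *[OF assms(1,5,9)] *[OF assms(1,6,8)] *[OF assms(2,4,9)] *[OF assms(3,4,8)]
      *[OF assms(2,6,7)] *[OF assms(3,5,7)] by linarith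
  finally show ?thesis .
qed

lemma det3_scale:
  fixes x1 :: real
  shows "det3 (x1 / \<alpha>) (y1 / \<beta>) (z1 / \<gamma>) (x2 / \<alpha>) (y2 / \<beta>) (z2 / \<gamma>) (x3 / \<alpha>) (y3 / \<beta>) (z3 / \<gamma>) =
    det3 x1 y1 z1 x2 y2 z2 x3 y3 z3 / (\<alpha> * \<beta> * \<gamma>)"
  by (simp add: det3_def divide_inverse algebra_simps)

lemma height_less_coord:
  assumes "height i j u v < Y" "0 < i" "0 < j"
  shows "\<bar>real_of_int u\<bar> < Y powr i" "\<bar>real_of_int v\<bar> < Y powr j"
proof -
  have *: "\<bar>real_of_int k\<bar> < Y powr e" if "\<bar>real_of_int k\<bar> powr (1 / e) < Y" "0 < e" for k e
  proof -
    have "(\<bar>real_of_int k\<bar> powr (1 / e)) powr e < Y powr e"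
      using that by (intro powr_less_mono2) auto
    then show ?thesis using that(2) by (simp add: powr_powr)
  qed
  show "\<bar>real_of_int u\<bar> < Y powr i" "\<bar>real_of_int v\<bar> < Y powr j"
    using assms by (auto simp: height_def intro!: *)
qed

text \<open>Shrinking both coefficients by \<open>t \<le> 1\<close> gains
  \<open>t powr (1 / i)\<close> in one and \<open>t powr (1 / j)\<close> in the other; the larger
  weight determines what is guaranteed.\<close>

lemma height_le_scaled:
  assumes "\<bar>real_of_int u\<bar> \<le> t * Y powr i" "\<bar>real_of_int v\<bar> \<le> t * Y powr j"
    and "0 < t" "t \<le> 1" "0 < Y" "0 < i" "i \<le> M" "0 < j" "j \<le> M"
  shows "height i j u v \<le> t powr (1 / M) * Y"
proof -
  have *: "\<bar>real_of_int k\<bar> powr (1 / e) \<le> t powr (1 / M) * Y"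
    if "\<bar>real_of_int k\<bar> \<le> t * Y powr e" "0 < e" "e \<le> M" for k e
  proof -
    have "\<bar>real_of_int k\<bar> powr (1 / e) \<le> (t * Y powr e) powr (1 / e)"
      using that by (intro powr_mono2) auto
    also have "\<dots> = t powr (1 / e) * Y"
      using that assms by (simp add: powr_mult powr_powr)
    also have "t powr (1 / e) \<le> t powr (1 / M)"
      using that assms by (intro powr_mono') (auto simp: frac_le)
    finally show ?thesis using assms by (simp add: mult_right_mono)
  qed
  show ?thesis using assms * by (simp add: height_def)
qed

lemma height_ge_1: "0 < i \<Longrightarrow> 0 < j \<Longrightarrow> (u, v) \<noteq> (0, 0) \<Longrightarrow> 1 \<le> height i j u v"
proof -
  assume ij: "0 < i" "0 < j" "(u, v) \<noteq> (0, 0)"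
  have *: "1 \<le> \<bar>real_of_int k\<bar> powr (1 / e)" if "k \<noteq> 0" "0 < e" for k e
  proof -
    have "1 \<le> \<bar>k\<bar>" using that by linarith
    then have "1 \<le> \<bar>real_of_int k\<bar>" by linarith
    then show ?thesis using that by (intro ge_one_powr_ge_zero) auto
  qed
  show ?thesis using ij *[of u i] *[of v j] by (auto simp: height_def le_max_iff_disj)
qed

text \<open>The coordinate with the smaller exponent: \<open>(lin, slope, lesser_coord)\<close> are coordinates of a line
  in \<open>\<real>\<^sup>3\<close> in which all weights are treated alike.\<close>

definition lesser_coord :: "real \<Rightarrow> real \<Rightarrow> line \<Rightarrow> real" where
  "lesser_coord i j L = (case L of (u, v, w) \<Rightarrow> if i < j then of_int u else of_int v)"

lemma lesser_coord_less:
  assumes "height i j u v < Y" "0 < i" "0 < j"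
  shows "\<bar>lesser_coord i j (u, v, w)\<bar> < Y powr min i j"
  using height_less_coord[OF assms] by (auto simp: lesser_coord_def min_def)

context curve
begin

definition CK :: real where "CK = (1 + K) / \<nu>"

lemma CK_ge_1: "1 \<le> CK" and K_le_CK: "1 + K \<le> CK"
proof -
  have "(1 + K) * \<nu> \<le> (1 + K) * 1" using \<nu> K_ge_1 by (intro mult_left_mono) auto
  then show "1 + K \<le> CK" using \<nu> by (simp add: CK_def field_simps)
  then show "1 \<le> CK" using K_ge_1 by linarith
qed

text \<open>The slope and one coefficient determine the other. If \<open>u\<close> is the known one,
  solving for \<open>v\<close> divides by \<open>f'\<close>, which is the \<open>\<nu>\<close> in
  \<open>CK\<close>.\<close>

lemma coord_bounds:
  assumes x: "x \<in> {a..a + l}"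
  shows "\<bar>real_of_int u\<bar> \<le> CK * (\<bar>slope (u, v, w) x\<bar> + \<bar>lesser_coord i j (u, v, w)\<bar>)" (is ?U)
    and "\<bar>real_of_int v\<bar> \<le> CK * (\<bar>slope (u, v, w) x\<bar> + \<bar>lesser_coord i j (u, v, w)\<bar>)" (is ?V)
proof -
  define S where "S = \<bar>slope (u, v, w) x\<bar>"
  have S: "0 \<le> S" by (simp add: S_def)
  have triv: "t \<le> CK * (S + t)" if "0 \<le> t" for t
  proof -
    have "t \<le> 1 * (S + t)" using S by simp
    also have "\<dots> \<le> CK * (S + t)" using CK_ge_1 S that by (intro mult_right_mono) auto
    finally show ?thesis .
  qed
  have "?U \<and> ?V"
  proof (cases "i < j")
    case True
    have "\<bar>real_of_int v\<bar> * \<nu> \<le> \<bar>real_of_int v\<bar> * \<bar>f' x\<bar>"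
      using slope_bounds[OF x] by (intro mult_left_mono) auto
    also have "\<dots> = \<bar>of_int v * f' x\<bar>" by (simp add: abs_mult)
    also have "\<dots> \<le> S + \<bar>real_of_int u\<bar>" by (simp add: S_def)
    also have "\<dots> \<le> (1 + K) * (S + \<bar>real_of_int u\<bar>)"
      using K_ge_1 S by (simp add: distrib_right)
    finally have "\<bar>real_of_int v\<bar> \<le> (1 + K) * (S + \<bar>real_of_int u\<bar>) / \<nu>"
      using \<nu> by (simp add: field_simps)
    then have "\<bar>real_of_int v\<bar> \<le> CK * (S + \<bar>real_of_int u\<bar>)" by (simp add: CK_def)
    then show ?thesis using triv[of "\<bar>real_of_int u\<bar>"] True by (simp add: lesser_coord_def S_def)
  next
    case False
    have "\<bar>real_of_int u\<bar> \<le> S + \<bar>of_int v * f' x\<bar>" by (simp add: S_def)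
    also have "\<bar>of_int v * f' x\<bar> \<le> \<bar>real_of_int v\<bar> * K"
      using slope_bounds[OF x] by (auto simp: abs_mult intro!: mult_left_mono)
    also have "S + \<bar>real_of_int v\<bar> * K \<le> (1 + K) * (S + \<bar>real_of_int v\<bar>)"
      using K_ge_1 S by (simp add: algebra_simps)
    also have "\<dots> \<le> CK * (S + \<bar>real_of_int v\<bar>)"
      using K_le_CK S by (intro mult_right_mono) auto
    finally show ?thesis using triv[of "\<bar>real_of_int v\<bar>"] False by (simp add: lesser_coord_def S_def)
  qed
  then show ?U ?V by auto
qed

text \<open>In these coordinates the determinant is an integer \<open>n\<close>, or
  \<open>- f' x * n\<close> when \<open>u\<close> takes the place of \<open>v\<close>; hence the
  threshold \<open>\<nu>\<close> instead of 1.\<close>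

lemma small_det_eq_0:
  assumes x: "x \<in> {a..a + l}"
    and small: "\<bar>det3 (lin L1 x) (slope L1 x) (lesser_coord i j L1) (lin L2 x) (slope L2 x) (lesser_coord i j L2)
       (lin L3 x) (slope L3 x) (lesser_coord i j L3)\<bar> < \<nu>"
  shows "det3 (lin L1 x) (slope L1 x) (lesser_coord i j L1) (lin L2 x) (slope L2 x) (lesser_coord i j L2)
       (lin L3 x) (slope L3 x) (lesser_coord i j L3) = 0" (is "?d = 0")
proof -
  obtain u1 v1 w1 u2 v2 w2 u3 v3 w3 where L: "L1 = (u1, v1, w1)" "L2 = (u2, v2, w2)" "L3 = (u3, v3, w3)"
    by (metis prod_cases3)
  define n where "n = det3 w1 u1 v1 w2 u2 v2 w3 u3 v3"
  show ?thesis
  proof (cases "i < j")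
    case False
    then have d: "?d = of_int n" using det_lin_slope by (simp add: L lesser_coord_def n_def)
    then have "\<bar>real_of_int n\<bar> < 1" using small \<nu> by linarith
    then have "n = 0" by linarith
    then show ?thesis using d by simp
  next
    case True
    have d: "?d = - (f' x * of_int n)"
      using True by (simp add: L lesser_coord_def n_def det3_def algebra_simps)
    have "\<nu> * \<bar>real_of_int n\<bar> \<le> \<bar>f' x\<bar> * \<bar>real_of_int n\<bar>"
      using slope_bounds[OF x] by (intro mult_right_mono) auto
    also have "\<dots> < \<nu>" using small unfolding d by (simp add: abs_mult)
    finally have "\<bar>real_of_int n\<bar> < 1" using \<nu> by simp
    then have "n = 0" by linarith
    then show ?thesis using d by simp
  qed
qed

lemma slope_variation:
  assumes x: "x \<in> {a..a + l}" "y \<in> {a..a + l}" "\<bar>y - x\<bar> \<le> \<rho>"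
    and L: "\<bar>slope (u, v, w) x\<bar> \<le> D" "\<bar>lesser_coord i j (u, v, w)\<bar> \<le> Z"
  shows "\<bar>slope (u, v, w) y - slope (u, v, w) x\<bar> \<le> K * CK * \<rho> * (D + Z)"
proof -
  have "\<bar>slope (u, v, w) y - slope (u, v, w) x\<bar> \<le> \<bar>of_int v\<bar> * K * \<bar>y - x\<bar>"
    by (rule slope_lipschitz[OF x(1,2)])
  also have "\<dots> \<le> (CK * (D + Z)) * K * \<rho>"
  proof (intro mult_mono)
    have "\<bar>real_of_int v\<bar> \<le> CK * (\<bar>slope (u, v, w) x\<bar> + \<bar>lesser_coord i j (u, v, w)\<bar>)"
      by (rule coord_bounds(2)[OF x(1)])
    also have "\<dots> \<le> CK * (D + Z)" using L CK_ge_1 by (intro mult_left_mono) auto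
    finally show "\<bar>of_int v\<bar> \<le> CK * (D + Z)" .
  qed (use L CK_ge_1 K_ge_1 x in auto)
  finally show ?thesis by (simp add: mult_ac)
qed

text \<open>The lines through a crowded cell span a plane of \<open>\<real>\<^sup>3\<close>, because their determinants are
  integers of absolute value below 1. Pigeonholing in this plane gains a factor \<open>G\<close> from
  only \<open>G\<^sup>2\<close> lines, where the whole space would require \<open>G\<^sup>3\<close>.\<close>

lemma crowded_cell:
  assumes ij: "0 < i" "0 < j"
    and J: "a \<le> p" "p + \<rho> \<le> a + l" "0 < \<rho>" and Y: "0 < Y" and D: "0 < D"
    and S: "finite S" "card S > G\<^sup>2" "G \<ge> 1"
    and mem: "\<And>u v w. (u, v, w) \<in> S \<Longrightarrow> height i j u v < Y \<and>
      (\<exists>x\<in>{p..p + \<rho>}. \<bar>lin (u, v, w) x\<bar> \<le> D * \<rho> \<and> \<bar>slope (u, v, w) x\<bar> < D)"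
    and var: "K * CK * \<rho> * (D + Y powr min i j) \<le> D / 8"
    and det: "36 * (D * \<rho>) * D * Y powr min i j < \<nu>"
    and G12: "12 * (D * \<rho>) < G"
    and DK: "D \<le> K1 * Y powr max i j" and K1: "0 \<le> K1" "8 * CK * (K1 + 1) \<le> G" and Y1: "1 \<le> Y"
  obtains u v w where "(u, v) \<noteq> (0, 0)" "height i j u v \<le> (8 * CK * (K1 + 1) / G) powr (1 / max i j) * Y"
    "\<And>x. x \<in> {p..p + \<rho>} \<Longrightarrow> \<bar>lin (u, v, w) x\<bar> \<le> 28 * (D * \<rho>) / G"
    "\<And>x. x \<in> {p..p + \<rho>} \<Longrightarrow> \<bar>slope (u, v, w) x\<bar> \<le> 16 * D / G"
proof -
  define Z where "Z = Y powr min i j"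
  have Z: "Z > 0" using Y by (simp add: Z_def)
  have G0: "real G > 0" using S(3) by simp
  have sub: "{p..p + \<rho>} \<subseteq> {a..a + l}" using J by auto
  have pJ: "p \<in> {p..p + \<rho>}" "p \<in> {a..a + l}" using J by auto
  have D\<rho>: "0 < D * \<rho>" using D J by simp
  \<comment> \<open>All lines are compared at the left endpoint \<open>p\<close>. By
    \<open>var\<close> the slope moves by at most \<open>D / 8\<close> on the way there. The factors
    3, 2 and 1 here, with the six terms of \<open>det3\<close>, account for the 36 in
    \<open>det\<close>.\<close>
  have bnd: "\<bar>lin L p\<bar> < 3 * (D * \<rho>) \<and> \<bar>slope L p\<bar> < 2 * D \<and> \<bar>lesser_coord i j L\<bar> < Z" if LS: "L \<in> S" for L
  proof -
    obtain u v w where L: "L = (u, v, w)" by (metis prod_cases3)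
    obtain x where x: "x \<in> {p..p + \<rho>}" "\<bar>lin L x\<bar> \<le> D * \<rho>" "\<bar>slope L x\<bar> < D" "height i j u v < Y"
      using mem[of u v w] LS L by auto
    have z: "\<bar>lesser_coord i j L\<bar> < Z"
      using lesser_coord_less[OF x(4) ij] by (simp add: Z_def L)
    have sl: "\<bar>slope L t\<bar> \<le> 9 / 8 * D" if "t \<in> {p..p + \<rho>}" for t
    proof -
      have "\<bar>slope L t - slope L x\<bar> \<le> K * CK * \<rho> * (D + Z)"
        unfolding L using x z that sub by (intro slope_variation[where i = i and j = j]) (auto simp: L)
      also have "\<dots> \<le> D / 8" using var by (simp add: Z_def)
      finally show ?thesis using x(3) by linarith
    qed
    have "\<bar>lin L p - lin L x\<bar> \<le> 9 / 8 * D * \<bar>p - x\<bar>"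
      using lin_lipschitz[OF x(1) pJ(1) sub sl] by blast
    also have "\<dots> \<le> 9 / 8 * D * \<rho>" using x(1) D by (intro mult_left_mono) auto
    finally have "\<bar>lin L p - lin L x\<bar> \<le> 9 / 8 * (D * \<rho>)" by (simp only: mult.assoc)
    moreover have "\<bar>lin L p\<bar> \<le> \<bar>lin L p - lin L x\<bar> + \<bar>lin L x\<bar>" by linarith
    ultimately have "\<bar>lin L p\<bar> \<le> 17 / 8 * (D * \<rho>)" using x(2) by linarith
    then show ?thesis using sl[OF pJ(1)] z D D\<rho> by linarith
  qed
  have "36 * (D * \<rho>) * D * Z < \<nu>" using det by (simp add: Z_def)
  then have deg: "det3 (lin L1 p) (slope L1 p) (lesser_coord i j L1) (lin L2 p) (slope L2 p) (lesser_coord i j L2)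
       (lin L3 p) (slope L3 p) (lesser_coord i j L3) = 0" if "L1 \<in> S" "L2 \<in> S" "L3 \<in> S" for L1 L2 L3
    using det3_bound[of "lin L1 p" "3 * (D * \<rho>)" "lin L2 p" "lin L3 p" "slope L1 p" "2 * D" "slope L2 p" "slope L3 p"
        "lesser_coord i j L1" Z "lesser_coord i j L2" "lesser_coord i j L3"]
      bnd[OF that(1)] bnd[OF that(2)] bnd[OF that(3)]
    by (intro small_det_eq_0 pJ) (simp add: mult_ac)
  obtain L L' where L: "L \<in> S" "L' \<in> S" "L \<noteq> L'"
    and close: "\<bar>lin L p / (3 * (D * \<rho>)) - lin L' p / (3 * (D * \<rho>))\<bar> \<le> 4 / G"
      "\<bar>slope L p / (2 * D) - slope L' p / (2 * D)\<bar> \<le> 4 / G"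
      "\<bar>lesser_coord i j L / Z - lesser_coord i j L' / Z\<bar> \<le> 4 / G"
  proof (rule close_pair_if_degenerate[where A = "\<lambda>L. lin L p / (3 * (D * \<rho>))" and B = "\<lambda>L. slope L p / (2 * D)"
        and C = "\<lambda>L. lesser_coord i j L / Z", OF S])
    fix L assume "L \<in> S"
    with bnd[OF this] D D\<rho> Z J show "\<bar>lin L p / (3 * (D * \<rho>))\<bar> < 1 \<and> \<bar>slope L p / (2 * D)\<bar> < 1 \<and> \<bar>lesser_coord i j L / Z\<bar> < 1"
      by (simp add: abs_mult)
  next
    fix L1 L2 L3 assume "L1 \<in> S" "L2 \<in> S" "L3 \<in> S"
    then show "det3 (lin L1 p / (3 * (D * \<rho>))) (slope L1 p / (2 * D)) (lesser_coord i j L1 / Z)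
        (lin L2 p / (3 * (D * \<rho>))) (slope L2 p / (2 * D)) (lesser_coord i j L2 / Z)
        (lin L3 p / (3 * (D * \<rho>))) (slope L3 p / (2 * D)) (lesser_coord i j L3 / Z) = 0"
      unfolding det3_scale using deg by simp
  qed blast
  obtain u1 v1 w1 u2 v2 w2 where L12: "L = (u1, v1, w1)" "L' = (u2, v2, w2)" by (metis prod_cases3)
  \<comment> \<open>The difference of two lines that are close in all three normalised coordinates:
    again an integer line, with coordinates smaller by a factor of order \<open>G\<close>.\<close>
  define u v w where "u = u1 - u2" and "v = v1 - v2" and "w = w1 - w2"
  have unscale: "\<bar>s - t\<bar> \<le> 4 / G * e" if "\<bar>s / e - t / e\<bar> \<le> 4 / G" "e > 0" for s t e :: real
  proof -
    have "\<bar>s / e - t / e\<bar> * e \<le> 4 / G * e" using that by (intro mult_right_mono) auto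
    moreover have "\<bar>s / e - t / e\<bar> * e = \<bar>s - t\<bar>"
      using that(2) by (simp add: diff_divide_distrib[symmetric])
    ultimately show ?thesis by simp
  qed
  have lp: "\<bar>lin (u, v, w) p\<bar> \<le> 4 / G * (3 * (D * \<rho>))"
    using unscale[OF close(1)] D\<rho> by (simp add: L12 u_def v_def w_def algebra_simps)
  have sp: "\<bar>slope (u, v, w) p\<bar> \<le> 4 / G * (2 * D)"
    using unscale[OF close(2)] D by (simp add: L12 u_def v_def w_def algebra_simps)
  have zp: "\<bar>lesser_coord i j (u, v, w)\<bar> \<le> 4 / G * Z"
    using unscale[OF close(3)] Z by (auto simp: L12 u_def v_def w_def lesser_coord_def split: if_splits)
  have slope: "\<bar>slope (u, v, w) t\<bar> \<le> 9 * D / G" if "t \<in> {p..p + \<rho>}" for t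
  proof -
    have "\<bar>slope (u, v, w) t - slope (u, v, w) p\<bar> \<le> K * CK * \<rho> * (4 / G * (2 * D) + 4 / G * Z)"
      using that sub pJ J by (intro slope_variation[OF _ _ _ sp zp]) auto
    also have "\<dots> \<le> K * CK * \<rho> * (8 / G * (D + Z))"
      using K_ge_1 CK_ge_1 J G0 Z by (intro mult_left_mono) (auto simp: field_simps)
    also have "\<dots> = 8 / G * (K * CK * \<rho> * (D + Z))" by simp
    also have "\<dots> \<le> 8 / G * (D / 8)" using var G0 by (intro mult_left_mono) (auto simp: Z_def)
    finally have "\<bar>slope (u, v, w) t - slope (u, v, w) p\<bar> \<le> D / G" by simp
    moreover have "4 / G * (2 * D) = 8 * (D / G)" "9 * D / G = 9 * (D / G)" by simp_all
    ultimately show ?thesis using sp by linarith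
  qed
  have lin: "\<bar>lin (u, v, w) t\<bar> \<le> 28 * (D * \<rho>) / G" if "t \<in> {p..p + \<rho>}" for t
  proof -
    have "\<bar>lin (u, v, w) t - lin (u, v, w) p\<bar> \<le> 9 * D / G * \<bar>t - p\<bar>"
      using lin_lipschitz[OF pJ(1) that sub slope] by blast
    also have "\<dots> \<le> 9 * D / G * \<rho>" using that D G0 by (intro mult_left_mono) auto
    finally have "\<bar>lin (u, v, w) t - lin (u, v, w) p\<bar> \<le> 9 * (D * \<rho> / G)" by simp
    moreover have "4 / G * (3 * (D * \<rho>)) = 12 * (D * \<rho> / G)" "28 * (D * \<rho>) / G = 28 * (D * \<rho> / G)" by simp_all
    moreover have "0 \<le> D * \<rho> / G" using D\<rho> by simp
    ultimately show ?thesis using lp by linarith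
  qed
  \<comment> \<open>Were \<open>u = v = 0\<close>, then \<open>w\<close> would be an integer of
    modulus at most \<open>12 * (D * \<rho>) / G < 1\<close>, hence 0, and the two lines would
    coincide.\<close>
  have uv0: "(u, v) \<noteq> (0, 0)"
  proof
    assume 0: "(u, v) = (0, 0)"
    then have "\<bar>real_of_int w\<bar> \<le> 12 * (D * \<rho>) / G" using lp by simp
    also have "\<dots> < 1" using G12 G0 by simp
    finally have "w = 0" by linarith
    then show False using 0 L(3) by (auto simp: L12 u_def v_def w_def)
  qed
  define t where "t = 8 * CK * (K1 + 1) / G"
  have t: "0 < t" "t \<le> 1" using CK_ge_1 K1 G0 by (auto simp: t_def)
  have ZM: "Z \<le> Y powr max i j" unfolding Z_def using Y1 by (intro powr_mono) auto
  have sz: "\<bar>slope (u, v, w) p\<bar> + \<bar>lesser_coord i j (u, v, w)\<bar> \<le> 8 / G * ((K1 + 1) * Y powr max i j)"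
  proof -
    have "\<bar>slope (u, v, w) p\<bar> + \<bar>lesser_coord i j (u, v, w)\<bar> \<le> 8 / G * D + 8 / G * Z"
      using sp zp Z G0 by (simp add: field_simps)
    also have "\<dots> = 8 / G * (D + Z)" by (simp add: distrib_left)
    also have "\<dots> \<le> 8 / G * ((K1 + 1) * Y powr max i j)"
      using DK ZM G0 by (intro mult_left_mono) (auto simp: distrib_right)
    finally show ?thesis .
  qed
  have tM: "CK * (8 / G * ((K1 + 1) * Y powr max i j)) = t * Y powr max i j" by (simp add: t_def)
  have big: "\<bar>real_of_int u\<bar> \<le> t * Y powr max i j" "\<bar>real_of_int v\<bar> \<le> t * Y powr max i j"
    unfolding tM[symmetric] using CK_ge_1 mult_left_mono[OF sz, of CK]
      coord_bounds[OF pJ(2), where u = u and v = v and w = w and i = i and j = j] by linarith+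
  have t4: "4 / G * Z \<le> t * Z"
  proof -
    have "1 * 1 \<le> CK * (K1 + 1)" using CK_ge_1 K1 by (intro mult_mono) auto
    then have "4 \<le> 8 * CK * (K1 + 1)" unfolding mult.assoc by linarith
    then have "4 / G \<le> t" unfolding t_def by (intro divide_right_mono) auto
    then show ?thesis using Z by (intro mult_right_mono) auto
  qed
  \<comment> \<open>The coefficient with the smaller weight is bounded by \<open>zp\<close>, the one
    with the larger weight by \<open>big\<close>; each is compared with the power of
    \<open>Y\<close> belonging to its own weight.\<close>
  have "\<bar>real_of_int u\<bar> \<le> t * Y powr i \<and> \<bar>real_of_int v\<bar> \<le> t * Y powr j"
  proof (cases "i < j")
    case True
    then show ?thesis using big(2) order_trans[OF zp t4] by (simp add: lesser_coord_def Z_def)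
  next
    case False
    then have "min i j = j" "max i j = i" by auto
    then show ?thesis using big(1) order_trans[OF zp t4] False by (simp add: lesser_coord_def Z_def)
  qed
  then have "height i j u v \<le> t powr (1 / max i j) * Y"
    using t Y ij by (intro height_le_scaled) auto
  then have h: "height i j u v \<le> (8 * CK * (K1 + 1) / G) powr (1 / max i j) * Y"
    by (simp only: t_def)
  have "9 * D / G \<le> 16 * D / G" using D G0 by (simp add: divide_right_mono)
  then have sl: "\<bar>slope (u, v, w) x\<bar> \<le> 16 * D / G" if "x \<in> {p..p + \<rho>}" for x
    using slope[OF that] by linarith
  show thesis by (rule that[OF uv0 h lin sl])
qed

text \<open>By \<open>var\<close> the slope cannot drop below half of its minimal size
  \<open>D / r\<close> inside the cell, so the form leaves \<open>[- \<epsilon>, \<epsilon>]\<close>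
  after the stated length.\<close>

lemma line_spread:
  assumes ij: "0 < i" "0 < j" and J: "a \<le> p" "p + \<rho> \<le> a + l" "0 \<le> \<rho>" and D: "0 < D" and r: "1 \<le> r"
    and L: "height i j u v < Y" and x0: "x0 \<in> {p..p + \<rho>}" "D / r \<le> \<bar>slope (u, v, w) x0\<bar>" "\<bar>slope (u, v, w) x0\<bar> < D"
    and var: "K * CK * \<rho> * (D + Y powr min i j) \<le> D / (2 * r)"
    and x: "x \<in> {p..p + \<rho>}" "\<bar>lin (u, v, w) x\<bar> \<le> \<epsilon>" and y: "y \<in> {p..p + \<rho>}" "\<bar>lin (u, v, w) y\<bar> \<le> \<epsilon>"
  shows "y - x \<le> 4 * \<epsilon> * r / D"
proof (cases "x < y")
  case True
  have sub: "{p..p + \<rho>} \<subseteq> {a..a + l}" using J by auto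
  have "x \<in> {a..a + l}" "y \<in> {a..a + l}" using x y sub by blast+
  from lin_mvt[OF this True, of "(u, v, w)"]
  obtain t where t: "x < t" "t < y" "lin (u, v, w) y - lin (u, v, w) x = slope (u, v, w) t * (y - x)" .
  have "\<bar>slope (u, v, w) t - slope (u, v, w) x0\<bar> \<le> K * CK * \<rho> * (D + Y powr min i j)"
    using t x y x0 J lesser_coord_less[OF L ij, of w] by (intro slope_variation[where i = i and j = j]) auto
  then have "D / (2 * r) \<le> \<bar>slope (u, v, w) t\<bar>"
    using var x0(2) by (simp add: field_simps)
  then have "D / (2 * r) * (y - x) \<le> \<bar>slope (u, v, w) t\<bar> * (y - x)"
    using True by (intro mult_right_mono) auto
  also have "\<dots> = \<bar>lin (u, v, w) y - lin (u, v, w) x\<bar>"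
    unfolding t(3) using True by (simp add: abs_mult)
  also have "\<dots> \<le> 2 * \<epsilon>" using x y by linarith
  finally show ?thesis using D r by (simp add: field_simps)
next
  case False
  have "0 \<le> \<epsilon>" using x by linarith
  then have "0 \<le> 4 * \<epsilon> * r / D" using D r by simp
  then show ?thesis using False by linarith
qed

end

section \<open>Classification of the removed lines\<close>

text \<open>\<open>R_gain\<close> says that \<open>s\<close> exceeds \<open>2 * M / (1 + M)\<close>
  with a factor 2 to spare, which pays for a geometric series over the slope classes.
  \<open>R_s\<close> does the same for the tangential classes.\<close>

locale weighted = curve a l f f' K \<nu> \<mu> + grid a l R for a l f f' K \<nu> \<mu> R +
  fixes i j s :: real
  assumes ij: "0 < i" "0 < j" "i + j = 1"
    and s: "1 / 2 \<le> s" "s < 1"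
    and R_large: "1000 * CK * (K + 3) \<le> \<nu> * real R"
    and R_s: "4 \<le> real R powr (s / 32)"
    and R_gain: "2 \<le> real R powr ((s - 2 * max i j / (1 + max i j)) / 16)"
begin

abbreviation "m \<equiv> min i j"
abbreviation "M \<equiv> max i j"

lemma mM: "m + M = 1" "1 / 2 \<le> M" "M < 1" "0 < m" "m \<le> 1 / 2"
  using ij by (auto simp: min_def max_def)

lemma R_consts: "1000 * CK \<le> R" "1000 * (K + 3) \<le> R" "1000 * CK * (K + 3) \<le> R" "1000 * (K + 3) \<le> \<nu> * R" "4000 \<le> real R"
proof -
  have "\<nu> * real R \<le> 1 * real R" using \<nu> by (intro mult_right_mono) auto
  then show 1: "1000 * CK * (K + 3) \<le> R" using R_large by simp
  have "1000 * 1 * (K + 3) \<le> 1000 * CK * (K + 3)" using CK_ge_1 K_ge_1 by (intro mult_right_mono) auto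
  then show 2: "1000 * (K + 3) \<le> \<nu> * R" "1000 * (K + 3) \<le> R" using 1 R_large by linarith+
  have "1000 * CK * 1 \<le> 1000 * CK * (K + 3)" using CK_ge_1 K_ge_1 by (intro mult_left_mono) auto
  then show "1000 * CK \<le> R" using 1 by simp
  have "4000 \<le> 1000 * (K + 3)" using K_ge_1 by simp
  also have "\<dots> \<le> real R" by (rule 2)
  finally show "4000 \<le> real R" .
qed

text \<open>\<open>slope_bound h 0\<close> exceeds every slope of height class \<open>h\<close> on
  the curve; \<open>n\<close> counts how many factors \<open>R\<close> the slope lies below
  that.\<close>

definition slope_bound :: "nat \<Rightarrow> nat \<Rightarrow> real" where
  "slope_bound h n = (K + 2) * (real R ^ (h + 1)) powr M / real R ^ n"

text \<open>Slopes below \<open>1 / steep h\<close> count as tangential.\<close>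

definition steep :: "nat \<Rightarrow> real" where
  "steep h = (real R ^ h) powr (1 / 8)"

definition line_in_class :: "nat \<Rightarrow> line \<Rightarrow> bool" where
  "line_in_class h L \<longleftrightarrow> (case L of (u, v, w) \<Rightarrow>
     (u, v) \<noteq> (0, 0) \<and> real R ^ h \<le> height i j u v \<and> height i j u v < real R ^ (h + 1))"

definition low_set :: "nat \<Rightarrow> real \<Rightarrow> real set" where
  "low_set h0 c = {x \<in> {a..a + l}. \<exists>u v w. (u, v) \<noteq> (0, 0) \<and> height i j u v < real R ^ h0 \<and>
     \<bar>lin (u, v, w) x\<bar> < c / height i j u v}"

definition tangential_set :: "real \<Rightarrow> nat \<Rightarrow> real set" where
  "tangential_set c h = {x \<in> {a..a + l}. \<exists>u v w. line_in_class h (u, v, w) \<and>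
     \<bar>lin (u, v, w) x\<bar> < c / height i j u v \<and> \<bar>slope (u, v, w) x\<bar> < 1 / steep h}"

definition transversal_set :: "real \<Rightarrow> nat \<Rightarrow> nat \<Rightarrow> real set" where
  "transversal_set c h n = {x \<in> {a..a + l}. \<exists>u v w. line_in_class h (u, v, w) \<and>
     \<bar>lin (u, v, w) x\<bar> < c / height i j u v \<and>
     slope_bound h n / R \<le> \<bar>slope (u, v, w) x\<bar> \<and> \<bar>slope (u, v, w) x\<bar> < slope_bound h n}"

lemma steep_ge_1: "1 \<le> steep h"
  unfolding steep_def using R_pos by (intro ge_one_powr_ge_zero) auto

lemma steep_pow: "steep h ^ 8 = real R ^ h"
proof -
  have "steep h ^ 8 = steep h powr 8"
    using powr_realpow[of "steep h" 8] steep_ge_1[of h] by simp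
  then show ?thesis using R_pos by (simp add: steep_def powr_powr)
qed

lemma steep_half: "(real R ^ h) powr (1 / 2) = steep h ^ 4"
proof -
  have "steep h ^ 4 = steep h powr 4"
    using powr_realpow[of "steep h" 4] steep_ge_1[of h] by simp
  then show ?thesis using R_pos by (simp add: steep_def powr_powr)
qed

lemma slope_bound_pos: "0 < slope_bound h n"
  using K_ge_1 R_pos by (simp add: slope_bound_def)

lemma classD:
  assumes "line_in_class h (u, v, w)"
  shows "(u, v) \<noteq> (0, 0)" "real R ^ h \<le> height i j u v" "height i j u v < real R ^ (h + 1)"
    "0 < height i j u v" "c \<ge> 0 \<Longrightarrow> c / height i j u v \<le> c / real R ^ h"
proof -
  show 1: "(u, v) \<noteq> (0, 0)" "real R ^ h \<le> height i j u v" "height i j u v < real R ^ (h + 1)"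
    using assms by (auto simp: line_in_class_def)
  show "0 < height i j u v" using 1(2) R_pos by (meson less_le_trans zero_less_power)
  then show "c \<ge> 0 \<Longrightarrow> c / height i j u v \<le> c / real R ^ h"
    using 1(2) R_pos by (intro divide_left_mono) auto
qed

lemma ex_class:
  assumes "(u, v) \<noteq> (0, 0)"
  shows "\<exists>h. line_in_class h (u, v, w)"
proof -
  define H where "H = height i j u v"
  have H: "1 \<le> H" using height_ge_1[OF ij(1,2) assms] by (simp add: H_def)
  define h where "h = nat \<lfloor>log R H\<rfloor>"
  have lg: "0 \<le> log R H" using H R_pos by simp
  then have b: "real h \<le> log R H" "log R H < real h + 1" by (simp_all add: h_def)
  have "real R ^ h = R powr real h" "real R ^ (h + 1) = R powr (real h + 1)"
    using R_pos by (simp_all add: powr_add powr_realpow)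
  moreover have "R powr log R H = H" using H R_pos by simp
  moreover have "R powr real h \<le> R powr log R H" using b R_pos by (intro powr_mono) auto
  moreover have "R powr log R H < R powr (real h + 1)" using b R_pos by (intro powr_less_mono) auto
  ultimately show ?thesis using assms
    by (intro exI[of _ h]) (simp add: line_in_class_def H_def del: power_Suc)
qed

lemma ex_slope_class:
  assumes L: "line_in_class h (u, v, w)" and x: "x \<in> {a..a + l}" and st: "1 / steep h \<le> \<bar>slope (u, v, w) x\<bar>"
  obtains n where "slope_bound h n / R \<le> \<bar>slope (u, v, w) x\<bar>" "\<bar>slope (u, v, w) x\<bar> < slope_bound h n"
    "1 / steep h \<le> slope_bound h n"
proof -
  define S where "S = \<bar>slope (u, v, w) x\<bar>"
  define Y where "Y = real R ^ (h + 1)"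
  have Y: "1 \<le> Y" unfolding Y_def using R_pos by (intro one_le_power) auto
  have "0 < 1 / steep h" using steep_ge_1[of h] by simp
  then have S0: "0 < S" using st unfolding S_def by linarith
  have iM: "Y powr i \<le> Y powr M" "Y powr j \<le> Y powr M" using Y by (auto intro: powr_mono)
  have "S \<le> \<bar>real_of_int u\<bar> + \<bar>real_of_int v\<bar> * \<bar>f' x\<bar>" by (simp add: S_def abs_mult[symmetric])
  also have "\<dots> \<le> Y powr M + Y powr M * K"
    using height_less_coord[OF classD(3)[OF L] ij(1,2)] iM slope_bounds[OF x]
    by (intro add_mono mult_mono) (auto simp: Y_def)
  also have "\<dots> < (K + 2) * Y powr M" using Y by (simp add: algebra_simps)
  finally have S_lt: "S < slope_bound h 0" by (simp add: slope_bound_def Y_def)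
  have "\<exists>n. slope_bound h n < S"
  proof -
    obtain n where "slope_bound h 0 / S < real R ^ n" using R_pos real_arch_pow[of R] by auto
    then have "slope_bound h 0 / real R ^ n < S" using S0 R_pos by (simp add: field_simps)
    then show ?thesis by (intro exI[of _ n]) (simp add: slope_bound_def)
  qed
  then obtain n1 where n1: "\<not> S < slope_bound h n1" by (meson less_asym)
  define n2 where "n2 = (LEAST n. \<not> S < slope_bound h n)"
  have n2: "\<not> S < slope_bound h n2" unfolding n2_def by (rule LeastI[of _ n1]) (rule n1)
  then obtain n where n: "n2 = Suc n" using S_lt by (cases n2) auto
  have "S < slope_bound h n" using not_less_Least[of n "\<lambda>n. \<not> S < slope_bound h n"] n by (auto simp: n2_def)
  moreover have "slope_bound h n / R \<le> S" using n2 R_pos by (simp add: n slope_bound_def field_simps)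
  ultimately show thesis using that st by (auto simp: S_def)
qed

end

text \<open>For given \<open>R\<close> and \<open>s\<close>, the constants are chosen in the order \<open>k0\<close>, \<open>h0\<close>, \<open>q1\<close>, \<open>c\<close>. Lines of
  height below \<open>R ^ h0\<close> escape the asymptotic estimates; they have finitely many zeros, so for tiny \<open>c\<close>
  they can be removed at one very deep level \<open>q1\<close> at negligible cost. The exponents 1/8 and 1/32
  (and the 16 in \<open>lag\<close>) only have to be small enough.\<close>

locale removal_params = weighted +
  fixes k0 h0 q1 :: nat and c r0 :: real
  assumes k0: "1 \<le> k0"
    and c: "0 < c" "c * real R ^ (k0 + 20) \<le> 1" "c * real R ^ (k0 + 20) \<le> l"
    and h0: "\<And>h. h0 \<le> h \<Longrightarrow> 1000 * K ^ 4 * real R ^ 6 * (1 + 1 / \<mu>\<^sup>2) \<le> (real R ^ h) powr (1 / 32)"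
      "\<And>h. h0 \<le> h \<Longrightarrow> (real R ^ h) powr (- m) \<le> l"
    and low_hits: "real (card (hits (low_set h0 c) q1)) \<le> r0"
    and low_cell: "\<And>u v w k. (u, v) \<noteq> (0, 0) \<Longrightarrow> height i j u v < real R ^ h0 \<Longrightarrow> k < R ^ q1 \<Longrightarrow>
      \<exists>x\<in>cell q1 k. c \<le> \<bar>lin (u, v, w) x\<bar>"
    and q1: "1 \<le> q1"
begin

text \<open>The length given by \<open>line_spread\<close> for \<open>\<epsilon> = c / R ^ h\<close>
  and slopes between \<open>slope_bound h n / R\<close> and \<open>slope_bound h n\<close>.\<close>

definition width :: "nat \<Rightarrow> nat \<Rightarrow> real" where
  "width h n = 4 * c * R / (real R ^ h * slope_bound h n)"

text \<open>Nearly tangent lines of class \<open>h\<close> have \<open>v\<close> of size about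
  \<open>(R ^ h) powr m\<close>. At \<open>tan_scale\<close> the product of \<open>v\<close> and the
  cell length is therefore small, so determinants vanish. \<open>tan_width\<close> is the separation
  at which curvature contradicts a vanishing determinant.\<close>

definition tan_width :: "nat \<Rightarrow> real" where
  "tan_width h = (real R ^ h) powr (- m - 1 / 32)"

definition tan_scale :: "nat \<Rightarrow> real" where
  "tan_scale h = (real R ^ h) powr (- m) / real R ^ 4"

text \<open>One class for each \<open>n\<close> may act at the same level, so the lag must grow with
  \<open>n\<close> to make the costs summable. The growth is slow enough that
  \<open>R ^ lag n\<close> stays below a constant times \<open>steep h\<close>.\<close>

definition lag :: "nat \<Rightarrow> nat" where "lag n = k0 + n div 16"

text \<open>Before rounding, the exponent solves
  \<open>G powr (1 + 1 / M) = R ^ (k + 5)\<close>.\<close>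

definition crowd :: "nat \<Rightarrow> nat" where
  "crowd k = nat \<lceil>real R powr ((real k + 5) * M / (1 + M))\<rceil>"

definition rem_index :: "removal set" where
  "rem_index = {Transversal h n | h n. h0 \<le> h \<and> 1 / steep h \<le> slope_bound h n} \<union> {Tangential h | h. h0 \<le> h} \<union> {Low}"

definition rem_level :: "removal \<Rightarrow> nat" where
  "rem_level \<iota> = (case \<iota> of Transversal h n \<Rightarrow> level (width h n) | Tangential h \<Rightarrow> level (tan_width h) | Low \<Rightarrow> q1)"

definition rem_base :: "removal \<Rightarrow> nat" where
  "rem_base \<iota> = (case \<iota> of Transversal h n \<Rightarrow> level (width h n) - lag n | Tangential h \<Rightarrow> level (tan_scale h) | Low \<Rightarrow> 0)"

definition rem_count :: "removal \<Rightarrow> real" where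
  "rem_count \<iota> = (case \<iota> of Transversal h n \<Rightarrow> 3 * real (crowd (lag n)) ^ 2 | Tangential h \<Rightarrow> 4 | Low \<Rightarrow> r0)"

definition rem_set :: "removal \<Rightarrow> real set" where
  "rem_set \<iota> = (case \<iota> of Transversal h n \<Rightarrow> transversal_set c h n | Tangential h \<Rightarrow> tangential_set c h | Low \<Rightarrow> low_set h0 c)"

lemma classify:
  assumes x: "x \<in> {a..a + l}" and uv: "(u, v) \<noteq> (0, 0)" and small: "\<bar>lin (u, v, w) x\<bar> < c / height i j u v"
  obtains (low) "height i j u v < real R ^ h0" "x \<in> low_set h0 c"
    | (tan) h where "h0 \<le> h" "line_in_class h (u, v, w)" "\<bar>slope (u, v, w) x\<bar> < 1 / steep h" "x \<in> tangential_set c h"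
    | (trans) h n where "h0 \<le> h" "line_in_class h (u, v, w)" "1 / steep h \<le> slope_bound h n"
        "slope_bound h n / R \<le> \<bar>slope (u, v, w) x\<bar>" "x \<in> transversal_set c h n"
proof -
  obtain h where h: "line_in_class h (u, v, w)" using ex_class[OF uv] by blast
  show thesis
  proof (cases "h < h0")
    case True
    then have "real R ^ (h + 1) \<le> real R ^ h0" using R_pos by (intro power_increasing) auto
    then have H: "height i j u v < real R ^ h0" using classD(3)[OF h] by linarith
    show thesis by (rule low[OF H]) (use x uv H small in \<open>auto simp: low_set_def\<close>)
  next
    case False
    show thesis
    proof (cases "\<bar>slope (u, v, w) x\<bar> < 1 / steep h")
      case True
      show thesis
        by (rule tan[OF _ h True]) (use False x h small True in \<open>auto simp: tangential_set_def\<close>)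
    next
      case st: False
      obtain n where n: "slope_bound h n / R \<le> \<bar>slope (u, v, w) x\<bar>" "\<bar>slope (u, v, w) x\<bar> < slope_bound h n"
          "1 / steep h \<le> slope_bound h n"
        using ex_slope_class[OF h x] st by (metis not_less)
      show thesis
        by (rule trans[OF _ h n(3,1)]) (use False x h small n in \<open>auto simp: transversal_set_def\<close>)
    qed
  qed
qed

lemma Bad_if_not_removed:
  assumes x: "x \<in> {a..a + l}" and nr: "\<And>\<iota>. \<iota> \<in> rem_index \<Longrightarrow> x \<notin> rem_set \<iota>"
  shows "(x, f x) \<in> Bad i j"
proof (rule Bad_if_dual[OF ij c(1)])
  have "1 \<le> real R ^ (k0 + 20)" using R_pos by (simp add: one_le_power)
  then have "c * 1 \<le> c * real R ^ (k0 + 20)" using c(1) by (intro mult_left_mono) auto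
  then show "c \<le> 1" using c(2) by linarith
  fix u v w :: int
  assume uv: "(u, v) \<noteq> (0, 0)"
  show "c / height i j u v \<le> \<bar>of_int u * x + of_int v * f x + of_int w\<bar>"
  proof (rule ccontr)
    assume "\<not> ?thesis"
    then have "\<bar>lin (u, v, w) x\<bar> < c / height i j u v" by simp
    from x uv this show False
    proof (cases rule: classify)
      case low
      then show False using nr[of Low] by (simp add: rem_index_def rem_set_def)
    next
      case (tan h)
      then show False using nr[of "Tangential h"] by (simp add: rem_index_def rem_set_def)
    next
      case (trans h n)
      then show False using nr[of "Transversal h n"] by (simp add: rem_index_def rem_set_def)
    qed
  qed
qed

end

lemma crowd_exponent: "0 < x \<Longrightarrow> y * x / (1 + x) * (1 + 1 / x) = y" for x y :: real
proof -
  assume "0 < x"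
  then have "1 + 1 / x = (1 + x) / x" by (simp add: field_simps)
  then show ?thesis using \<open>0 < x\<close> by simp
qed

section \<open>Scales of the transversal classes\<close>

context removal_params
begin

lemma lag_ge_1: "1 \<le> lag n"
  using k0 by (simp add: lag_def)

text \<open>A slope class reaching up to \<open>1 / steep h\<close> cannot be too deep. Together
  with the 16 in \<open>lag\<close> this bounds the lag in terms of \<open>h\<close>.\<close>

lemma transversal_index_le:
  assumes valid: "1 / steep h \<le> slope_bound h n"
  shows "n \<le> 2 * h + 2"
proof -
  define X where "X = real R ^ h"
  define Y where "Y = real R ^ (h + 1)"
  have X: "1 \<le> X" "1 \<le> Y" unfolding X_def Y_def by (intro one_le_power, use R_pos in simp)+
  have "steep h \<le> X powr 1" unfolding steep_def X_def[symmetric] using X by (intro powr_mono) auto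
  then have eX: "steep h \<le> X" using X by simp
  have "Y powr M \<le> Y powr 1" using X mM by (intro powr_mono) auto
  then have YM: "Y powr M \<le> Y" using X by simp
  have "real R ^ n \<le> (K + 2) * Y powr M * steep h"
    using valid steep_ge_1[of h] R_pos by (simp add: slope_bound_def Y_def field_simps)
  also have "\<dots> \<le> R * Y * X"
    by (intro mult_mono) (use YM eX X R_consts(2) K_ge_1 steep_ge_1[of h] in auto)
  also have "\<dots> = real R ^ (2 * h + 2)" by (simp add: X_def Y_def power_add power_mult power2_eq_square mult_ac)
  finally show ?thesis using R_pos power_le_imp_le_exp by blast
qed

lemma lag_power_le:
  assumes valid: "1 / steep h \<le> slope_bound h n"
  shows "real R ^ lag n \<le> real R ^ (k0 + 1) * steep h"
proof -
  have "16 * (n div 16) \<le> 2 * h + 2" using transversal_index_le[OF valid] by linarith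
  then have n: "real (n div 16) \<le> 1 + real h / 8" by linarith
  have "real R ^ (n div 16) = R powr real (n div 16)" using R_pos by (simp add: powr_realpow)
  also have "\<dots> \<le> R powr (1 + real h / 8)" using n R_pos by (intro powr_mono) auto
  also have "\<dots> = R * steep h"
    using R_pos by (simp add: powr_add steep_def powr_powr flip: powr_realpow)
  finally have "real R ^ k0 * real R ^ (n div 16) \<le> real R ^ k0 * (R * steep h)"
    by (intro mult_left_mono) auto
  then show ?thesis by (simp add: lag_def power_add mult_ac)
qed

text \<open>\<open>\<rho>\<close> is the length of a counting cell. Since
  \<open>width h n * R ^ h * slope_bound h n = 4 * c * R\<close>, and cells of the removal level
  match the width up to a factor \<open>R\<close>, the product
  \<open>slope_bound h n * \<rho>\<close> is \<open>c * R ^ lag n / R ^ h\<close> up to bounded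
  factors. The smallness of \<open>c\<close> absorbs \<open>R ^ lag n\<close> except for one factor
  \<open>steep h\<close>, which leaves seven of the eight such factors in
  \<open>R ^ h\<close>.\<close>

lemma transversal_scale:
  assumes valid: "1 / steep h \<le> slope_bound h n"
  defines "\<rho> \<equiv> l / real R ^ (level (width h n) - lag n)"
  shows width_pos: "0 < width h n" and width_le: "width h n \<le> l"
    and lag_le_level: "lag n \<le> level (width h n)"
    and lower: "4 * c * real R ^ (lag n + 1) / real R ^ h \<le> slope_bound h n * \<rho>"
    and upper: "slope_bound h n * \<rho> \<le> 4 * c * real R ^ (lag n + 2) / real R ^ h"
    and small: "slope_bound h n * \<rho> \<le> 1 / (real R ^ 15 * steep h ^ 7)"
    and width_small: "width h n * real R ^ 16 * steep h ^ 6 \<le> l"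
proof -
  define X where "X = real R ^ h"
  define D where "D = slope_bound h n"
  define k where "k = lag n"
  define e where "e = steep h"
  have X: "0 < X" "X = e ^ 8" using R_pos by (simp_all add: X_def e_def steep_pow)
  have e: "1 \<le> e" using steep_ge_1 by (simp add: e_def)
  have D: "0 < D" using slope_bound_pos by (simp add: D_def)
  have De: "1 \<le> D * e" using valid e by (simp add: D_def e_def field_simps)
  have R0: "0 < real R" "1 \<le> real R" using R_pos by auto
  show w0: "0 < width h n"
    unfolding width_def X_def[symmetric] D_def[symmetric] using c(1) X(1) D R0
    by (intro divide_pos_pos mult_pos_pos) auto
  have wD: "width h n * (X * D) = 4 * c * R" using X D by (simp add: width_def X_def[symmetric] D_def[symmetric])
  have Rk: "real R ^ k \<le> real R ^ (k0 + 1) * e" using lag_power_le[OF valid] by (simp add: k_def e_def)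
  have four: "4 \<le> real R" using R_consts by linarith
  \<comment> \<open>Origin of the 20 in the bounds on \<open>c\<close>: one factor \<open>R\<close>
    replaces the 4, one is explicit, the lag gives \<open>k0 + 1\<close>, and 17 are kept in
    reserve.\<close>
  have key: "4 * c * R * real R ^ k * real R ^ 17 \<le> c * real R ^ (k0 + 20) * e"
  proof -
    have "4 * c * R * real R ^ k * real R ^ 17 \<le> real R * c * R * (real R ^ (k0 + 1) * e) * real R ^ 17"
      by (intro mult_mono) (use four c Rk e R0 in auto)
    also have "\<dots> = c * real R ^ (k0 + 20) * e"
      by (simp add: power_add power_numeral_reduce mult_ac)
    finally show ?thesis .
  qed
  have wkey: "width h n * real R ^ k * real R ^ 17 * e ^ 6 * (c' * 1) \<le> c * real R ^ (k0 + 20) * (c' * 1)" if "0 \<le> c'" for c'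
  proof (rule mult_right_mono)
    have "width h n * e ^ 7 \<le> width h n * (e ^ 7 * (D * e))" using De w0 e by (intro mult_left_mono) auto
    also have "\<dots> = 4 * c * R" using wD by (simp add: X power_numeral_reduce mult_ac)
    finally have "width h n * e ^ 7 * (real R ^ k * real R ^ 17) \<le> 4 * c * R * (real R ^ k * real R ^ 17)"
      by (intro mult_right_mono) auto
    also have "\<dots> \<le> c * real R ^ (k0 + 20) * e" using key by (simp add: mult_ac)
    finally have "(width h n * real R ^ k * real R ^ 17 * e ^ 6) * e \<le> (c * real R ^ (k0 + 20)) * e"
      by (simp add: power_numeral_reduce mult_ac)
    then show "width h n * real R ^ k * real R ^ 17 * e ^ 6 \<le> c * real R ^ (k0 + 20)"
      by (rule mult_right_le_imp_le) (use e in auto)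
  qed (use that in simp)
  have wl: "width h n * real R ^ k * real R ^ 17 * e ^ 6 \<le> l" using wkey[of 1] c(3) by simp
  have e6: "1 \<le> e ^ 6" using e by (rule one_le_power)
  have Rpow: "1 \<le> real R ^ q" for q using R0 by (intro one_le_power) auto
  have "width h n * real R ^ k * 1 * 1 \<le> width h n * real R ^ k * real R ^ 17 * e ^ 6"
    using w0 e6 Rpow by (intro mult_mono) auto
  then have wk: "width h n * real R ^ k \<le> l" using wl by simp
  then have "width h n \<le> l / real R ^ k" using R0 by (simp add: field_simps)
  then show kQ: "lag n \<le> level (width h n)" unfolding k_def[symmetric] by (rule le_level[OF w0])
  have "width h n * 1 \<le> width h n * real R ^ k" using w0 Rpow by (intro mult_left_mono) auto
  then show wle: "width h n \<le> l" using wk by simp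
  have "width h n * 1 * real R ^ 16 * e ^ 6 \<le> width h n * real R ^ k * real R ^ 17 * e ^ 6"
    using w0 e6 Rpow R0 e by (intro mult_mono power_increasing) auto
  then show "width h n * real R ^ 16 * steep h ^ 6 \<le> l" using wl by (simp add: e_def)
  have \<rho>: "\<rho> = real R ^ k * (l / real R ^ level (width h n))"
    unfolding \<rho>_def k_def using kQ R0 by (simp add: power_diff)
  have "4 * c * R * real R ^ k = width h n * (X * D) * real R ^ k" by (simp only: wD)
  also have "\<dots> = X * D * (real R ^ k * width h n)" by (simp only: mult_ac)
  also have "\<dots> \<le> X * D * \<rho>"
    unfolding \<rho> using le_level_size[OF w0 wle] X D R0 by (intro mult_left_mono) auto
  also have "\<dots> = D * \<rho> * X" by (simp only: mult_ac)
  finally have "4 * c * R * real R ^ k \<le> D * \<rho> * X" .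
  then show "4 * c * real R ^ (lag n + 1) / real R ^ h \<le> slope_bound h n * \<rho>"
    using X by (simp add: pos_divide_le_eq X_def[symmetric] D_def[symmetric] k_def[symmetric] mult_ac)
  have "X * D * \<rho> \<le> X * D * (real R ^ k * (real R * width h n))"
    unfolding \<rho> using level_size_less[OF w0 wle] X D R0 by (intro mult_left_mono) auto
  also have "\<dots> = (width h n * (X * D)) * (R * real R ^ k)" by (simp add: mult_ac)
  also have "\<dots> = 4 * c * R * real R ^ k * R" unfolding wD by (simp only: mult_ac)
  finally have up: "D * \<rho> * X \<le> 4 * c * R * real R ^ k * R" by (simp add: mult_ac)
  then show "slope_bound h n * \<rho> \<le> 4 * c * real R ^ (lag n + 2) / real R ^ h"
    using X by (simp add: pos_le_divide_eq X_def[symmetric] D_def[symmetric] k_def[symmetric] power2_eq_square power_add mult_ac)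
  have "D * \<rho> * e ^ 8 * real R ^ 16 \<le> 4 * c * R * real R ^ k * R * real R ^ 16"
    using up by (intro mult_right_mono) (auto simp: X)
  also have "\<dots> = 4 * c * R * real R ^ k * real R ^ 17" by (simp add: power_numeral_reduce mult_ac)
  also have "\<dots> \<le> 1 * e" using key c(2) e mult_right_mono[OF c(2), of e] by linarith
  finally have "(D * \<rho> * e ^ 7 * real R ^ 16) * e \<le> 1 * e" by (simp add: power_numeral_reduce mult_ac)
  then have "D * \<rho> * e ^ 7 * real R ^ 16 \<le> 1" by (rule mult_right_le_imp_le) (use e in auto)
  moreover have "D * \<rho> * e ^ 7 * real R ^ 15 \<le> D * \<rho> * e ^ 7 * real R ^ 16"
    using D l_pos R0 e by (intro mult_left_mono power_increasing) (auto simp: \<rho>_def)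
  ultimately have "D * \<rho> * e ^ 7 * real R ^ 15 \<le> 1" by linarith
  then show "slope_bound h n * \<rho> \<le> 1 / (real R ^ 15 * steep h ^ 7)"
    using e R0 by (simp add: pos_le_divide_eq D_def[symmetric] e_def[symmetric] mult_ac)
qed

text \<open>Here \<open>m \<le> 1 / 2\<close> enters: it bounds the lesser coefficient by
  \<open>R * steep h ^ 4\<close>. As \<open>\<rho>\<close> is below \<open>1 / steep h ^ 6\<close>
  and the slope bound is at least \<open>1 / steep h\<close>, the variation is a small fraction of
  the slope bound.\<close>

lemma transversal_variation:
  assumes valid: "1 / steep h \<le> slope_bound h n"
  defines "\<rho> \<equiv> l / real R ^ (level (width h n) - lag n)"
  shows "K * CK * \<rho> * (slope_bound h n + (real R ^ (h + 1)) powr m) \<le> slope_bound h n / (8 * R)"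
proof -
  define D where "D = slope_bound h n"
  define e where "e = steep h"
  define Z where "Z = (real R ^ (h + 1)) powr m"
  have e: "1 \<le> e" using steep_ge_1 by (simp add: e_def)
  have D: "0 < D" using slope_bound_pos by (simp add: D_def)
  have De: "1 \<le> D * e" using valid e by (simp add: D_def e_def field_simps)
  have R0: "0 < real R" "1 \<le> real R" using R_pos by auto
  have \<rho>0: "0 < \<rho>" using l_pos R0 by (simp add: \<rho>_def)
  have small: "D * \<rho> * (real R ^ 15 * e ^ 7) \<le> 1"
    using small[OF valid] e R0 by (simp add: D_def e_def \<rho>_def pos_le_divide_eq)
  have \<rho>e: "\<rho> * (real R ^ 15 * e ^ 6) \<le> 1"
  proof -
    have "\<rho> * (real R ^ 15 * e ^ 6) * 1 \<le> \<rho> * (real R ^ 15 * e ^ 6) * (D * e)"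
      using De \<rho>0 e R0 by (intro mult_left_mono) auto
    also have "\<dots> = D * \<rho> * (real R ^ 15 * e ^ 7)" by (simp add: power_numeral_reduce mult_ac)
    finally show ?thesis using small by simp
  qed
  have Z: "Z \<le> R * e ^ 4"
  proof -
    have "Z \<le> (real R ^ (h + 1)) powr (1 / 2)"
      unfolding Z_def using mM R0 by (intro powr_mono one_le_power) auto
    also have "\<dots> = R powr (1 / 2) * e ^ 4"
      using R0 steep_half[of h] by (simp add: powr_mult e_def)
    also have "R powr (1 / 2) \<le> R powr 1" using R0 by (intro powr_mono) auto
    finally show ?thesis using R0 e by (simp add: mult_right_mono)
  qed
  have "\<rho> * Z * real R ^ 14 \<le> D"
  proof -
    have "\<rho> * Z * real R ^ 14 \<le> \<rho> * (R * e ^ 4) * real R ^ 14" using Z \<rho>0 R0 by (intro mult_left_mono mult_right_mono) auto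
    also have "\<dots> = \<rho> * (real R ^ 15 * e ^ 4)" by (simp add: power_numeral_reduce mult_ac)
    also have "\<dots> \<le> \<rho> * (real R ^ 15 * e ^ 4) * (D * e)" using De \<rho>0 e R0 by simp
    also have "\<dots> = D * (\<rho> * (real R ^ 15 * e ^ 5))" by (simp add: power_numeral_reduce mult_ac)
    also have "\<dots> \<le> D * (\<rho> * (real R ^ 15 * e ^ 6))"
      using D \<rho>0 R0 e by (intro mult_left_mono power_increasing) auto
    also have "\<dots> \<le> D * 1" using \<rho>e D by (intro mult_left_mono) auto
    finally show ?thesis by simp
  qed
  moreover have "\<rho> * D * real R ^ 14 \<le> D"
  proof -
    have "\<rho> * (real R ^ 14 * 1) \<le> \<rho> * (real R ^ 15 * e ^ 6)"
      using \<rho>0 R0 e by (intro mult_left_mono mult_mono power_increasing one_le_power) auto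
    then have "\<rho> * real R ^ 14 \<le> 1" using \<rho>e by simp
    then have "D * (\<rho> * real R ^ 14) \<le> D * 1" using D by (intro mult_left_mono) auto
    then show ?thesis by (simp add: mult_ac)
  qed
  ultimately have "\<rho> * (D + Z) * real R ^ 14 \<le> 2 * D" by (simp add: algebra_simps)
  then have "16 * (K * CK) * (\<rho> * (D + Z) * real R ^ 14) \<le> 16 * (K * CK) * (2 * D)"
    using K_ge_1 CK_ge_1 by (intro mult_left_mono) auto
  also have "\<dots> \<le> real R ^ 13 * (2 * D)"
  proof (intro mult_right_mono)
    have "K * CK \<le> (K + 3) * CK" using K_ge_1 CK_ge_1 by (intro mult_right_mono) auto
    moreover have "1000 * ((K + 3) * CK) \<le> R" using R_consts(3) by (simp add: mult_ac)
    moreover have "0 \<le> K * CK" using K_ge_1 CK_ge_1 by simp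
    ultimately have "16 * (K * CK) \<le> real R ^ 1" unfolding power_one_right by linarith
    also have "\<dots> \<le> real R ^ 13" using R0 by (intro power_increasing) auto
    finally show "16 * (K * CK) \<le> real R ^ 13" .
  qed (use D in auto)
  also have "16 * (K * CK) * (\<rho> * (D + Z) * real R ^ 14) = (8 * R * (K * CK * \<rho> * (D + Z))) * (2 * real R ^ 13)"
  proof -
    have "real R ^ 14 = R * real R ^ 13" using power_Suc[of "real R" 13] by simp
    then show ?thesis by (simp only: algebra_simps) simp
  qed
  also have "real R ^ 13 * (2 * D) = D * (2 * real R ^ 13)" by simp
  finally have "(8 * R * (K * CK * \<rho> * (D + Z))) * (2 * real R ^ 13) \<le> D * (2 * real R ^ 13)" .
  then have "8 * R * (K * CK * \<rho> * (D + Z)) \<le> D"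
    by (rule mult_right_le_imp_le) (use R0 in auto)
  then show ?thesis
    unfolding D_def[symmetric] Z_def[symmetric] using R0 by (simp add: pos_le_divide_eq mult_ac)
qed

text \<open>\<open>M + m = 1\<close> turns \<open>slope_bound h n\<close> times the lesser
  coefficient bound into \<open>(K + 2) * R ^ (h + 1) / R ^ n\<close>. The factor
  \<open>1 / R ^ n\<close> pays for the lag because \<open>lag n \<le> k0 + n\<close>, and a
  multiple of \<open>c * R ^ (k0 + 3)\<close> remains.\<close>

lemma transversal_det_small:
  assumes valid: "1 / steep h \<le> slope_bound h n"
  defines "\<rho> \<equiv> l / real R ^ (level (width h n) - lag n)"
  shows "36 * (slope_bound h n * \<rho>) * slope_bound h n * (real R ^ (h + 1)) powr m < \<nu>"
proof -
  define D where "D = slope_bound h n"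
  define X where "X = real R ^ h"
  define Y where "Y = real R ^ (h + 1)"
  have R0: "0 < real R" "1 \<le> real R" using R_pos by auto
  have Y: "0 < Y" "Y = R * X" "0 < X" using R0 by (simp_all add: X_def Y_def)
  have YY: "Y powr M * Y powr m = Y"
    using Y mM by (simp add: powr_add[symmetric] add.commute)
  have DY: "D * Y powr m * real R ^ n = (K + 2) * Y"
    unfolding D_def slope_bound_def Y_def[symmetric] using YY R0 by simp
  have lag: "lag n \<le> k0 + n" by (simp add: lag_def)
  have "D * \<rho> \<le> 4 * c * real R ^ (lag n + 2) / X"
    unfolding D_def \<rho>_def X_def by (rule upper[OF valid])
  also have "\<dots> \<le> 4 * c * real R ^ (k0 + n + 2) / X"
    using lag c Y R0 by (intro divide_right_mono mult_left_mono power_increasing) auto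
  finally have D\<rho>: "D * \<rho> \<le> 4 * c * real R ^ (k0 + n + 2) / X" .
  have DYm: "D * Y powr m = (K + 2) * Y / real R ^ n" using DY R0 by (simp add: field_simps)
  have "36 * (D * \<rho>) * (D * Y powr m) \<le> 36 * (4 * c * real R ^ (k0 + n + 2) / X) * ((K + 2) * Y / real R ^ n)"
    unfolding DYm using D\<rho> K_ge_1 Y R0 by (intro mult_right_mono mult_left_mono) auto
  also have "\<dots> = 144 * (K + 2) * (c * real R ^ (k0 + 3))"
    using Y R0 by (simp add: power_add power_numeral_reduce field_simps)
  also have "\<dots> < \<nu>"
  proof -
    have "144 * (K + 2) * (c * real R ^ (k0 + 3)) * R \<le> \<nu> * R * (c * real R ^ (k0 + 3)) * R"
    proof (intro mult_right_mono)
      have "144 * (K + 2) \<le> 1000 * (K + 3)" using K_ge_1 by simp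
      then show "144 * (K + 2) \<le> \<nu> * R" using R_consts(4) by (rule order_trans)
    qed (use c R0 in auto)
    also have "\<dots> = \<nu> * (c * real R ^ (k0 + 5))" by (simp add: power_add power_numeral_reduce mult_ac)
    also have "\<dots> \<le> \<nu> * (c * real R ^ (k0 + 20))"
      using \<nu> c R0 by (intro mult_left_mono power_increasing) auto
    also have "\<dots> \<le> \<nu> * 1" using \<nu> c by (intro mult_left_mono) auto
    also have "\<dots> < \<nu> * R" using \<nu> R_pos by simp
    finally show ?thesis by (rule mult_right_less_imp_less) (use R0 in auto)
  qed
  finally show ?thesis by (simp add: D_def Y_def mult.assoc)
qed

lemma crowd_bounds:
  assumes k: "1 \<le> k"
  shows crowd_ge: "real R ^ 2 \<le> crowd k" and crowd_powr: "real R ^ (k + 5) \<le> real (crowd k) powr (1 + 1 / M)"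
    and crowd_le: "crowd k \<le> 2 * real R powr ((real k + 5) * M / (1 + M))"
proof -
  define t where "t = (real k + 5) * M / (1 + M)"
  have R0: "0 < real R" "1 \<le> real R" using R_pos by auto
  have M13: "1 / 3 \<le> M / (1 + M)" using mM by (simp add: field_simps)
  have t: "2 \<le> t"
  proof -
    have "6 * (1 / 3) \<le> (real k + 5) * (M / (1 + M))" using M13 k by (intro mult_mono) auto
    then show ?thesis by (simp add: t_def)
  qed
  have ge: "R powr t \<le> crowd k" by (simp add: crowd_def t_def real_nat_ceiling_ge)
  have "real R ^ 2 = R powr 2" using R0 powr_realpow[of R 2] by simp
  also have "\<dots> \<le> R powr t" using t R0 by (intro powr_mono) auto
  finally show "real R ^ 2 \<le> crowd k" using ge by linarith
  have "t * (1 + 1 / M) = real k + 5" unfolding t_def using mM by (intro crowd_exponent) linarith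
  then have "real R ^ (k + 5) = (R powr t) powr (1 + 1 / M)"
    using R0 powr_realpow[of R "k + 5"] by (simp add: powr_powr)
  also have "\<dots> \<le> real (crowd k) powr (1 + 1 / M)" using ge mM by (intro powr_mono2) auto
  finally show "real R ^ (k + 5) \<le> real (crowd k) powr (1 + 1 / M)" .
  have "1 \<le> R powr t" using R0 t by (intro ge_one_powr_ge_zero) auto
  then have "crowd k \<le> R powr t + 1" unfolding crowd_def t_def[symmetric] by linarith
  then show "crowd k \<le> 2 * real R powr ((real k + 5) * M / (1 + M))"
    using \<open>1 \<le> R powr t\<close> by (simp add: t_def)
qed


section \<open>Tangential classes, and cells trapped by a line\<close>

definition slow :: "nat \<Rightarrow> real" where
  "slow h = (real R ^ h) powr (1 / 32)"

lemma slow_bounds: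
  assumes "h0 \<le> h"
  shows slow_large: "1000 * K ^ 4 * real R ^ 6 * (1 + 1 / \<mu>\<^sup>2) \<le> slow h" and slow_ge_R: "real R ^ 6 \<le> slow h"
    and slow_ge_1: "1 \<le> slow h"
proof -
  show 1: "1000 * K ^ 4 * real R ^ 6 * (1 + 1 / \<mu>\<^sup>2) \<le> slow h"
    using h0(1)[OF assms] by (simp add: slow_def)
  have "1 * 1 * real R ^ 6 * 1 \<le> 1000 * K ^ 4 * real R ^ 6 * (1 + 1 / \<mu>\<^sup>2)"
    using K_ge_1 by (intro mult_mono one_le_power) auto
  then show 2: "real R ^ 6 \<le> slow h" using 1 by simp
  have "1 \<le> real R ^ 6" using R_pos by (intro one_le_power) simp
  then show "1 \<le> slow h" using 2 by linarith
qed

text \<open>With \<open>slow h\<close> as the unit, \<open>steep h\<close>, \<open>R ^ h\<close> and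
  its square root become integer powers, so the estimates below compare exponents of one
  base.\<close>

lemma powers_of_slow:
  "steep h = slow h ^ 4" "(real R ^ h) powr (1 / 2) = slow h ^ 16" "real R ^ h = slow h ^ 32"
  "tan_width h = (real R ^ h) powr (- m) / slow h"
proof -
  have s: "slow h > 0" using R_pos by (simp add: slow_def)
  have pw: "slow h ^ n = (real R ^ h) powr (real n / 32)" for n
    using s R_pos by (simp add: slow_def powr_powr flip: powr_realpow)
  show "steep h = slow h ^ 4" "(real R ^ h) powr (1 / 2) = slow h ^ 16" "real R ^ h = slow h ^ 32"
    using R_pos by (simp_all add: pw steep_def)
  show "tan_width h = (real R ^ h) powr (- m) / slow h"
    unfolding tan_width_def slow_def by (simp only: powr_diff)
qed

text \<open>A slope below 1/2 forces \<open>u\<close> to be close to \<open>- v * f'\<close>, so a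
  large \<open>u\<close> forces a large \<open>v\<close>. The height makes some coefficient at least
  \<open>(R ^ h) powr m\<close>, while the lesser one is at most that size times \<open>R\<close>;
  so \<open>v\<close> has this size up to constants.\<close>

lemma tangential_coord:
  assumes h: "h0 \<le> h" and L: "line_in_class h (u, v, w)" and x: "x \<in> {a..a + l}"
    and sl: "\<bar>slope (u, v, w) x\<bar> < 1 / steep h"
  shows "(real R ^ h) powr m / (2 * K) \<le> \<bar>real_of_int v\<bar>"
    and "\<bar>real_of_int v\<bar> \<le> 2 * CK * R * (real R ^ h) powr m"
proof -
  define X where "X = real R ^ h"
  have X: "1 \<le> X" unfolding X_def using R_pos by (intro one_le_power) simp
  have R0: "0 < real R" "1 \<le> real R" using R_pos by auto
  have g: "1 \<le> slow h" "real R ^ 6 \<le> slow h" using slow_bounds[OF h] by auto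
  have "2 \<le> real R ^ 1" using R_pos by simp
  also have "\<dots> \<le> real R ^ 6" using R0 by (intro power_increasing) auto
  also have "\<dots> \<le> slow h ^ 1" using g by simp
  also have "\<dots> \<le> slow h ^ 4" using g by (intro power_increasing) auto
  finally have "2 \<le> steep h" by (simp add: powers_of_slow)
  then have "1 / steep h \<le> 1 / 2" by (intro divide_left_mono) auto
  then have half: "\<bar>slope (u, v, w) x\<bar> < 1 / 2" using sl by linarith
  have Xm1: "1 \<le> X powr m" using X mM by (intro ge_one_powr_ge_zero) auto
  have Xm: "X powr m \<le> X powr i" "X powr m \<le> X powr j" using X by (auto intro: powr_mono)
  have root: "X powr e \<le> \<bar>real_of_int k\<bar>" if "X \<le> \<bar>real_of_int k\<bar> powr (1 / e)" "0 < e" for k e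
    using powr_mono2[OF _ _ that(1), of e] that(2) X by (simp add: powr_powr)
  have "X \<le> height i j u v" using classD(2)[OF L] by (simp add: X_def)
  then consider "X powr i \<le> \<bar>real_of_int u\<bar>" | "X powr j \<le> \<bar>real_of_int v\<bar>"
    using root ij by (auto simp: height_def le_max_iff_disj)
  then show "(real R ^ h) powr m / (2 * K) \<le> \<bar>real_of_int v\<bar>"
  proof cases
    case 1
    then have u: "X powr m \<le> \<bar>real_of_int u\<bar>" using Xm by linarith
    have "\<bar>of_int v * f' x\<bar> \<le> \<bar>real_of_int v\<bar> * K"
      unfolding abs_mult using slope_bounds[OF x] by (intro mult_left_mono) auto
    moreover have "\<bar>real_of_int u\<bar> \<le> \<bar>slope (u, v, w) x\<bar> + \<bar>of_int v * f' x\<bar>" by simp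
    ultimately have "X powr m \<le> 1 / 2 + \<bar>real_of_int v\<bar> * K" using half u by linarith
    then have "X powr m / 2 \<le> \<bar>real_of_int v\<bar> * K" using Xm1 by linarith
    then show ?thesis using K_ge_1 by (simp add: X_def[symmetric] field_simps)
  next
    case 2
    have "X powr m / (2 * K) \<le> X powr m / 1" using K_ge_1 Xm1 by (intro divide_left_mono) auto
    then show ?thesis using 2 Xm by (simp add: X_def[symmetric])
  qed
  define Z where "Z = (real R ^ (h + 1)) powr m"
  have Z: "Z \<le> R * X powr m"
  proof -
    have "Z = R powr m * X powr m" using R0 by (simp add: Z_def X_def powr_mult)
    also have "\<dots> \<le> R powr 1 * X powr m" using R0 mM by (intro mult_right_mono powr_mono) auto
    finally show ?thesis using R0 by simp
  qed
  have RX: "1 * 1 \<le> R * X powr m" using R0 Xm1 by (intro mult_mono) auto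
  have "\<bar>real_of_int v\<bar> \<le> CK * (\<bar>slope (u, v, w) x\<bar> + \<bar>lesser_coord i j (u, v, w)\<bar>)"
    by (rule coord_bounds(2)[OF x])
  also have "\<dots> \<le> CK * (R * X powr m + R * X powr m)"
    using lesser_coord_less[OF classD(3)[OF L] ij(1,2), of w] Z RX half CK_ge_1
    by (intro mult_left_mono add_mono) (auto simp: Z_def)
  finally show "\<bar>real_of_int v\<bar> \<le> 2 * CK * R * (real R ^ h) powr m" by (simp add: X_def)
qed

lemma tan_width_le: "h0 \<le> h \<Longrightarrow> tan_width h \<le> l / slow h" "h0 \<le> h \<Longrightarrow> tan_width h \<le> l"
  "0 < tan_width h" "0 < tan_scale h" "h0 \<le> h \<Longrightarrow> tan_scale h \<le> l"
proof -
  have R0: "0 < real R" "1 \<le> real R" using R_pos by auto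
  show "0 < tan_width h" "0 < tan_scale h" using R0 by (simp_all add: tan_width_def tan_scale_def)
  assume h: "h0 \<le> h"
  show 1: "tan_width h \<le> l / slow h"
    unfolding powers_of_slow(4) using h0(2)[OF h] slow_ge_1[OF h] by (intro divide_right_mono) auto
  have "l / slow h \<le> l / 1" using l_pos slow_ge_1[OF h] by (intro divide_left_mono) auto
  then show "tan_width h \<le> l" using 1 by simp
  have "1 \<le> real R ^ 4" using R0 by (intro one_le_power)
  then have "tan_scale h \<le> (real R ^ h) powr (- m) / 1"
    unfolding tan_scale_def using R0 by (intro divide_left_mono) auto
  then show "tan_scale h \<le> l" using h0(2)[OF h] by simp
qed

text \<open>A cell inside the bad interval of a line would have been removed at the level of that interval,
  or earlier.\<close>

lemma not_trapped:
  assumes alive: "alive rem_index rem_level rem_set p \<kappa>" and uv: "(u, v) \<noteq> (0, 0)"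
    and lin: "\<And>x. x \<in> cell p \<kappa> \<Longrightarrow> \<bar>lin (u, v, w) x\<bar> < c / height i j u v"
    and sl: "\<And>x. x \<in> cell p \<kappa> \<Longrightarrow> \<bar>slope (u, v, w) x\<bar> * (l / real R ^ p) < c / height i j u v"
  shows False
proof -
  define \<rho> where "\<rho> = l / real R ^ p"
  define x0 where "x0 = a + l * real \<kappa> / real R ^ p"
  have R0: "0 < real R" "1 \<le> real R" using R_pos by auto
  have \<rho>: "0 < \<rho>" using l_pos R0 by (simp add: \<rho>_def)
  have cell_eq: "cell p \<kappa> = {x0..x0 + \<rho>}"
    by (simp add: cell_def x0_def \<rho>_def distrib_left add_divide_distrib)
  have \<kappa>: "\<kappa> < R ^ p" using alive by (simp add: alive_def)
  have sub: "cell p \<kappa> \<subseteq> {a..a + l}" using cell_subset[of 0 p \<kappa>] \<kappa> by (simp add: cell_0)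
  have x0: "x0 \<in> cell p \<kappa>" "x0 + \<rho> \<in> cell p \<kappa>" using \<rho> by (auto simp: cell_eq)
  then have x0I: "x0 \<in> {a..a + l}" "x0 + \<rho> \<in> {a..a + l}" using sub by blast+
  have anc: False if "\<iota> \<in> rem_index" "rem_level \<iota> \<le> p" "x0 \<in> rem_set \<iota>" for \<iota>
  proof -
    have "x0 \<in> cell (rem_level \<iota>) (\<kappa> div R ^ (p - rem_level \<iota>))"
      using cell_subset[OF that(2)] x0(1) by blast
    then show False using alive that unfolding alive_def by blast
  qed
  define H where "H = height i j u v"
  have cH: "c / H \<le> c" "0 < c / H"
  proof -
    have H: "1 \<le> H" using height_ge_1[OF ij(1,2) uv] by (simp add: H_def)
    have "c / H \<le> c / 1" using H c by (intro divide_left_mono) auto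
    then show "c / H \<le> c" by simp
    show "0 < c / H" using H c by simp
  qed
  show False
    using x0I(1) uv lin[OF x0(1)]
  proof (cases rule: classify)
    case low
    show False
    proof (cases "q1 \<le> p")
      case True
      then show False using anc[of Low] low by (simp add: rem_index_def rem_level_def rem_set_def)
    next
      case False
      \<comment> \<open>The cell is coarser than level \<open>q1\<close>. Its first descendant at
        that level contains a point with value at least \<open>c\<close>, although the form is
        supposed to be small on the whole cell.\<close>
      define k where "k = \<kappa> * R ^ (q1 - p)"
      have "k < R ^ p * R ^ (q1 - p)" using \<kappa> R_pos by (simp add: k_def)
      then have "k < R ^ q1" using False by (simp flip: power_add)
      from low_cell[OF uv low(1) this]
      obtain x where x: "x \<in> cell q1 k" "c \<le> \<bar>lin (u, v, w) x\<bar>" by blast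
      have "k div R ^ (q1 - p) = \<kappa>" using R_pos by (simp add: k_def)
      then have "x \<in> cell p \<kappa>" using cell_subset[of p q1 k] x(1) False by auto
      then show False using lin x(2) cH(1) by (fastforce simp: H_def)
    qed
  next
    case (tan h)
    define X where "X = real R ^ h"
    define g where "g = slow h"
    have X: "0 < X" using R0 by (simp add: X_def)
    have g: "1 \<le> g" using slow_ge_1[OF tan(1)] by (simp add: g_def)
    have X32: "X = g ^ 32" by (simp add: X_def g_def powers_of_slow)
    have c1: "c \<le> 1"
    proof -
      have "c * 1 \<le> c * real R ^ (k0 + 20)" using c(1) R0 by (intro mult_left_mono one_le_power) auto
      then show ?thesis using c(2) by linarith
    qed
    have cX: "c / H \<le> 1 / X"
    proof -
      have "c / H \<le> c / X" using classD(5)[OF tan(2), of c] c by (simp add: H_def X_def)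
      also have "\<dots> \<le> 1 / X" using c1 X by (intro divide_right_mono) auto
      finally show ?thesis .
    qed
    \<comment> \<open>The values at both endpoints and the linear term are each below
      \<open>c / H\<close>, so the second-order remainder is at most \<open>3 / X\<close>. Curvature
      thus bounds the length of the cell.\<close>
    have "\<mu> / 4 * \<rho>\<^sup>2 \<le> \<bar>f (x0 + \<rho>) - f x0 - f' x0 * \<rho>\<bar>"
      using remainder_lower[OF x0I] by simp
    then have "\<bar>real_of_int v\<bar> * (\<mu> / 4 * \<rho>\<^sup>2) \<le> \<bar>real_of_int v\<bar> * \<bar>f (x0 + \<rho>) - f x0 - f' x0 * \<rho>\<bar>"
      by (intro mult_left_mono) auto
    also have "\<dots> = \<bar>lin (u, v, w) (x0 + \<rho>) - lin (u, v, w) x0 - slope (u, v, w) x0 * \<rho>\<bar>"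
      by (simp add: abs_mult[symmetric] algebra_simps)
    also have "\<dots> \<le> 3 / X"
    proof -
      have "\<bar>slope (u, v, w) x0 * \<rho>\<bar> < c / H" using sl[OF x0(1)] \<rho>
        unfolding \<rho>_def[symmetric] H_def[symmetric] by (simp only: abs_mult abs_of_pos)
      moreover have "\<bar>lin (u, v, w) (x0 + \<rho>)\<bar> < c / H" "\<bar>lin (u, v, w) x0\<bar> < c / H"
        using lin[OF x0(1)] lin[OF x0(2)] by (simp_all add: H_def)
      ultimately show ?thesis using cX by linarith
    qed
    finally have v\<rho>: "\<bar>real_of_int v\<bar> * (\<mu> / 4 * \<rho>\<^sup>2) \<le> 3 / X" .
    \<comment> \<open>A longer cell, with the lower bound on \<open>v\<close>, would give
      \<open>\<mu> * slow h \<le> 24 * K\<close>, against the choice of \<open>h0\<close>. Once the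
      cell is this short, the tangential class has already acted on it or an ancestor.\<close>
    have "\<rho> \<le> tan_width h"
    proof (rule ccontr)
      assume "\<not> \<rho> \<le> tan_width h"
      then have "(tan_width h)\<^sup>2 \<le> \<rho>\<^sup>2" using tan_width_le(3)[of h] by (intro power_mono) auto
      then have "X powr m / (2 * K) * (\<mu> / 4 * (tan_width h)\<^sup>2) \<le> \<bar>real_of_int v\<bar> * (\<mu> / 4 * \<rho>\<^sup>2)"
        using tangential_coord(1)[OF tan(1,2) x0I(1) tan(3)] \<mu> K_ge_1
        by (intro mult_mono) (auto simp: X_def)
      then have "X powr m / (2 * K) * (\<mu> / 4 * (tan_width h)\<^sup>2) \<le> 3 / X" using v\<rho> by linarith
      then have 1: "\<mu> * (X powr m * (tan_width h)\<^sup>2 * X) \<le> 24 * K"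
        using X K_ge_1 by (simp add: field_simps)
      have "X powr m * (tan_width h)\<^sup>2 * X = X powr (- m) * X / g ^ 2"
        using X unfolding powers_of_slow(4) g_def[symmetric] X_def[symmetric]
        by (simp add: power2_eq_square powr_minus field_simps)
      moreover have "X powr (- m) * X \<ge> g ^ 16"
      proof -
        have "X powr (- (1 / 2)) \<le> X powr (- m)" using X mM g X32 by (intro powr_mono) auto
        then have "X powr (- (1 / 2)) * X \<le> X powr (- m) * X" using X by (intro mult_right_mono) auto
        moreover have "X powr (- (1 / 2)) * X = X powr (1 / 2)"
        proof -
          have "X powr (1 / 2) = X powr (- (1 / 2) + 1)" by simp
          also have "\<dots> = X powr (- (1 / 2)) * X" using X by (subst powr_add) simp
          finally show ?thesis by simp
        qed
        moreover have "X powr (1 / 2) = g ^ 16" unfolding X_def g_def by (rule powers_of_slow(2))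
        ultimately show ?thesis by simp
      qed
      ultimately have "g ^ 16 / g ^ 2 \<le> X powr m * (tan_width h)\<^sup>2 * X"
        using g by (simp add: divide_right_mono)
      moreover have "g ^ 1 \<le> g ^ 14" using g by (intro power_increasing) auto
      moreover have "g ^ 16 / g ^ 2 = g ^ 14" using g by (simp add: power_diff[symmetric])
      ultimately have "g \<le> X powr m * (tan_width h)\<^sup>2 * X" by simp
      then have "\<mu> * g \<le> \<mu> * (X powr m * (tan_width h)\<^sup>2 * X)" using \<mu> by (intro mult_left_mono) auto
      then have "\<mu> * g \<le> 24 * K" using 1 by (rule order_trans)
      moreover have "24 * K < \<mu> * g"
      proof -
        have "1 / \<mu> \<le> 1 + 1 / \<mu>\<^sup>2"
          using sum_squares_ge_zero[of "1 / \<mu> - 1" 0] zero_le_power2[of "1 / \<mu> - 1 / 2"]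
          by (simp add: power2_eq_square algebra_simps)
        then have "K * 1 * (1 / \<mu>) \<le> K ^ 4 * real R ^ 6 * (1 + 1 / \<mu>\<^sup>2)"
          using K_ge_1 R0 \<mu> self_le_power[of K 4] by (intro mult_mono one_le_power) auto
        then have "1000 * (K / \<mu>) \<le> g" using slow_large[OF tan(1)] by (simp add: g_def mult.assoc)
        then have "1000 * K \<le> \<mu> * g" using \<mu> by (simp add: field_simps)
        then show ?thesis using K_ge_1 by linarith
      qed
      ultimately show False by linarith
    qed
    then have "level (tan_width h) \<le> p"
      using level_le tan_width_le(2)[OF tan(1)] by (simp add: \<rho>_def)
    then show False using anc[of "Tangential h"] tan by (simp add: rem_index_def rem_level_def rem_set_def)
  next
    case (trans h n)
    define X where "X = real R ^ h"
    define D where "D = slope_bound h n"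
    have X: "0 < X" using R0 by (simp add: X_def)
    have D: "0 < D" using slope_bound_pos by (simp add: D_def)
    \<comment> \<open>The lower slope bound makes the cell at most a quarter of
      \<open>width h n\<close> long, so the removal level of this class is at most
      \<open>p\<close>.\<close>
    have "D / R * \<rho> \<le> \<bar>slope (u, v, w) x0\<bar> * \<rho>" using trans(4) \<rho> by (intro mult_right_mono) (auto simp: D_def)
    also have "\<dots> < c / H" using sl[OF x0(1)] by (simp add: \<rho>_def H_def)
    also have "\<dots> \<le> c / X" using classD(5)[OF trans(2), of c] c by (simp add: H_def X_def)
    finally have "\<rho> \<le> c * R / (X * D)" using X D R0 by (simp add: field_simps)
    also have "\<dots> \<le> width h n"
      unfolding width_def X_def[symmetric] D_def[symmetric]
      using X D R0 c by (intro divide_right_mono) auto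
    finally have "level (width h n) \<le> p"
      using level_le width_le[OF trans(3)] by (simp add: \<rho>_def)
    then show False using anc[of "Transversal h n"] trans by (simp add: rem_index_def rem_level_def rem_set_def)
  qed
qed

text \<open>The ratio of \<open>tan_scale\<close> to \<open>tan_width\<close> is
  \<open>slow h / R ^ 4\<close>; rounding to levels loses at most one more factor
  \<open>R\<close>.\<close>

lemma tangential_levels:
  assumes h: "h0 \<le> h"
  shows "level (tan_scale h) < level (tan_width h)"
    and "slow h \<le> real R ^ 5 * real R ^ (level (tan_width h) - level (tan_scale h))"
proof -
  define p where "p = level (tan_scale h)"
  define q where "q = level (tan_width h)"
  define g where "g = slow h"
  define Z where "Z = (real R ^ h) powr (- m)"
  have R0: "0 < real R" "1 < real R" using R_pos by auto
  have Z: "0 < Z" using R0 by (simp add: Z_def)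
  have g: "1 \<le> g" "real R ^ 6 \<le> g" using slow_bounds[OF h] by (auto simp: g_def)
  have 1: "Z / real R ^ 4 \<le> l / real R ^ p"
    using le_level_size[OF tan_width_le(4) tan_width_le(5)[OF h]] by (simp add: p_def tan_scale_def Z_def)
  have 2: "l / real R ^ q < R * (Z / g)"
    using level_size_less[OF tan_width_le(3) tan_width_le(2)[OF h]] by (simp add: q_def powers_of_slow Z_def g_def)
  have "g * (l / real R ^ q) \<le> g * (R * (Z / g))" using 2 g by (intro mult_left_mono) auto
  also have "\<dots> = real R ^ 5 * (Z / real R ^ 4)" using g R0 by (simp add: field_simps power_numeral_reduce)
  also have "\<dots> \<le> real R ^ 5 * (l / real R ^ p)" using 1 R0 by (intro mult_left_mono) auto
  finally have "l * (g * real R ^ p) \<le> l * (real R ^ 5 * real R ^ q)" using R0 l_pos by (simp add: field_simps)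
  then have 3: "g * real R ^ p \<le> real R ^ 5 * real R ^ q" using l_pos by (simp only: mult_le_cancel_left_pos)
  have "real R ^ 6 * real R ^ p \<le> g * real R ^ p" using g R0 by (intro mult_right_mono) auto
  then have "real R ^ (6 + p) \<le> real R ^ (5 + q)" using 3 unfolding power_add by linarith
  then have "6 + p \<le> 5 + q" using R0 power_le_imp_le_exp by blast
  then have pq: "p < q" by simp
  then show "level (tan_scale h) < level (tan_width h)" by (simp add: p_def q_def)
  have "real R ^ q = real R ^ (q - p) * real R ^ p" using pq by (simp flip: power_add)
  then have "g * real R ^ p \<le> (real R ^ 5 * real R ^ (q - p)) * real R ^ p" using 3 by (simp add: mult.assoc)
  then have "g \<le> real R ^ 5 * real R ^ (q - p)" using R0 by (simp only: mult_le_cancel_right_pos zero_less_power)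
  then show "slow h \<le> real R ^ 5 * real R ^ (level (tan_width h) - level (tan_scale h))"
    by (simp add: g_def p_def q_def)
qed

text \<open>\<open>tangential_triple\<close> applies with \<open>\<theta> = 1 / R\<close>,
  \<open>\<epsilon>1 = 1 / R ^ h\<close> and \<open>\<epsilon>2 = 1 / steep h\<close>. For
  separation \<open>tan_width\<close> its left side has order \<open>slow h\<close> to the power -3,
  its right side at most \<open>R\<^sup>2\<close> times \<open>slow h\<close> to the power -4. So no
  three points are that far apart, and \<open>card_hits_le_4\<close> applies.\<close>

lemma tangential_count:
  assumes h: "h0 \<le> h" and \<kappa>: "\<kappa> < R ^ level (tan_scale h)"
  shows "card {k' \<in> hits (tangential_set c h) (level (tan_width h)).
      k' div R ^ (level (tan_width h) - level (tan_scale h)) = \<kappa>} \<le> 4"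
proof -
  define p where "p = level (tan_scale h)"
  define q where "q = level (tan_width h)"
  define X where "X = real R ^ h"
  define g where "g = slow h"
  define \<rho> where "\<rho> = l / real R ^ p"
  define B where "B = 2 * CK * R * X powr m"
  define b where "b = X powr m / (2 * K)"
  have R0: "0 < real R" "1 \<le> real R" using R_pos by auto
  have K0: "0 < K" using K_ge_1 by linarith
  have X: "0 < X" "1 \<le> X" using R0 by (auto simp: X_def intro: one_le_power)
  have Xm: "0 < X powr m" using X by simp
  have g: "1 \<le> g" "real R ^ 6 \<le> g" using slow_bounds[OF h] by (auto simp: g_def)
  have X32: "X = g ^ 32" by (simp add: X_def g_def powers_of_slow)
  have \<rho>: "\<rho> \<le> X powr (- m) / real R ^ 3"
    using level_size_less[OF tan_width_le(4) tan_width_le(5)[OF h]] R0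
    by (simp add: \<rho>_def p_def tan_scale_def X_def power_numeral_reduce)
  have B: "0 < B" using CK_ge_1 R0 Xm by (simp add: B_def)
  have CKR: "2 * CK \<le> R"
  proof -
    have "2 * CK \<le> 1000 * CK" using CK_ge_1 by simp
    then show ?thesis using R_consts(1) by (rule order_trans)
  qed
  have \<theta>1: "B * \<rho> \<le> 1 / R"
  proof -
    have "B * \<rho> \<le> B * (X powr (- m) / real R ^ 3)" using \<rho> B by (intro mult_left_mono) auto
    also have "\<dots> = 2 * CK / real R ^ 2"
      using X R0 by (simp add: B_def powr_minus power_numeral_reduce field_simps)
    also have "\<dots> \<le> R / real R ^ 2" using CKR by (intro divide_right_mono) auto
    finally show ?thesis using R0 by (simp add: power2_eq_square)
  qed
  have R6g: "real R ^ n \<le> g ^ k" if "n \<le> 6" "1 \<le> k" for n k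
  proof -
    have "real R ^ n \<le> real R ^ 6" using R0 that by (intro power_increasing) auto
    also have "\<dots> \<le> g ^ 1" using g by simp
    also have "\<dots> \<le> g ^ k" using g that by (intro power_increasing) auto
    finally show ?thesis .
  qed
  have \<epsilon>2: "1 / g ^ 4 \<le> 1 / R" using R6g[of 1 4] R0 g by (intro divide_left_mono) auto
  have X1B: "1 / X * B \<le> (real R)\<^sup>2 / g ^ 16"
  proof -
    have "X powr m \<le> X powr (1 / 2)" using X mM by (intro powr_mono) auto
    also have "\<dots> = g ^ 16" unfolding X_def g_def by (rule powers_of_slow(2))
    finally have "X powr m \<le> g ^ 16" .
    then have "B \<le> R * R * g ^ 16"
      unfolding B_def using CKR R0 CK_ge_1 Xm by (intro mult_mono) auto
    then have "1 / X * B \<le> 1 / X * (R * R * g ^ 16)" using X by (intro mult_left_mono) auto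
    also have "\<dots> = (real R)\<^sup>2 / g ^ 16" using g by (simp add: X32 power2_eq_square field_simps flip: power_add)
    finally show ?thesis .
  qed
  have \<epsilon>1: "1 / X * B \<le> (1 / R)\<^sup>2"
  proof -
    have "real R ^ 4 \<le> g ^ 16" by (rule R6g) auto
    then have "(real R)\<^sup>2 / g ^ 16 \<le> (real R)\<^sup>2 / real R ^ 4" using R0 g by (intro divide_left_mono) auto
    also have "\<dots> = (1 / R)\<^sup>2" using R0 by (simp add: power_numeral_reduce power2_eq_square)
    finally show ?thesis using X1B by linarith
  qed
  have K3: "6 * (K + 1)\<^sup>2 * (1 / R) ^ 3 < 1"
  proof -
    have "K + 1 \<le> 1000 * (K + 3)" using K0 by simp
    then have K1R: "K + 1 \<le> R" using R_consts(2) by (rule order_trans)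
    have "6 * (K + 1)\<^sup>2 \<le> 6 * (real R)\<^sup>2" using K1R K0 by (intro mult_left_mono power_mono) auto
    also have "\<dots> < real R * (real R)\<^sup>2" using R_consts(5) by (intro mult_strict_right_mono) auto
    finally show ?thesis using R0 by (simp add: power2_eq_square power3_eq_cube field_simps)
  qed
  have no3: False if xs: "x1 \<in> tangential_set c h \<inter> cell p \<kappa>" "x2 \<in> tangential_set c h \<inter> cell p \<kappa>"
      "x3 \<in> tangential_set c h \<inter> cell p \<kappa>" "x2 - x1 \<ge> tan_width h" "x3 - x2 \<ge> tan_width h" for x1 x2 x3
  proof -
    have c1: "c \<le> 1"
    proof -
      have "c * 1 \<le> c * real R ^ (k0 + 20)" using c(1) R0 by (intro mult_left_mono one_le_power) auto
      then show ?thesis using c(2) by linarith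
    qed
    have tl: "\<exists>u v w. \<bar>lin (u, v, w) x\<bar> \<le> 1 / X \<and> \<bar>slope (u, v, w) x\<bar> \<le> 1 / g ^ 4 \<and>
        b \<le> \<bar>real_of_int v\<bar> \<and> \<bar>real_of_int v\<bar> \<le> B" if tx: "x \<in> tangential_set c h" for x
    proof -
      obtain u v w where L: "line_in_class h (u, v, w)" "\<bar>lin (u, v, w) x\<bar> < c / height i j u v"
          "\<bar>slope (u, v, w) x\<bar> < 1 / steep h" and x: "x \<in> {a..a + l}"
        using tx by (auto simp: tangential_set_def)
      have "c / height i j u v \<le> c / X" using classD(5)[OF L(1), of c] c by (simp add: X_def)
      also have "\<dots> \<le> 1 / X" using c1 X by (intro divide_right_mono) auto
      finally have "\<bar>lin (u, v, w) x\<bar> \<le> 1 / X" using L(2) by linarith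
      then show ?thesis
        using L(3) tangential_coord[OF h L(1) x L(3)]
        by (intro exI[of _ u] exI[of _ v] exI[of _ w] conjI)
          (auto simp: powers_of_slow g_def X_def b_def B_def)
    qed
    obtain u1 v1 w1 where L1: "\<bar>lin (u1, v1, w1) x1\<bar> \<le> 1 / X" "\<bar>slope (u1, v1, w1) x1\<bar> \<le> 1 / g ^ 4"
        "b \<le> \<bar>real_of_int v1\<bar>" "\<bar>real_of_int v1\<bar> \<le> B" using tl xs(1) by blast
    obtain u2 v2 w2 where L2: "\<bar>lin (u2, v2, w2) x2\<bar> \<le> 1 / X" "\<bar>slope (u2, v2, w2) x2\<bar> \<le> 1 / g ^ 4"
        "b \<le> \<bar>real_of_int v2\<bar>" "\<bar>real_of_int v2\<bar> \<le> B" using tl xs(2) by blast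
    obtain u3 v3 w3 where L3: "\<bar>lin (u3, v3, w3) x3\<bar> \<le> 1 / X" "\<bar>slope (u3, v3, w3) x3\<bar> \<le> 1 / g ^ 4"
        "b \<le> \<bar>real_of_int v3\<bar>" "\<bar>real_of_int v3\<bar> \<le> B" using tl xs(3) by blast
    have x13: "x3 - x1 \<le> \<rho>"
      using xs(1,3) by (simp add: cell_def \<rho>_def distrib_left add_divide_distrib)
    have xI: "x1 \<in> {a..a + l}" "x2 \<in> {a..a + l}" "x3 \<in> {a..a + l}"
      using xs by (auto simp: tangential_set_def)
    have "0 < b" using Xm K0 by (simp add: b_def)
    have tri: "\<mu>\<^sup>2 * (b * tan_width h) ^ 3 \<le> 20 * (K + 1) * (1 / X * B + 1 / g ^ 4)"
      by (rule tangential_triple[OF xI tan_width_le(3) xs(4,5) x13 L1(4) L2(4) L3(4) L1(3) L2(3) L3(3) \<open>0 < b\<close>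
            L1(1) L2(1) L3(1) L1(2) L2(2) L3(2) \<theta>1 _ \<epsilon>2 \<epsilon>1 K3]) (use R0 in auto)
    have "b * tan_width h = 1 / (2 * K * g)"
      unfolding powers_of_slow(4) b_def X_def[symmetric] g_def[symmetric]
      using X by (simp add: powr_minus field_simps)
    moreover have "1 / X * B + 1 / g ^ 4 \<le> 2 * (real R)\<^sup>2 / g ^ 4"
    proof -
      have "(real R)\<^sup>2 / g ^ 16 \<le> (real R)\<^sup>2 / g ^ 4" using g by (intro divide_left_mono power_increasing) auto
      moreover have "1 / g ^ 4 \<le> (real R)\<^sup>2 / g ^ 4" using g R0 by (intro divide_right_mono one_le_power) auto
      ultimately show ?thesis using X1B by linarith
    qed
    ultimately have "\<mu>\<^sup>2 * (1 / (2 * K * g)) ^ 3 \<le> 20 * (K + 1) * (2 * (real R)\<^sup>2 / g ^ 4)"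
      using tri K0 mult_left_mono[of "1 / X * B + 1 / g ^ 4" "2 * (real R)\<^sup>2 / g ^ 4" "20 * (K + 1)"] by simp
    then have step: "\<mu>\<^sup>2 * (1 / (2 * K * g)) ^ 3 * (8 * K ^ 3 * g ^ 4) \<le> 20 * (K + 1) * (2 * (real R)\<^sup>2 / g ^ 4) * (8 * K ^ 3 * g ^ 4)"
      using K0 g by (intro mult_right_mono) auto
    have lhs: "\<mu>\<^sup>2 * (1 / (2 * K * g)) ^ 3 * (8 * K ^ 3 * g ^ 4) = \<mu>\<^sup>2 * g"
      using K0 g by (simp add: power_divide power_mult_distrib power_numeral_reduce field_simps)
    have rhs: "20 * (K + 1) * (2 * (real R)\<^sup>2 / g ^ 4) * (8 * K ^ 3 * g ^ 4) = 320 * ((K + 1) * K ^ 3) * (real R)\<^sup>2"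
      using g by simp
    have KK: "(K + 1) * K ^ 3 \<le> 2 * K ^ 4"
    proof -
      have "(K + 1) * K ^ 3 \<le> (2 * K) * K ^ 3" using K_ge_1 by (intro mult_right_mono) auto
      then show ?thesis by (simp add: power_numeral_reduce)
    qed
    have "\<mu>\<^sup>2 * g \<le> 320 * ((K + 1) * K ^ 3) * (real R)\<^sup>2" using step unfolding lhs rhs .
    also have "\<dots> \<le> 320 * (2 * K ^ 4) * (real R)\<^sup>2" using KK by (intro mult_right_mono mult_left_mono) auto
    finally have up: "\<mu>\<^sup>2 * g \<le> 640 * (K ^ 4 * (real R)\<^sup>2)" by simp
    have "1000 * K ^ 4 * real R ^ 2 * (1 / \<mu>\<^sup>2) \<le> 1000 * K ^ 4 * real R ^ 6 * (1 + 1 / \<mu>\<^sup>2)"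
      using K_ge_1 R0 by (intro mult_mono power_increasing) auto
    then have "1000 * K ^ 4 * real R ^ 2 * (1 / \<mu>\<^sup>2) \<le> g" using slow_large[OF h] by (simp add: g_def)
    then have "1000 * (K ^ 4 * real R ^ 2) \<le> \<mu>\<^sup>2 * g" using \<mu> by (simp add: field_simps)
    moreover have "0 < K ^ 4 * real R ^ 2" using K0 R0 by simp
    ultimately show False using up by linarith
  qed
  have "card {k' \<in> hits (tangential_set c h) q. k' div R ^ (q - p) = \<kappa>} \<le> card (hits (tangential_set c h \<inter> cell p \<kappa>) q)"
    using tangential_levels(1)[OF h] by (intro card_hits_in_cell) (simp add: p_def q_def)
  also have "\<dots> \<le> 4"
  proof (rule card_hits_le_4[OF no3])
    show "tan_width h \<le> l / real R ^ q"
      unfolding q_def by (rule le_level_size[OF tan_width_le(3) tan_width_le(2)[OF h]])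
  qed
  finally show ?thesis by (simp add: p_def q_def)
qed


section \<open>Counting transversal lines in one cell\<close>

lemma crowd_beats_height:
  assumes k: "1 \<le> k"
  shows "112 * real R ^ (k + 3) * (8 * CK * (K + 3)) powr (1 / M) < real (crowd k) powr (1 + 1 / M)"
proof -
  define K2 where "K2 = 8 * CK * (K + 3)"
  have R0: "0 < real R" "1 \<le> real R" using R_pos by auto
  have K2: "1 \<le> K2"
  proof -
    have "1 * 1 \<le> (8 * CK) * (K + 3)" using CK_ge_1 K_ge_1 by (intro mult_mono) auto
    then show ?thesis by (simp add: K2_def)
  qed
  have "125 * K2 \<le> R" using R_consts(3) by (simp add: K2_def)
  then have K2R: "K2 \<le> R / 125" by simp
  \<comment> \<open>\<open>1 / M \<le> 2\<close>, so the constants cost at most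
    \<open>(R / 125)\<^sup>2\<close>: exactly the room between \<open>R ^ (k + 3)\<close> and
    \<open>R ^ (k + 5)\<close>, as 112 is less than 15625.\<close>
  have "K2 powr (1 / M) \<le> K2 powr 2"
    using K2 mM by (intro powr_mono) (auto simp: pos_divide_le_eq)
  also have "\<dots> = K2\<^sup>2" using K2 powr_realpow[of K2 2] by simp
  also have "\<dots> \<le> (R / 125)\<^sup>2" using K2 K2R by (intro power_mono) auto
  finally have "112 * real R ^ (k + 3) * K2 powr (1 / M) \<le> 112 * real R ^ (k + 3) * (R / 125)\<^sup>2"
    using R0 by (intro mult_left_mono) auto
  also have "\<dots> = (112 / 15625) * real R ^ (k + 5)" by (simp add: power_divide power_add power_numeral_reduce)
  also have "\<dots> < 1 * real R ^ (k + 5)" using R0 by (intro mult_strict_right_mono) auto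
  also have "\<dots> \<le> real (crowd k) powr (1 + 1 / M)" using crowd_powr[OF k] by simp
  finally show ?thesis by (simp add: K2_def)
qed

text \<open>With more lines, \<open>crowded_cell\<close> produces a line whose values on the cell
  shrink by \<open>G\<close> and whose height shrinks by \<open>G powr (1 / M)\<close>, up to
  constants. By \<open>crowd_beats_height\<close> value times height is then below \<open>c\<close>
  on the whole cell, which \<open>not_trapped\<close> forbids for an alive cell.\<close>

lemma transversal_lines_le:
  assumes h: "h0 \<le> h" and valid: "1 / steep h \<le> slope_bound h n"
    and alive: "alive rem_index rem_level rem_set (level (width h n) - lag n) \<kappa>"
    and S: "finite S" and mem: "\<And>u v w. (u, v, w) \<in> S \<Longrightarrow> line_in_class h (u, v, w) \<and>
      (\<exists>x\<in>cell (level (width h n) - lag n) \<kappa>. \<bar>lin (u, v, w) x\<bar> < c / height i j u v \<and>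
         \<bar>slope (u, v, w) x\<bar> < slope_bound h n)"
  shows "card S \<le> (crowd (lag n))\<^sup>2"
proof (rule ccontr)
  assume "\<not> ?thesis"
  then have card: "card S > (crowd (lag n))\<^sup>2" by simp
  define p where "p = level (width h n) - lag n"
  define \<rho> where "\<rho> = l / real R ^ p"
  define x0 where "x0 = a + l * real \<kappa> / real R ^ p"
  define X where "X = real R ^ h"
  define Y where "Y = real R ^ (h + 1)"
  define D where "D = slope_bound h n"
  define k where "k = lag n"
  define G where "G = crowd k"
  define K2 where "K2 = 8 * CK * (K + 3)"
  have R0: "0 < real R" "1 \<le> real R" using R_pos by auto
  have k1: "1 \<le> k" using lag_ge_1 by (simp add: k_def)
  have \<rho>: "0 < \<rho>" using l_pos R0 by (simp add: \<rho>_def)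
  have X: "0 < X" "Y = R * X" using R0 by (simp_all add: X_def Y_def)
  have X1: "1 \<le> Y" unfolding Y_def using R0 by (intro one_le_power) auto
  have D: "0 < D" using slope_bound_pos by (simp add: D_def)
  have cell_eq: "cell p \<kappa> = {x0..x0 + \<rho>}"
    by (simp add: cell_def x0_def \<rho>_def distrib_left add_divide_distrib)
  have \<kappa>: "\<kappa> < R ^ p" using alive by (simp add: alive_def p_def)
  have sub: "cell p \<kappa> \<subseteq> {a..a + l}" using cell_subset[of 0 p \<kappa>] \<kappa> by (simp add: cell_0)
  have GR: "real R ^ 2 \<le> G" using crowd_ge[OF k1] by (simp add: G_def)
  have "1 \<le> real R ^ 2" using R0 by (intro one_le_power) auto
  then have G1: "1 \<le> real G" using GR by linarith
  have K2R: "K2 \<le> real R"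
  proof -
    have "K2 \<le> 1000 * CK * (K + 3)"
      unfolding K2_def using CK_ge_1 K_ge_1 by (intro mult_right_mono) auto
    then show ?thesis using R_consts(3) by (rule order_trans)
  qed
  have RG: "real R \<le> G"
  proof -
    have "real R ^ 1 \<le> real R ^ 2" using R0 by (intro power_increasing) auto
    then show ?thesis using GR by simp
  qed
  have K2: "1 \<le> K2"
  proof -
    have "1 * 1 \<le> (8 * CK) * (K + 3)" using CK_ge_1 K_ge_1 by (intro mult_mono) auto
    then show ?thesis by (simp add: K2_def)
  qed
  have e: "1 \<le> steep h" by (rule steep_ge_1)
  have D\<rho>_low: "c / X \<le> D * \<rho>"
  proof -
    have "1 \<le> real R ^ (k + 1)" using R0 by (intro one_le_power) auto
    then have "c * 1 \<le> (4 * c) * real R ^ (k + 1)" using c by (intro mult_mono) auto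
    then have "c / X \<le> 4 * c * real R ^ (k + 1) / X" using X by (intro divide_right_mono) auto
    also have "\<dots> \<le> D * \<rho>" unfolding X_def D_def \<rho>_def p_def k_def by (rule lower[OF valid])
    finally show ?thesis .
  qed
  have D\<rho>_up: "D * \<rho> \<le> 4 * c * real R ^ (k + 2) / X"
    unfolding X_def D_def \<rho>_def p_def k_def by (rule upper[OF valid])
  have D\<rho>_small: "12 * (D * \<rho>) < G"
  proof -
    have "D * \<rho> \<le> 1 / (real R ^ 15 * steep h ^ 7)"
      unfolding D_def \<rho>_def p_def by (rule small[OF valid])
    also have "\<dots> \<le> 1 / (1 * 1)" using R0 e by (intro divide_left_mono mult_mono one_le_power) auto
    finally have "12 * (D * \<rho>) \<le> 12" by simp
    moreover have "12 < real G" using R_consts(5) RG by linarith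
    ultimately show ?thesis by linarith
  qed
  have var: "K * CK * \<rho> * (D + Y powr m) \<le> D / (8 * R)"
    unfolding D_def \<rho>_def p_def Y_def by (rule transversal_variation[OF valid])
  also have "\<dots> \<le> D / 8" using D R0 by (intro divide_left_mono) auto
  finally have var8: "K * CK * \<rho> * (D + Y powr m) \<le> D / 8" .
  have det: "36 * (D * \<rho>) * D * Y powr m < \<nu>"
    unfolding D_def \<rho>_def p_def Y_def by (rule transversal_det_small[OF valid])
  have DK: "D \<le> (K + 2) * Y powr M"
  proof -
    have "1 \<le> real R ^ n" using R0 by (intro one_le_power) auto
    then have "(K + 2) * Y powr M / real R ^ n \<le> (K + 2) * Y powr M / 1"
      using K_ge_1 R0 by (intro divide_left_mono) auto
    then show ?thesis unfolding D_def slope_bound_def Y_def by simp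
  qed
  have x0: "a \<le> x0" "x0 + \<rho> \<le> a + l" using sub \<rho> unfolding cell_eq by auto
  have mem': "height i j u v < Y \<and> (\<exists>x\<in>{x0..x0 + \<rho>}. \<bar>lin (u, v, w) x\<bar> \<le> D * \<rho> \<and> \<bar>slope (u, v, w) x\<bar> < D)"
    if LS: "(u, v, w) \<in> S" for u v w
  proof -
    obtain x where L: "line_in_class h (u, v, w)" and x: "x \<in> cell p \<kappa>" "\<bar>lin (u, v, w) x\<bar> < c / height i j u v"
        "\<bar>slope (u, v, w) x\<bar> < D"
      using mem[OF LS] unfolding p_def D_def by blast
    have "c / height i j u v \<le> c / X" using classD(5)[OF L, of c] c by (simp add: X_def)
    then have "\<bar>lin (u, v, w) x\<bar> \<le> D * \<rho>" using x(2) D\<rho>_low by linarith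
    then show ?thesis using classD(3)[OF L] x unfolding cell_eq Y_def by blast
  qed
  have K22: "8 * CK * (K + 2 + 1) = K2" by (simp add: K2_def)
  obtain u v w where uv: "(u, v) \<noteq> (0, 0)" and ht: "height i j u v \<le> (8 * CK * (K + 2 + 1) / G) powr (1 / M) * Y"
    and lin: "\<And>x. x \<in> {x0..x0 + \<rho>} \<Longrightarrow> \<bar>lin (u, v, w) x\<bar> \<le> 28 * (D * \<rho>) / G"
    and sl: "\<And>x. x \<in> {x0..x0 + \<rho>} \<Longrightarrow> \<bar>slope (u, v, w) x\<bar> \<le> 16 * D / G"
  proof (rule crowded_cell[OF ij(1,2) x0 \<rho> _ D S _ _ mem' var8 det D\<rho>_small DK _ _ X1])
    show "G\<^sup>2 < card S" using card by (simp add: G_def k_def)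
    show "1 \<le> G" using G1 by simp
    show "0 \<le> K + 2" using K_ge_1 by simp
    show "8 * CK * (K + 2 + 1) \<le> real G" unfolding K22 using K2R RG by linarith
  qed (use X1 in auto)
  define H where "H = height i j u v"
  have H1: "1 \<le> H" using height_ge_1[OF ij(1,2) uv] by (simp add: H_def)
  have key: "28 * (D * \<rho>) / G < c / H"
  proof -
    have H: "H \<le> (K2 / G) powr (1 / M) * Y" using ht by (simp only: H_def K22)
    have "28 * (D * \<rho>) * H \<le> (28 * (4 * c * real R ^ (k + 2) / X)) * ((K2 / G) powr (1 / M) * Y)"
      using H D\<rho>_up D \<rho> H1 c R0 X by (intro mult_mono) auto
    also have "\<dots> = c * (112 * real R ^ (k + 3) * K2 powr (1 / M)) / G powr (1 / M)"
      using X K2 G1 by (simp add: powr_divide power_add power_numeral_reduce)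
    also have "\<dots> < c * G powr (1 + 1 / M) / G powr (1 / M)"
      using crowd_beats_height[OF k1] c G1 unfolding K2_def[symmetric] G_def[symmetric]
      by (intro divide_strict_right_mono mult_strict_left_mono) auto
    also have "\<dots> = c * G" using G1 by (simp add: powr_add)
    finally show ?thesis using G1 H1 by (simp add: field_simps)
  qed
  show False
  proof (rule not_trapped[OF _ uv])
    show "alive rem_index rem_level rem_set p \<kappa>" using alive by (simp add: p_def)
    fix x assume x: "x \<in> cell p \<kappa>"
    show "\<bar>lin (u, v, w) x\<bar> < c / height i j u v"
      using lin[of x] x key unfolding cell_eq H_def by linarith
    have "\<bar>slope (u, v, w) x\<bar> * \<rho> \<le> 16 * D / G * \<rho>"
      using sl[of x] x \<rho> unfolding cell_eq by (intro mult_right_mono) auto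
    also have "\<dots> = 16 * (D * \<rho>) / G" by simp
    also have "\<dots> \<le> 28 * (D * \<rho>) / G" using D \<rho> G1 by (intro divide_right_mono) auto
    finally show "\<bar>slope (u, v, w) x\<bar> * (l / real R ^ p) < c / height i j u v"
      using key unfolding \<rho>_def H_def by linarith
  qed
qed

text \<open>Assign to every hit cell one line responsible for it. At most \<open>G\<^sup>2\<close>
  lines occur. Each is responsible for at most 3 cells, because its small values in the counting
  cell are attained on a set of diameter at most \<open>width h n\<close>.\<close>

lemma transversal_count:
  assumes h: "h0 \<le> h" and valid: "1 / steep h \<le> slope_bound h n"
    and alive: "alive rem_index rem_level rem_set (level (width h n) - lag n) \<kappa>"
  shows "card {k' \<in> hits (transversal_set c h n) (level (width h n)). k' div R ^ lag n = \<kappa>} \<le> 3 * (crowd (lag n))\<^sup>2"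
proof -
  define q where "q = level (width h n)"
  define p where "p = q - lag n"
  define \<rho> where "\<rho> = l / real R ^ p"
  define x0 where "x0 = a + l * real \<kappa> / real R ^ p"
  define X where "X = real R ^ h"
  define D where "D = slope_bound h n"
  define W where "W = {k' \<in> hits (transversal_set c h n) q. k' div R ^ lag n = \<kappa>}"
  have R0: "0 < real R" "1 \<le> real R" using R_pos by auto
  have qp: "q - p = lag n" "p \<le> q" using lag_le_level[OF valid] by (simp_all add: p_def q_def)
  have \<rho>: "0 < \<rho>" using l_pos R0 by (simp add: \<rho>_def)
  have X: "0 < X" using R0 by (simp add: X_def)
  have D: "0 < D" using slope_bound_pos by (simp add: D_def)
  have cell_eq: "cell p \<kappa> = {x0..x0 + \<rho>}"
    by (simp add: cell_def x0_def \<rho>_def distrib_left add_divide_distrib)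
  have \<kappa>: "\<kappa> < R ^ p" using alive by (simp add: alive_def p_def q_def)
  have sub: "cell p \<kappa> \<subseteq> {a..a + l}" using cell_subset[of 0 p \<kappa>] \<kappa> by (simp add: cell_0)
  have x0: "a \<le> x0" "x0 + \<rho> \<le> a + l" using sub \<rho> unfolding cell_eq by auto
  have fW: "finite W" using finite_hits by (simp add: W_def)
  have "\<forall>k'\<in>W. \<exists>L x. x \<in> cell q k' \<and> x \<in> cell p \<kappa> \<and> line_in_class h L \<and>
      \<bar>lin L x\<bar> < c / (case L of (u, v, w) \<Rightarrow> height i j u v) \<and> D / R \<le> \<bar>slope L x\<bar> \<and> \<bar>slope L x\<bar> < D"
  proof
    fix k' assume k': "k' \<in> W"
    then obtain x where x: "x \<in> cell q k'" "x \<in> transversal_set c h n" by (auto simp: W_def hits_def)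
    have "x \<in> cell p \<kappa>" using cell_subset[OF qp(2), of k'] x(1) k' qp(1) by (auto simp: W_def)
    moreover obtain u v w where "line_in_class h (u, v, w)" "\<bar>lin (u, v, w) x\<bar> < c / height i j u v"
        "D / R \<le> \<bar>slope (u, v, w) x\<bar>" "\<bar>slope (u, v, w) x\<bar> < D"
      using x(2) unfolding transversal_set_def D_def by blast
    ultimately show "\<exists>L x. x \<in> cell q k' \<and> x \<in> cell p \<kappa> \<and> line_in_class h L \<and>
      \<bar>lin L x\<bar> < c / (case L of (u, v, w) \<Rightarrow> height i j u v) \<and> D / R \<le> \<bar>slope L x\<bar> \<and> \<bar>slope L x\<bar> < D"
      using x(1) by (intro exI[of _ "(u, v, w)"] exI[of _ x]) simp
  qed
  then obtain F \<xi> where F: "\<And>k'. k' \<in> W \<Longrightarrow> \<xi> k' \<in> cell q k' \<and> \<xi> k' \<in> cell p \<kappa> \<and> line_in_class h (F k') \<and>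
      \<bar>lin (F k') (\<xi> k')\<bar> < c / (case F k' of (u, v, w) \<Rightarrow> height i j u v) \<and>
      D / R \<le> \<bar>slope (F k') (\<xi> k')\<bar> \<and> \<bar>slope (F k') (\<xi> k')\<bar> < D"
    by metis
  have S: "card (F ` W) \<le> (crowd (lag n))\<^sup>2"
  proof (rule transversal_lines_le[OF h valid alive])
    show "finite (F ` W)" using fW by simp
    fix u v w assume "(u, v, w) \<in> F ` W"
    then obtain k' where k': "k' \<in> W" "F k' = (u, v, w)" by force
    then show "line_in_class h (u, v, w) \<and>
      (\<exists>x\<in>cell (level (width h n) - lag n) \<kappa>. \<bar>lin (u, v, w) x\<bar> < c / height i j u v \<and>
         \<bar>slope (u, v, w) x\<bar> < slope_bound h n)"
      using F[OF k'(1)] unfolding k'(2) p_def q_def D_def by auto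
  qed
  have fibre: "card {k' \<in> W. F k' = L} \<le> 3" if LF: "L \<in> F ` W" for L
  proof -
    obtain u v w where L: "L = (u, v, w)" by (metis prod_cases3)
    obtain k1 where k1: "k1 \<in> W" "F k1 = (u, v, w)" using LF L by force
    note F1 = F[OF k1(1), unfolded k1(2)]
    define BL where "BL = {x \<in> cell p \<kappa>. \<bar>lin (u, v, w) x\<bar> \<le> c / X}"
    have Lc: "line_in_class h (u, v, w)" using F1 by blast
    have cX: "c / height i j u v \<le> c / X" using classD(5)[OF Lc, of c] c by (simp add: X_def)
    have "{k' \<in> W. F k' = L} \<subseteq> hits BL q"
    proof
      fix k' assume "k' \<in> {k' \<in> W. F k' = L}"
      then have k': "k' \<in> W" "F k' = (u, v, w)" by (auto simp: L)
      have "\<xi> k' \<in> BL" using F[OF k'(1), unfolded k'(2)] cX by (simp add: BL_def)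
      then show "k' \<in> hits BL q" using F[OF k'(1)] k'(1) by (auto simp: hits_def W_def)
    qed
    then have "card {k' \<in> W. F k' = L} \<le> card (hits BL q)" by (intro card_mono finite_hits)
    also have "\<dots> \<le> 3"
    proof (rule card_hits_le_3)
      show "width h n \<le> l / real R ^ q"
        unfolding q_def by (rule le_level_size[OF width_pos[OF valid] width_le[OF valid]])
      fix x y assume xy: "x \<in> BL" "y \<in> BL"
      have "K * CK * \<rho> * (D + (real R ^ (h + 1)) powr m) \<le> D / (8 * R)"
        unfolding D_def \<rho>_def p_def q_def by (rule transversal_variation[OF valid])
      also have "\<dots> \<le> D / (2 * real R)" using D R0 by (intro divide_left_mono) auto
      finally have var: "K * CK * \<rho> * (D + (real R ^ (h + 1)) powr m) \<le> D / (2 * real R)" .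
      have "y - x \<le> 4 * (c / X) * R / D"
      proof (rule line_spread[OF ij(1,2) x0 _ D R0(2) classD(3)[OF Lc] _ _ _ var])
        show "\<xi> k1 \<in> {x0..x0 + \<rho>}" using F1 by (simp add: cell_eq)
        show "D / R \<le> \<bar>slope (u, v, w) (\<xi> k1)\<bar>" "\<bar>slope (u, v, w) (\<xi> k1)\<bar> < D" using F1 by blast+
      qed (use xy \<rho> in \<open>auto simp: BL_def cell_eq\<close>)
      also have "\<dots> = width h n" unfolding width_def X_def[symmetric] D_def[symmetric] by simp
      finally show "y - x \<le> width h n" .
    qed
    finally show ?thesis .
  qed
  have "W = (\<Union>L\<in>F ` W. {k' \<in> W. F k' = L})" by auto
  then have "card W = card (\<Union>L\<in>F ` W. {k' \<in> W. F k' = L})" by simp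
  also have "\<dots> \<le> (\<Sum>L\<in>F ` W. card {k' \<in> W. F k' = L})" using fW by (intro card_UN_le) auto
  also have "\<dots> \<le> (\<Sum>L\<in>F ` W. 3)" using fibre by (intro sum_mono) auto
  also have "\<dots> \<le> 3 * (crowd (lag n))\<^sup>2" using S by simp
  finally show ?thesis by (simp add: W_def q_def)
qed

end

section \<open>Summation of the costs\<close>

lemma sum_half_powers_le:
  assumes "finite (S :: nat set)"
  shows "(\<Sum>n\<in>S. (1 / 2 :: real) ^ n) \<le> 2"
proof -
  have "(\<Sum>n\<in>S. (1 / 2 :: real) ^ n) \<le> (\<Sum>n. (1 / 2) ^ n)"
    using assms by (intro sum_le_suminf) auto
  then show ?thesis by (simp add: suminf_geometric)
qed

context removal_params
begin

lemma far_class: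
  assumes h: "32 * (q + 1) \<le> h"
  shows "real R ^ (q + 1) \<le> slow h" "real R ^ (q + 1) \<le> steep h ^ 4"
proof -
  have R0: "1 \<le> real R" "0 < real R" using R_pos by auto
  have "real R ^ (q + 1) = R powr real (q + 1)" using R0 by (simp only: powr_realpow)
  also have "\<dots> \<le> R powr (real h / 32)"
  proof (intro powr_mono)
    have "real (32 * (q + 1)) \<le> real h" using h by (simp only: of_nat_le_iff)
    then show "real (q + 1) \<le> real h / 32" by simp
  qed (use R0 in auto)
  also have "\<dots> = slow h" using R0 by (simp add: slow_def powr_powr flip: powr_realpow)
  finally show 1: "real R ^ (q + 1) \<le> slow h" .
  have "1 \<le> real R ^ (q + 1)" using R0 by (intro one_le_power) auto
  then have "1 \<le> slow h" using 1 by linarith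
  then have "slow h ^ 1 \<le> slow h ^ 16" by (intro power_increasing) auto
  also have "\<dots> = steep h ^ 4" unfolding powers_of_slow(1) by (simp flip: power_mult)
  finally show "real R ^ (q + 1) \<le> steep h ^ 4" using 1 by simp
qed

text \<open>From \<open>h = 32 * (q + 1)\<close> on, both kinds of width are below
  \<open>l / R ^ (q + 1)\<close>, so only finitely many \<open>h\<close> act at level
  \<open>q\<close>; for each of them \<open>n\<close> is bounded.\<close>

lemma finite_level:
  "finite {\<iota> \<in> rem_index. rem_level \<iota> = q}"
proof -
  have R0: "1 \<le> real R" "0 < real R" using R_pos by auto
  define N where "N = 32 * (q + 1)"
  have tan: "h < N" if "h0 \<le> h" "level (tan_width h) = q" for h
  proof (rule ccontr)
    assume "\<not> h < N"
    then have "real R ^ (q + 1) \<le> slow h" by (intro far_class(1)) (simp add: N_def)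
    then have "l / slow h \<le> l / real R ^ (q + 1)" using l_pos R0 slow_ge_1[OF that(1)] by (intro divide_left_mono) auto
    then have "tan_width h \<le> l / real R ^ (q + 1)" using tan_width_le(1)[OF that(1)] by linarith
    then show False using le_level[OF tan_width_le(3)] that(2) by fastforce
  qed
  have trans: "h < N" if valid: "1 / steep h \<le> slope_bound h n" and eq: "level (width h n) = q" for h n
  proof (rule ccontr)
    assume "\<not> h < N"
    then have "real R ^ (q + 1) \<le> steep h ^ 4" by (intro far_class(2)) (simp add: N_def)
    also have "\<dots> \<le> steep h ^ 6" using steep_ge_1 by (intro power_increasing) auto
    finally have q6: "1 * real R ^ (q + 1) \<le> real R ^ 16 * steep h ^ 6"
      using R0 by (intro mult_mono one_le_power) auto
    have "width h n * (1 * real R ^ (q + 1)) \<le> width h n * (real R ^ 16 * steep h ^ 6)"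
      using q6 width_pos[OF valid] by (intro mult_left_mono) auto
    also have "\<dots> \<le> l" using width_small[OF valid] by (simp add: mult.assoc)
    finally have "width h n \<le> l / real R ^ (q + 1)" using R0 by (simp add: pos_le_divide_eq)
    then show False using le_level[OF width_pos[OF valid]] eq by fastforce
  qed
  have "{\<iota> \<in> rem_index. rem_level \<iota> = q} \<subseteq>
      (\<lambda>(h, n). Transversal h n) ` ({..<N} \<times> {..2 * N + 2}) \<union> Tangential ` {..<N} \<union> {Low}"
  proof
    fix \<iota> assume \<iota>: "\<iota> \<in> {\<iota> \<in> rem_index. rem_level \<iota> = q}"
    show "\<iota> \<in> (\<lambda>(h, n). Transversal h n) ` ({..<N} \<times> {..2 * N + 2}) \<union> Tangential ` {..<N} \<union> {Low}"
    proof (cases \<iota>)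
      case (Transversal h n)
      then have valid: "1 / steep h \<le> slope_bound h n" and "level (width h n) = q"
        using \<iota> by (auto simp: rem_index_def rem_level_def)
      then have "h < N" "n \<le> 2 * h + 2" using trans transversal_index_le by auto
      then show ?thesis using Transversal by auto
    next
      case (Tangential h)
      then show ?thesis using \<iota> tan by (auto simp: rem_index_def rem_level_def)
    qed simp
  qed
  then show ?thesis by (rule finite_subset) auto
qed

text \<open>For fixed \<open>n\<close> the width falls at least by a factor \<open>R\<close> with
  each step of \<open>h\<close>. A level thus contains at most one transversal class per
  \<open>n\<close>, and its cost may be summed over \<open>n\<close> alone.\<close>

lemma width_level_inj:
  assumes v: "1 / steep h \<le> slope_bound h n" "1 / steep h' \<le> slope_bound h' n"
    and eq: "level (width h n) = level (width h' n)"
  shows "h = h'"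
proof -
  have less: "level (width h n) < level (width h' n)"
    if lt: "h < h'" and v: "1 / steep h \<le> slope_bound h n" "1 / steep h' \<le> slope_bound h' n" for h h'
  proof (rule level_Suc_le[OF width_pos[OF v(2)] _ width_le[OF v(1)]])
    have R0: "1 \<le> real R" "0 < real R" using R_pos by auto
    have mono: "real R ^ (h + 1) \<le> real R ^ (h' + 1)" using lt R0 by (intro power_increasing) auto
    have "slope_bound h n \<le> slope_bound h' n"
      unfolding slope_bound_def using mono mM K_ge_1 R0
      by (intro divide_right_mono mult_left_mono powr_mono2) auto
    moreover have "real R * real R ^ h \<le> real R ^ h'"
      using power_increasing[of "Suc h" h' "real R"] lt R0 by simp
    ultimately have "(R * real R ^ h) * slope_bound h n \<le> real R ^ h' * slope_bound h' n"
      using slope_bound_pos[of h n] by (intro mult_mono) auto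
    then have "4 * c * R / (real R ^ h' * slope_bound h' n) \<le> 4 * c * R / ((R * real R ^ h) * slope_bound h n)"
      using c R0 slope_bound_pos[of h n] slope_bound_pos[of h' n] by (intro divide_left_mono mult_pos_pos) auto
    then have "R * width h' n \<le> R * (4 * c * R / ((R * real R ^ h) * slope_bound h n))"
      unfolding width_def using R0 by (intro mult_left_mono) auto
    also have "\<dots> = width h n" using R0 by (simp add: width_def)
    finally show "R * width h' n \<le> width h n" .
  qed
  show ?thesis using less[of h h'] less[of h' h] v eq by (cases h h' rule: linorder_cases) auto
qed

text \<open>The 5 is 2 + 2 + 1: a geometric series over \<open>n\<close> for the transversal
  classes, one over \<open>h\<close> for the tangential ones, and the single class
  \<open>Low\<close>.\<close>

lemma rem_scheme:
  fixes e :: real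
  defines "T \<equiv> real R powr s"
  assumes tr: "\<And>n. 3 * (real (crowd (lag n)))\<^sup>2 / T ^ (lag n - 1) \<le> e * (1 / 2) ^ n"
    and ta: "\<And>h. h0 \<le> h \<Longrightarrow> 4 / T ^ (level (tan_width h) - 1 - level (tan_scale h)) \<le> e * (1 / 2) ^ h"
    and lo: "r0 / T ^ (q1 - 1) \<le> e" and e: "0 \<le> e"
  shows "scheme T (5 * e) rem_index rem_base rem_level rem_count rem_set"
  unfolding scheme_def
proof (intro conjI ballI allI)
  fix \<iota> assume \<iota>: "\<iota> \<in> rem_index"
  show "rem_base \<iota> < rem_level \<iota>"
  proof (cases \<iota>)
    case (Transversal h n)
    then have valid: "1 / steep h \<le> slope_bound h n" using \<iota> by (auto simp: rem_index_def)
    show ?thesis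
      using lag_le_level[OF valid] lag_ge_1[of n] by (simp add: rem_base_def rem_level_def Transversal)
  next
    case (Tangential h)
    then show ?thesis using \<iota> tangential_levels(1) by (auto simp: rem_base_def rem_level_def rem_index_def)
  next
    case Low
    then show ?thesis using q1 by (simp add: rem_base_def rem_level_def)
  qed
  have r0: "0 \<le> r0" using low_hits by (rule order_trans[rotated]) simp
  then show "0 \<le> rem_count \<iota>" by (cases \<iota>) (simp_all add: rem_count_def)
  fix \<kappa>
  show "alive rem_index rem_level rem_set (rem_base \<iota>) \<kappa> \<longrightarrow>
      real (card {k' \<in> hits (rem_set \<iota>) (rem_level \<iota>). k' div R ^ (rem_level \<iota> - rem_base \<iota>) = \<kappa>}) \<le> rem_count \<iota>"
  proof
    assume al: "alive rem_index rem_level rem_set (rem_base \<iota>) \<kappa>"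
    show "real (card {k' \<in> hits (rem_set \<iota>) (rem_level \<iota>). k' div R ^ (rem_level \<iota> - rem_base \<iota>) = \<kappa>}) \<le> rem_count \<iota>"
    proof (cases \<iota>)
      case (Transversal h n)
      then have h: "h0 \<le> h" and valid: "1 / steep h \<le> slope_bound h n" using \<iota> by (auto simp: rem_index_def)
      have "level (width h n) - (level (width h n) - lag n) = lag n" using lag_le_level[OF valid] by simp
      moreover have "alive rem_index rem_level rem_set (level (width h n) - lag n) \<kappa>"
        using al by (simp add: Transversal rem_base_def)
      from of_nat_mono[OF transversal_count[OF h valid this], where ?'a = real]
      have "real (card {k' \<in> hits (transversal_set c h n) (level (width h n)). k' div R ^ lag n = \<kappa>}) \<le> 3 * (real (crowd (lag n)))\<^sup>2"
        by simp
      ultimately show ?thesis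
        by (simp add: Transversal rem_set_def rem_level_def rem_base_def rem_count_def)
    next
      case (Tangential h)
      then have h: "h0 \<le> h" using \<iota> by (auto simp: rem_index_def)
      have "\<kappa> < R ^ level (tan_scale h)" using al by (simp add: alive_def rem_base_def Tangential)
      from tangential_count[OF h this] show ?thesis
        by (simp add: Tangential rem_set_def rem_level_def rem_base_def rem_count_def)
    next
      case Low
      have "card {k' \<in> hits (low_set h0 c) q1. k' div R ^ q1 = \<kappa>} \<le> card (hits (low_set h0 c) q1)"
        by (intro card_mono finite_hits) auto
      then show ?thesis using low_hits
        by (simp add: Low rem_set_def rem_level_def rem_base_def rem_count_def)
    qed
  qed
next
  fix q
  show fin: "finite {\<iota> \<in> rem_index. rem_level \<iota> = q}" by (rule finite_level)
  define w where "w \<iota> = rem_count \<iota> / T ^ (q - 1 - rem_base \<iota>)" for \<iota>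
  define A where "A = {\<iota> \<in> rem_index. rem_level \<iota> = q}"
  define A1 where "A1 = {\<iota> \<in> A. \<exists>h n. \<iota> = Transversal h n}"
  define A2 where "A2 = {\<iota> \<in> A. \<exists>h. \<iota> = Tangential h}"
  define A3 where "A3 = {\<iota> \<in> A. \<iota> = Low}"
  have "\<iota> \<in> A1 \<union> A2 \<union> A3" if "\<iota> \<in> A" for \<iota>
    using that by (cases \<iota>) (auto simp: A1_def A2_def A3_def)
  then have A: "A = A1 \<union> A2 \<union> A3" by (auto simp: A1_def A2_def A3_def)
  have "finite A" using fin by (simp add: A_def)
  then have fA: "finite A1" "finite A2" "finite A3" unfolding A by auto
  have "sum w A = sum w A1 + sum w A2 + sum w A3"
    unfolding A using fA by (subst sum.union_disjoint; auto simp: A1_def A2_def A3_def sum.union_disjoint)+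
  moreover have "sum w A1 \<le> 2 * e"
  proof -
    define N where "N \<iota> = (case \<iota> of Transversal h n \<Rightarrow> n | _ \<Rightarrow> 0)" for \<iota> :: removal
    have inj: "inj_on N A1"
    proof (rule inj_onI)
      fix x y assume xy: "x \<in> A1" "y \<in> A1" "N x = N y"
      obtain h n where x: "x = Transversal h n" "1 / steep h \<le> slope_bound h n" "level (width h n) = q"
        using xy(1) by (auto simp: A1_def A_def rem_index_def rem_level_def)
      obtain h' n' where y: "y = Transversal h' n'" "1 / steep h' \<le> slope_bound h' n'" "level (width h' n') = q"
        using xy(2) by (auto simp: A1_def A_def rem_index_def rem_level_def)
      have "n' = n" using xy(3) x y by (simp add: N_def)
      then show "x = y" using x y width_level_inj[of h n h'] by simp
    qed
    have "sum w A1 \<le> (\<Sum>\<iota>\<in>A1. e * (1 / 2) ^ N \<iota>)"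
    proof (rule sum_mono)
      fix \<iota> assume "\<iota> \<in> A1"
      then obtain h n where x: "\<iota> = Transversal h n" "1 / steep h \<le> slope_bound h n" "level (width h n) = q"
        by (auto simp: A1_def A_def rem_index_def rem_level_def)
      have "lag n \<le> q" using lag_le_level[OF x(2)] x(3) by simp
      then have "q - 1 - (q - lag n) = lag n - 1" by simp
      then show "w \<iota> \<le> e * (1 / 2) ^ N \<iota>"
        using tr[of n] by (simp add: w_def x rem_count_def rem_base_def N_def)
    qed
    also have "\<dots> = e * (\<Sum>n\<in>N ` A1. (1 / 2) ^ n)"
      by (simp add: sum_distrib_left sum.reindex[OF inj])
    also have "\<dots> \<le> e * 2" using fA e by (intro mult_left_mono sum_half_powers_le) auto
    finally show ?thesis by simp
  qed
  moreover have "sum w A2 \<le> 2 * e"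
  proof -
    define N where "N \<iota> = (case \<iota> of Tangential h \<Rightarrow> h | _ \<Rightarrow> 0)" for \<iota> :: removal
    have inj: "inj_on N A2"
      by (rule inj_onI) (auto simp: A2_def N_def)
    have "sum w A2 \<le> (\<Sum>\<iota>\<in>A2. e * (1 / 2) ^ N \<iota>)"
    proof (rule sum_mono)
      fix \<iota> assume "\<iota> \<in> A2"
      then obtain h where x: "\<iota> = Tangential h" "h0 \<le> h" "level (tan_width h) = q"
        by (auto simp: A2_def A_def rem_index_def rem_level_def)
      then show "w \<iota> \<le> e * (1 / 2) ^ N \<iota>"
        using ta[OF x(2)] by (simp add: w_def rem_count_def rem_base_def N_def)
    qed
    also have "\<dots> = e * (\<Sum>n\<in>N ` A2. (1 / 2) ^ n)"
      by (simp add: sum_distrib_left sum.reindex[OF inj])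
    also have "\<dots> \<le> e * 2" using fA e by (intro mult_left_mono sum_half_powers_le) auto
    finally show ?thesis by simp
  qed
  moreover have "sum w A3 \<le> e"
  proof (cases "A3 = {}")
    case False
    then have "Low \<in> A" by (auto simp: A3_def)
    then have A3: "A3 = {Low}" and "rem_level Low = q" by (auto simp: A3_def A_def)
    then have "q = q1" by (simp add: rem_level_def)
    show ?thesis using lo unfolding A3 w_def \<open>q = q1\<close> by (simp add: rem_count_def rem_base_def)
  qed (use e in simp)
  ultimately show "(\<Sum>\<iota> | \<iota> \<in> rem_index \<and> rem_level \<iota> = q. rem_count \<iota> / T ^ (q - 1 - rem_base \<iota>)) \<le> 5 * e"
    by (simp add: A_def w_def)
qed

end

context grid
begin

lemma power_powr_swap: "(real R ^ n) powr x = (real R powr x) ^ n"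
proof -
  have "(real R ^ n) powr x = (real R powr real n) powr x" using R_pos by (simp only: powr_realpow)
  also have "\<dots> = real R powr (x * real n)" by (simp add: powr_powr mult.commute)
  also have "\<dots> = (real R powr x) ^ n" using R_pos by (simp add: powr_power mult.commute)
  finally show ?thesis .
qed

end

context removal_params
begin

text \<open>With \<open>\<sigma> = 2 * M / (1 + M)\<close> and \<open>k = lag n\<close> the cost has
  \<open>R\<close>-exponent \<open>(k + 5) * \<sigma> - s * (k - 1) = 5 * \<sigma> + s - (s -
  \<sigma>) * k\<close>. The part \<open>k0\<close> of the lag makes it small; the part
  \<open>n div 16\<close> yields the factor \<open>(1 / 2) ^ n\<close> by \<open>R_gain\<close>,
  whose 16 is that of \<open>lag\<close>.\<close>

lemma transversal_cost:
  assumes e: "12 * real R ^ 7 * (1 / 2) ^ k0 \<le> e"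
  shows "3 * (real (crowd (lag n)))\<^sup>2 / (real R powr s) ^ (lag n - 1) \<le> e * (1 / 2) ^ n"
proof -
  define k where "k = lag n"
  define \<sigma> where "\<sigma> = 2 * M / (1 + M)"
  define \<omega> where "\<omega> = s - \<sigma>"
  have R0: "0 < real R" "1 < real R" using R_pos by auto
  have k: "1 \<le> k" using lag_ge_1 by (simp add: k_def)
  have \<sigma>: "\<sigma> \<le> 1" using mM by (simp add: \<sigma>_def pos_divide_le_eq)
  have gain: "2 \<le> real R powr (\<omega> / 16)" using R_gain by (simp add: \<omega>_def \<sigma>_def)
  have \<omega>: "0 < \<omega>"
  proof (rule ccontr)
    assume "\<not> 0 < \<omega>"
    then have "real R powr (\<omega> / 16) \<le> real R powr 0" using R0 by (intro powr_mono) auto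
    then show False using gain R0 by simp
  qed
  have "0 \<le> \<sigma>" using mM by (simp add: \<sigma>_def)
  then have \<omega>1: "\<omega> \<le> 1" using s by (simp add: \<omega>_def)
  have "(real (crowd k))\<^sup>2 \<le> (2 * real R powr ((real k + 5) * M / (1 + M)))\<^sup>2"
    using crowd_le[OF k] by (intro power_mono) auto
  also have "\<dots> = 4 * real R powr ((real k + 5) * \<sigma>)"
  proof -
    have "(real R powr ((real k + 5) * M / (1 + M)))\<^sup>2 = real R powr ((real k + 5) * M / (1 + M) + (real k + 5) * M / (1 + M))"
      by (simp only: power2_eq_square powr_add)
    also have "(real k + 5) * M / (1 + M) + (real k + 5) * M / (1 + M) = (real k + 5) * \<sigma>"
      by (simp add: \<sigma>_def)
    finally show ?thesis by (simp add: power_mult_distrib)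
  qed
  finally have crowd: "(real (crowd k))\<^sup>2 \<le> 4 * real R powr ((real k + 5) * \<sigma>)" .
  have T: "(real R powr s) ^ (k - 1) = real R powr (s * (real k - 1))"
    using R0 k by (simp add: powr_powr flip: powr_realpow)
  have "3 * (real (crowd k))\<^sup>2 / (real R powr s) ^ (k - 1) \<le> 3 * (4 * real R powr ((real k + 5) * \<sigma>)) / real R powr (s * (real k - 1))"
    unfolding T using crowd by (intro divide_right_mono mult_left_mono) auto
  also have "\<dots> = 12 * real R powr ((real k + 5) * \<sigma> - s * (real k - 1))"
    by (simp add: powr_diff)
  \<comment> \<open>The 7 bounds \<open>5 * \<sigma> + s + \<omega>\<close>; the last summand is the
    rounding loss in \<open>n div 16\<close>.\<close>
  also have "\<dots> \<le> 12 * real R powr (7 - \<omega> * real k0 - \<omega> / 16 * real n)"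
  proof -
    have "n \<le> 16 * (n div 16) + 15" by linarith
    then have "real n \<le> 16 * real (n div 16) + 15" by linarith
    then have "real n / 16 - 1 \<le> real (n div 16)" by linarith
    then have "\<omega> * (real n / 16 - 1) \<le> \<omega> * real (n div 16)" using \<omega> by (intro mult_left_mono) auto
    moreover have "(real k + 5) * \<sigma> - s * (real k - 1) = 5 * \<sigma> + s - \<omega> * real k0 - \<omega> * real (n div 16)"
      by (simp add: k_def lag_def \<omega>_def algebra_simps)
    ultimately have "(real k + 5) * \<sigma> - s * (real k - 1) \<le> 7 - \<omega> * real k0 - \<omega> / 16 * real n"
      using \<sigma> s \<omega>1 by (simp add: algebra_simps)
    then show ?thesis using R0 by (intro mult_left_mono powr_mono) auto
  qed
  also have "\<dots> = 12 * (real R ^ 7 * (real R powr - \<omega>) ^ k0 * (real R powr (- (\<omega> / 16))) ^ n)"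
  proof -
    have "real R powr (7 - \<omega> * real k0 - \<omega> / 16 * real n) = real R powr (7 + (- \<omega>) * real k0 + (- (\<omega> / 16)) * real n)"
      by simp
    also have "\<dots> = real R powr 7 * real R powr ((- \<omega>) * real k0) * real R powr ((- (\<omega> / 16)) * real n)"
      by (simp only: powr_add)
    also have "\<dots> = real R ^ 7 * (real R powr - \<omega>) ^ k0 * (real R powr (- (\<omega> / 16))) ^ n"
    proof -
      have pw: "(real R powr x) ^ q = real R powr (x * real q)" for x q
        using R0 by (simp add: powr_power mult.commute)
      have "real R powr 7 = real R ^ 7" using R0 powr_realpow[of R 7] by simp
      then show ?thesis unfolding pw by simp
    qed
    finally show ?thesis by simp
  qed
  also have "\<dots> \<le> 12 * (real R ^ 7 * (1 / 2) ^ k0 * (1 / 2) ^ n)"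
  proof -
    have half: "real R powr (- (\<omega> / 16)) \<le> 1 / 2" using gain R0 by (simp add: powr_minus field_simps)
    have "real R powr - \<omega> \<le> real R powr (- (\<omega> / 16))" using R0 \<omega> by (intro powr_mono) auto
    then have "real R powr - \<omega> \<le> 1 / 2" using half by linarith
    then show ?thesis using half R0 by (intro mult_left_mono mult_mono power_mono) auto
  qed
  also have "\<dots> = (12 * real R ^ 7 * (1 / 2) ^ k0) * (1 / 2) ^ n" by simp
  also have "\<dots> \<le> e * (1 / 2) ^ n" using e by (intro mult_right_mono) auto
  finally show ?thesis by (simp add: k_def)
qed

text \<open>\<open>R_s\<close> gives \<open>slow h powr s \<ge> 4 ^ h\<close>, and
  \<open>tangential_levels\<close> turns this into a lower bound on the power of \<open>T\<close>.
  Of the resulting factor \<open>(1 / 4) ^ h\<close>, one \<open>(1 / 2) ^ h\<close> is kept for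
  summation and the other is bounded through \<open>h0\<close>.\<close>

lemma tangential_cost:
  assumes e: "4 * real R ^ 6 * (1 / 2) ^ h0 \<le> e" and h: "h0 \<le> h"
  shows "4 / (real R powr s) ^ (level (tan_width h) - 1 - level (tan_scale h)) \<le> e * (1 / 2) ^ h"
proof -
  define d where "d = level (tan_width h) - level (tan_scale h)"
  define T where "T = real R powr s"
  have R0: "0 < real R" "1 < real R" using R_pos by auto
  have d: "1 \<le> d" "level (tan_width h) - 1 - level (tan_scale h) = d - 1"
    using tangential_levels(1)[OF h] by (auto simp: d_def)
  have T: "0 < T" using R0 by (simp add: T_def)
  have "T \<le> real R powr 1" unfolding T_def using R0 s by (intro powr_mono) auto
  then have TR: "T \<le> R" using R0 by simp
  have slow0: "0 < slow h" using slow_ge_1[OF h] by linarith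
  have "slow h powr s \<le> (real R ^ 5 * real R ^ d) powr s"
    using tangential_levels(2)[OF h] slow0 s by (intro powr_mono2) (auto simp: d_def)
  also have "\<dots> = (real R ^ 5) powr s * T ^ d"
    unfolding T_def power_powr_swap[symmetric] by (simp add: powr_mult)
  also have "(real R ^ 5) powr s \<le> (real R ^ 5) powr 1"
    using R0 s by (intro powr_mono one_le_power) auto
  finally have slow_T: "slow h powr s \<le> real R ^ 5 * T ^ d" using R0 T by (simp add: mult_right_mono)
  have "slow h powr s = (real R powr (s / 32)) ^ h"
    unfolding power_powr_swap[symmetric] slow_def by (simp add: powr_powr)
  moreover have "4 ^ h \<le> (real R powr (s / 32)) ^ h" using R_s by (intro power_mono) auto
  ultimately have "4 ^ h \<le> real R ^ 5 * T ^ d" using slow_T by linarith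
  also have "T ^ d = T * T ^ (d - 1)" using d(1) by (simp add: power_eq_if)
  also have "real R ^ 5 * (T * T ^ (d - 1)) \<le> real R ^ 5 * (R * T ^ (d - 1))"
    using TR T by (intro mult_left_mono mult_right_mono) auto
  also have "\<dots> = real R ^ 6 * T ^ (d - 1)" by (simp add: power_numeral_reduce)
  finally have 4: "4 ^ h \<le> real R ^ 6 * T ^ (d - 1)" .
  have "4 / T ^ (d - 1) \<le> 4 * real R ^ 6 / 4 ^ h"
    using 4 T by (simp add: field_simps)
  also have "\<dots> = 4 * real R ^ 6 * ((1 / 2) ^ h * (1 / 2) ^ h)"
    by (simp add: power_mult_distrib[symmetric] power_divide)
  also have "\<dots> \<le> 4 * real R ^ 6 * ((1 / 2) ^ h0 * (1 / 2) ^ h)"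
    using h by (intro mult_left_mono mult_right_mono power_decreasing) auto
  also have "\<dots> = (4 * real R ^ 6 * (1 / 2) ^ h0) * (1 / 2) ^ h" by simp
  also have "\<dots> \<le> e * (1 / 2) ^ h" using e by (intro mult_right_mono) auto
  finally show ?thesis unfolding d(2) T_def .
qed

end

section \<open>Lines of small height\<close>

context curve
begin

lemma f'_inj: "inj_on f' {a..a + l}"
proof (rule linorder_inj_onI)
  fix x y assume xy: "x < y" "x \<in> {a..a + l}" "y \<in> {a..a + l}"
  have "0 < \<mu> * (y - x)" using xy \<mu> by simp
  then show "f' x \<noteq> f' y" using curved xy by fastforce
qed auto

text \<open>Three zeros would give two distinct zeros of the slope. As \<open>f'\<close> is
  injective, this forces \<open>v = 0\<close> and then \<open>u = 0\<close>.\<close>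

lemma finite_zeros:
  assumes uv: "(u, v) \<noteq> (0, 0)"
  shows "finite {x \<in> {a..a + l}. lin (u, v, w) x = 0}" (is "finite ?Z")
proof (rule ccontr)
  assume inf: "infinite ?Z"
  obtain x where x: "x \<in> ?Z" using inf by (metis finite.emptyI ex_in_conv)
  obtain y where y: "y \<in> ?Z - {x}" using inf by (metis finite.emptyI ex_in_conv infinite_remove)
  obtain z where z: "z \<in> ?Z - {x} - {y}" using inf by (metis finite.emptyI ex_in_conv infinite_remove)
  have "\<exists>p q r. p \<in> ?Z \<and> q \<in> ?Z \<and> r \<in> ?Z \<and> p < q \<and> q < r"
  proof -
    have ne: "x \<noteq> y" "y \<noteq> z" "x \<noteq> z" using y z by auto
    have Z: "x \<in> ?Z" "y \<in> ?Z" "z \<in> ?Z" using x y z by auto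
    consider "x < y" "y < z" | "x < z" "z < y" | "y < x" "x < z" | "y < z" "z < x" | "z < x" "x < y" | "z < y" "y < x"
      using ne by linarith
    then show ?thesis by cases (use Z in blast)+
  qed
  then obtain p q r where pqr: "p \<in> ?Z" "q \<in> ?Z" "r \<in> ?Z" "p < q" "q < r" by blast
  have I: "p \<in> {a..a + l}" "q \<in> {a..a + l}" "r \<in> {a..a + l}" using pqr by auto
  have z0: "lin (u, v, w) p = 0" "lin (u, v, w) q = 0" "lin (u, v, w) r = 0" using pqr by auto
  from lin_mvt[OF I(1,2) pqr(4), of "(u, v, w)"]
  obtain s where s: "p < s" "s < q" "lin (u, v, w) q - lin (u, v, w) p = slope (u, v, w) s * (q - p)" .
  from lin_mvt[OF I(2,3) pqr(5), of "(u, v, w)"]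
  obtain t where t: "q < t" "t < r" "lin (u, v, w) r - lin (u, v, w) q = slope (u, v, w) t * (r - q)" .
  have sl: "slope (u, v, w) s = 0" "slope (u, v, w) t = 0"
    using s(3) t(3) pqr(4,5) unfolding z0 by simp_all
  have "of_int v * (f' s - f' t) = slope (u, v, w) s - slope (u, v, w) t" by (simp add: algebra_simps)
  then have "of_int v * (f' s - f' t) = 0" unfolding sl by simp
  moreover have "f' s \<noteq> f' t"
  proof
    assume "f' s = f' t"
    moreover have "s \<in> {a..a + l}" "t \<in> {a..a + l}" using s t I by auto
    ultimately have "s = t" using f'_inj by (simp only: inj_on_eq_iff)
    then show False using s t by simp
  qed
  ultimately have "v = 0" by simp
  then show False using sl uv by simp
qed

lemma lin_continuous: "continuous_on {a..a + l} (lin L)"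
  by (meson DERIV_continuous_on lin_deriv)

lemma f_bounded: "x \<in> {a..a + l} \<Longrightarrow> \<bar>f x\<bar> \<le> \<bar>f a\<bar> + K * l"
proof -
  assume x: "x \<in> {a..a + l}"
  have "\<bar>lin (0, 1, 0) x - lin (0, 1, 0) a\<bar> \<le> K * \<bar>x - a\<bar>"
    by (rule lin_lipschitz[of a a "a + l"]) (use x l_gt_0 slope_bounds in auto)
  also have "\<dots> \<le> K * l" using x K_ge_1 by (intro mult_left_mono) auto
  finally show ?thesis by simp
qed

end

context weighted
begin

definition low_lines :: "nat \<Rightarrow> line set" where
  "low_lines h0 = {(u, v, w). (u, v) \<noteq> (0, 0) \<and> height i j u v < real R ^ h0 \<and>
     (\<exists>x\<in>{a..a + l}. \<bar>lin (u, v, w) x\<bar> < 1)}"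

lemma finite_low_lines: "finite (low_lines h0)"
proof -
  define Y where "Y = real R ^ h0"
  define b where "b = \<bar>a\<bar> + l + \<bar>f a\<bar> + K * l"
  define N where "N = \<lceil>Y\<rceil>"
  define W where "W = \<lceil>1 + 2 * (Y * b)\<rceil>"
  have Y: "1 \<le> Y" unfolding Y_def using R_pos by (intro one_le_power) auto
  have b0: "0 \<le> b" using l_pos K_ge_1 by (simp add: b_def)
  have "low_lines h0 \<subseteq> {-N..N} \<times> {-N..N} \<times> {-W..W}"
  proof
    fix L assume "L \<in> low_lines h0"
    then obtain u v w x where L: "L = (u, v, w)" and ht: "height i j u v < Y"
      and x: "x \<in> {a..a + l}" "\<bar>lin (u, v, w) x\<bar> < 1" by (auto simp: low_lines_def Y_def)
    have Yij: "Y powr i \<le> Y powr 1" "Y powr j \<le> Y powr 1" by (rule powr_mono; use Y ij in linarith)+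
    have uv: "\<bar>real_of_int u\<bar> \<le> Y" "\<bar>real_of_int v\<bar> \<le> Y"
      using height_less_coord[OF ht ij(1,2)] Yij Y by auto
    have xb: "\<bar>x\<bar> \<le> b" "\<bar>f x\<bar> \<le> b"
    proof -
      have "0 \<le> K * l" using K_ge_1 l_pos by simp
      then show "\<bar>x\<bar> \<le> b" "\<bar>f x\<bar> \<le> b" using x(1) f_bounded[OF x(1)] l_pos by (auto simp: b_def)
    qed
    have "\<bar>of_int u * x\<bar> \<le> Y * b" "\<bar>of_int v * f x\<bar> \<le> Y * b"
      unfolding abs_mult using uv xb Y by (auto intro!: mult_mono)
    then have "\<bar>real_of_int w\<bar> \<le> 1 + 2 * (Y * b)" using x(2) unfolding lin_simp by linarith
    then show "L \<in> {-N..N} \<times> {-N..N} \<times> {-W..W}"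
      using uv unfolding L N_def W_def by (auto simp: abs_le_iff) linarith+
  qed
  then show ?thesis by (rule finite_subset) auto
qed

lemma cell_sub: "k < R ^ n \<Longrightarrow> cell n k \<subseteq> {a..a + l}"
  using cell_subset[of 0 n k] by (simp add: cell_0)

text \<open>The zeros of the finitely many low lines do not depend on \<open>c\<close>. So
  \<open>r0\<close> is fixed first, then \<open>q1\<close> deep enough to make \<open>r0\<close>
  hits cheap, and last \<open>c1\<close> so small that at level \<open>q1\<close> only cells
  containing a zero are hit.\<close>

lemma low_params:
  assumes e: "0 < e"
  obtains q1 :: nat and r0 c1 :: real where "1 \<le> q1" "0 < c1" "r0 / (real R powr s) ^ (q1 - 1) \<le> e"
    "\<And>c. 0 < c \<Longrightarrow> c \<le> c1 \<Longrightarrow> real (card (hits (low_set h0 c) q1)) \<le> r0"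
    "\<And>c u v w k. 0 < c \<Longrightarrow> c \<le> c1 \<Longrightarrow> (u, v) \<noteq> (0, 0) \<Longrightarrow> height i j u v < real R ^ h0 \<Longrightarrow> k < R ^ q1 \<Longrightarrow>
      \<exists>x\<in>cell q1 k. c \<le> \<bar>lin (u, v, w) x\<bar>"
proof -
  define \<Lambda> where "\<Lambda> = low_lines h0"
  define T where "T = real R powr s"
  define zeros where "zeros L = {x \<in> {a..a + l}. lin L x = 0}" for L
  define Z where "Z = (\<Union>L\<in>\<Lambda>. zeros L)"
  define r0 where "r0 = 2 * real (card Z)"
  have R0: "0 < real R" "1 < real R" using R_pos by auto
  have T: "1 < T" using R0 s unfolding T_def by (intro gr_one_powr) auto
  have f\<Lambda>: "finite \<Lambda>" by (simp add: \<Lambda>_def finite_low_lines)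
  have fz: "finite (zeros L)" if "L \<in> \<Lambda>" for L
    using that finite_zeros by (auto simp: zeros_def \<Lambda>_def low_lines_def)
  then have fZ: "finite Z" using f\<Lambda> by (auto simp: Z_def)
  obtain N where N: "r0 / e < T ^ N" using real_arch_pow[OF T] by blast
  define q1 where "q1 = Suc N"
  have cost: "r0 / T ^ (q1 - 1) \<le> e" using N e T by (simp add: q1_def field_simps)
  \<comment> \<open>The second part serves the count of hit cells. The first serves
    \<open>not_trapped\<close>: even a cell containing a zero is not filled by small values.\<close>
  have ex: "\<exists>\<delta>>0. (\<exists>x\<in>cell q1 k. \<delta> \<le> \<bar>lin L x\<bar>) \<and> (zeros L \<inter> cell q1 k = {} \<longrightarrow> (\<forall>x\<in>cell q1 k. \<delta> \<le> \<bar>lin L x\<bar>))"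
    if L: "L \<in> \<Lambda>" and k: "k < R ^ q1" for L k
  proof (cases "zeros L \<inter> cell q1 k = {}")
    case True
    have "continuous_on (cell q1 k) (\<lambda>x. \<bar>lin L x\<bar>)"
      using continuous_on_subset[OF lin_continuous cell_sub[OF k]] by (intro continuous_on_rabs)
    from continuous_attains_inf[OF compact_cell cell_ne this]
    obtain x where x: "x \<in> cell q1 k" "\<forall>y\<in>cell q1 k. \<bar>lin L x\<bar> \<le> \<bar>lin L y\<bar>" by blast
    have "x \<in> {a..a + l}" using cell_sub[OF k] x(1) by (rule subsetD)
    then have "lin L x \<noteq> 0" using True x(1) by (auto simp: zeros_def)
    then show ?thesis using x by (intro exI[of _ "\<bar>lin L x\<bar>"]) auto
  next
    case False
    have "infinite (cell q1 k)"
      using l_pos R0 by (simp add: cell_def divide_strict_right_mono)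
    then have "\<not> cell q1 k \<subseteq> zeros L" using fz[OF L] finite_subset by blast
    then obtain x where "x \<in> cell q1 k" "lin L x \<noteq> 0" using cell_sub[OF k] by (auto simp: zeros_def)
    then show ?thesis using False by (intro exI[of _ "\<bar>lin L x\<bar>"]) auto
  qed
  then obtain \<delta> where \<delta>: "\<And>L k. L \<in> \<Lambda> \<Longrightarrow> k < R ^ q1 \<Longrightarrow> \<delta> L k > (0::real) \<and>
      (\<exists>x\<in>cell q1 k. \<delta> L k \<le> \<bar>lin L x\<bar>) \<and> (zeros L \<inter> cell q1 k = {} \<longrightarrow> (\<forall>x\<in>cell q1 k. \<delta> L k \<le> \<bar>lin L x\<bar>))"
    by metis
  \<comment> \<open>The inserted 1 gives \<open>c1 \<le> 1\<close>, which settles the lines outside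
    \<open>low_lines\<close>: their values are at least 1 on the whole interval.\<close>
  define c1 where "c1 = Min (insert 1 ((\<lambda>(L, k). \<delta> L k) ` (\<Lambda> \<times> {..<R ^ q1})))"
  have fin: "finite (insert 1 ((\<lambda>(L, k). \<delta> L k) ` (\<Lambda> \<times> {..<R ^ q1})))" using f\<Lambda> by auto
  have c1: "0 < c1" "c1 \<le> 1" using fin \<delta> by (auto simp: c1_def)
  have c1\<delta>: "c1 \<le> \<delta> L k" if "L \<in> \<Lambda>" "k < R ^ q1" for L k
    unfolding c1_def by (rule Min_le[OF fin]) (use that in force)
  show thesis
  proof (rule that[of q1 c1 r0])
    show "1 \<le> q1" by (simp add: q1_def)
    show "0 < c1" by (rule c1)
    show "r0 / (real R powr s) ^ (q1 - 1) \<le> e" using cost by (simp add: T_def)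
    show "\<exists>x\<in>cell q1 k. c \<le> \<bar>lin (u, v, w) x\<bar>"
      if c: "0 < c" "c \<le> c1" and L: "(u, v) \<noteq> (0, 0)" "height i j u v < real R ^ h0" and k: "k < R ^ q1" for c u v w k
    proof (cases "(u, v, w) \<in> \<Lambda>")
      case True
      then show ?thesis using \<delta>[OF True k] c1\<delta>[OF True k] c by (meson order_trans)
    next
      case False
      obtain x where x: "x \<in> cell q1 k" using cell_ne by blast
      then have "1 \<le> \<bar>lin (u, v, w) x\<bar>" using False L cell_sub[OF k] by (force simp: \<Lambda>_def low_lines_def)
      then show ?thesis using x c c1 by (intro bexI[of _ x]) auto
    qed
    fix c assume c: "0 < c" "c \<le> c1"
    have "hits (low_set h0 c) q1 \<subseteq> (\<Union>z\<in>Z. hits {z} q1)"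
    proof
      fix k assume "k \<in> hits (low_set h0 c) q1"
      then obtain x u v w where k: "k < R ^ q1" and x: "x \<in> cell q1 k" "x \<in> {a..a + l}"
        and L: "(u, v) \<noteq> (0, 0)" "height i j u v < real R ^ h0" "\<bar>lin (u, v, w) x\<bar> < c / height i j u v"
        unfolding hits_def low_set_def by blast
      have "1 \<le> height i j u v" by (rule height_ge_1[OF ij(1,2) L(1)])
      then have "c / height i j u v \<le> c / 1" using c by (intro divide_left_mono) auto
      then have lc: "\<bar>lin (u, v, w) x\<bar> < c" using L(3) by simp
      then have L\<Lambda>: "(u, v, w) \<in> \<Lambda>" using L x c c1 by (force simp: \<Lambda>_def low_lines_def)
      have "zeros (u, v, w) \<inter> cell q1 k \<noteq> {}"
        using \<delta>[OF L\<Lambda> k] c1\<delta>[OF L\<Lambda> k] lc c x(1) by fastforce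
      then obtain z where "z \<in> zeros (u, v, w)" "z \<in> cell q1 k" by blast
      then show "k \<in> (\<Union>z\<in>Z. hits {z} q1)" using L\<Lambda> k by (auto simp: Z_def hits_def)
    qed
    then have "card (hits (low_set h0 c) q1) \<le> card (\<Union>z\<in>Z. hits {z} q1)"
      using fZ finite_hits by (intro card_mono) auto
    also have "\<dots> \<le> (\<Sum>z\<in>Z. card (hits {z} q1))" by (rule card_UN_le[OF fZ])
    also have "\<dots> \<le> (\<Sum>z\<in>Z. 2)" by (intro sum_mono card_hits_point)
    finally have "card (hits (low_set h0 c) q1) \<le> 2 * card Z" by simp
    then have "real (card (hits (low_set h0 c) q1)) \<le> real (2 * card Z)" by (rule of_nat_mono)
    then show "real (card (hits (low_set h0 c) q1)) \<le> r0" by (simp add: r0_def)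
  qed
qed

section \<open>Choice of the constants\<close>

lemma power_half_small:
  assumes "0 < (e::real)"
  shows "eventually (\<lambda>n. C * (1 / 2) ^ n \<le> e) sequentially"
proof -
  have "(\<lambda>n. C * (1 / 2 :: real) ^ n) \<longlonglongrightarrow> C * 0"
    by (intro tendsto_mult_left LIMSEQ_power_zero) simp
  then have "eventually (\<lambda>n. C * (1 / 2) ^ n < e) sequentially"
    using assms by (intro order_tendstoD(2)) auto
  then show ?thesis by (rule eventually_mono) simp
qed

theorem removable_not_Bad: "removable s {x. (x, f x) \<notin> Bad i j}"
  unfolding removable_def
proof (intro allI impI)
  fix e :: real assume e: "0 < e"
  define e' where "e' = e / 5"
  have e': "0 < e'" using e by (simp add: e'_def)
  have R0: "0 < real R" "1 < real R" using R_pos by auto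
  have "eventually (\<lambda>k. 12 * real R ^ 7 * (1 / 2) ^ k \<le> e' \<and> 1 \<le> k) sequentially"
    using power_half_small[OF e'] eventually_ge_at_top by (rule eventually_conj)
  then obtain k0 where k0: "12 * real R ^ 7 * (1 / 2) ^ k0 \<le> e'" "1 \<le> k0"
    by (auto simp: eventually_sequentially)
  have "eventually (\<lambda>h. 1000 * K ^ 4 * real R ^ 6 * (1 + 1 / \<mu>\<^sup>2) \<le> (real R powr (1 / 32)) ^ h) sequentially"
  proof -
    have b: "1 < real R powr (1 / 32)" using R0 by (intro gr_one_powr) auto
    obtain N where N: "1000 * K ^ 4 * real R ^ 6 * (1 + 1 / \<mu>\<^sup>2) < (real R powr (1 / 32)) ^ N"
      using real_arch_pow[OF b] by blast
    have "1000 * K ^ 4 * real R ^ 6 * (1 + 1 / \<mu>\<^sup>2) \<le> (real R powr (1 / 32)) ^ h" if "N \<le> h" for h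
      using N power_increasing[OF that, of "real R powr (1 / 32)"] b by linarith
    then show ?thesis by (auto simp: eventually_sequentially)
  qed
  moreover have "eventually (\<lambda>h. (real R powr (- m)) ^ h \<le> l) sequentially"
  proof -
    have "real R powr (- m) < real R powr 0" using R0 mM by (intro powr_less_mono) auto
    then have "(\<lambda>h. (real R powr (- m)) ^ h) \<longlonglongrightarrow> 0"
      using R0 by (intro LIMSEQ_power_zero) simp
    then have "eventually (\<lambda>h. (real R powr (- m)) ^ h < l) sequentially"
      using l_pos by (rule order_tendstoD(2))
    then show ?thesis by (rule eventually_mono) simp
  qed
  moreover have "eventually (\<lambda>h. 4 * real R ^ 6 * (1 / 2) ^ h \<le> e') sequentially"
    by (rule power_half_small[OF e'])
  ultimately have "eventually (\<lambda>h. 1000 * K ^ 4 * real R ^ 6 * (1 + 1 / \<mu>\<^sup>2) \<le> (real R powr (1 / 32)) ^ h \<and>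
      (real R powr (- m)) ^ h \<le> l \<and> 4 * real R ^ 6 * (1 / 2) ^ h \<le> e') sequentially"
    by (intro eventually_conj)
  then obtain h0 where h0: "\<And>h. h0 \<le> h \<Longrightarrow> 1000 * K ^ 4 * real R ^ 6 * (1 + 1 / \<mu>\<^sup>2) \<le> (real R powr (1 / 32)) ^ h"
      "\<And>h. h0 \<le> h \<Longrightarrow> (real R powr (- m)) ^ h \<le> l" "4 * real R ^ 6 * (1 / 2) ^ h0 \<le> e'"
    unfolding eventually_sequentially by blast
  obtain q1 r0 c1 where q1: "1 \<le> q1" "0 < c1" "r0 / (real R powr s) ^ (q1 - 1) \<le> e'"
    and low: "\<And>c. 0 < c \<Longrightarrow> c \<le> c1 \<Longrightarrow> real (card (hits (low_set h0 c) q1)) \<le> r0"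
    "\<And>c u v w k. 0 < c \<Longrightarrow> c \<le> c1 \<Longrightarrow> (u, v) \<noteq> (0, 0) \<Longrightarrow> height i j u v < real R ^ h0 \<Longrightarrow> k < R ^ q1 \<Longrightarrow>
      \<exists>x\<in>cell q1 k. c \<le> \<bar>lin (u, v, w) x\<bar>"
    using low_params[OF e'] by metis
  define c where "c = min c1 (min (1 / real R ^ (k0 + 20)) (l / real R ^ (k0 + 20)))"
  have c: "0 < c" "c \<le> c1" using q1 l_pos R0 by (auto simp: c_def)
  have RK: "0 < real R ^ (k0 + 20)" using R0 by simp
  have cR: "c * real R ^ (k0 + 20) \<le> 1" "c * real R ^ (k0 + 20) \<le> l"
  proof -
    have "c \<le> 1 / real R ^ (k0 + 20)" "c \<le> l / real R ^ (k0 + 20)" unfolding c_def by (meson min.cobounded1 min.cobounded2 order_trans)+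
    then show "c * real R ^ (k0 + 20) \<le> 1" "c * real R ^ (k0 + 20) \<le> l"
      unfolding pos_le_divide_eq[OF RK] .
  qed
  interpret P: removal_params a l f f' K \<nu> \<mu> R i j s k0 h0 q1 c r0
    by unfold_locales (use k0 c cR h0(1,2)[folded power_powr_swap] q1 low(1)[OF c] low(2)[OF c] in auto)
  have "scheme (real R powr s) (5 * e') P.rem_index P.rem_base P.rem_level P.rem_count P.rem_set"
    using P.rem_scheme[OF P.transversal_cost[OF k0(1)] P.tangential_cost[OF h0(3)] q1(3)] e' by simp
  moreover have "{x. (x, f x) \<notin> Bad i j} \<inter> {a..a + l} \<subseteq> (\<Union>\<iota>\<in>P.rem_index. P.rem_set \<iota>)"
    using P.Bad_if_not_removed by blast
  ultimately show "\<exists>(A :: removal set) P Q r B. scheme (real R powr s) e A P Q r B \<and>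
      {x. (x, f x) \<notin> Bad i j} \<inter> {a..a + l} \<subseteq> (\<Union>\<iota>\<in>A. B \<iota>)"
    by (intro exI[of _ P.rem_index] exI[of _ P.rem_base] exI[of _ P.rem_level] exI[of _ P.rem_count]
        exI[of _ P.rem_set] conjI) (simp_all add: e'_def)
qed

end

section \<open>Degenerate weights\<close>

definition badly_approximable :: "real \<Rightarrow> bool" where
  "badly_approximable y \<longleftrightarrow> (\<exists>c>0. \<forall>u w :: int. u \<noteq> 0 \<longrightarrow> c / \<bar>of_int u\<bar> \<le> \<bar>of_int u * y + of_int w\<bar>)"

lemma badly_approximable_nint_dist:
  assumes "badly_approximable y"
  shows "\<exists>c>0. \<forall>q::nat. q \<ge> 1 \<longrightarrow> c / real q < nint_dist (real q * y)"
proof -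
  obtain c where c: "c > 0" "\<And>u w :: int. u \<noteq> 0 \<Longrightarrow> c / \<bar>of_int u\<bar> \<le> \<bar>of_int u * y + of_int w\<bar>"
    using assms by (auto simp: badly_approximable_def)
  have "c / 2 / real q < nint_dist (real q * y)" if q: "q \<ge> 1" for q :: nat
  proof -
    have "c / real q \<le> nint_dist (real q * y)"
      using c(2)[of "int q" "- round (real q * y)"] q by (simp add: nint_dist_def)
    moreover have "c / 2 / real q < c / real q" using c q by (intro divide_strict_right_mono) auto
    ultimately show ?thesis by linarith
  qed
  then show ?thesis using c(1) by (intro exI[of _ "c / 2"]) auto
qed

lemma Bad_0_1I: "badly_approximable y \<Longrightarrow> (x, y) \<in> Bad 0 1"
proof -
  assume "badly_approximable y"
  then obtain c where c: "c > 0" "\<And>q::nat. q \<ge> 1 \<Longrightarrow> c / real q < nint_dist (real q * y)"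
    using badly_approximable_nint_dist by blast
  have "root_conv (nint_dist z) 1 = nint_dist z" for z by (simp add: root_conv_def nint_dist_def)
  then show ?thesis using c by (force simp: Bad_def less_max_iff_disj)
qed

lemma Bad_swap: "(y, x) \<in> Bad i j \<longleftrightarrow> (x, y) \<in> Bad j i"
  by (simp add: Bad_def max.commute)

lemma Bad_1_0I: "badly_approximable x \<Longrightarrow> (x, y) \<in> Bad 1 0"
  using Bad_0_1I Bad_swap by blast

context grid
begin

definition rat_width :: "real \<Rightarrow> real \<Rightarrow> nat \<Rightarrow> real" where
  "rat_width c \<nu> h = 2 * c / (\<nu> * (real R ^ h)\<^sup>2)"

definition rat_set :: "(real \<Rightarrow> real) \<Rightarrow> real \<Rightarrow> nat \<Rightarrow> real set" where
  "rat_set g c h = {x \<in> {a..a + l}. \<exists>u w :: int. real R ^ h \<le> \<bar>of_int u\<bar> \<and> \<bar>of_int u\<bar> < real R ^ (h + 1) \<and>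
     \<bar>of_int u * g x + of_int w\<bar> < c / \<bar>of_int u\<bar>}"

text \<open>Two fractions of the same class met within a distance \<open>\<rho>\<close> coincide,
  since their integer determinant is below 1. Both values of \<open>g\<close> are then within
  \<open>c / (R ^ h)\<^sup>2\<close> of one rational, and \<open>\<nu>\<close> carries this back to
  the arguments.\<close>

lemma rat_set_spread:
  fixes c \<nu> K \<rho> :: real
  assumes g: "\<And>x y. x \<in> {a..a + l} \<Longrightarrow> y \<in> {a..a + l} \<Longrightarrow> \<nu> * \<bar>y - x\<bar> \<le> \<bar>g y - g x\<bar> \<and> \<bar>g y - g x\<bar> \<le> K * \<bar>y - x\<bar>"
    and \<nu>: "0 < \<nu>" and K: "0 \<le> K" and c: "0 < c" "4 * c * R \<le> 1" and \<rho>: "2 * K * \<rho> * (real R ^ (h + 1))\<^sup>2 < 1"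
    and x: "x1 \<in> rat_set g c h" "x2 \<in> rat_set g c h" "\<bar>x1 - x2\<bar> \<le> \<rho>"
  shows "x2 - x1 \<le> rat_width c \<nu> h"
proof -
  define X where "X = real R ^ h"
  define Y where "Y = real R ^ (h + 1)"
  have R0: "0 < real R" "1 < real R" using R_pos by auto
  have X: "0 < X" "Y = R * X" "0 < Y" using R0 by (simp_all add: X_def Y_def)
  obtain u1 w1 :: int where L1: "X \<le> \<bar>real_of_int u1\<bar>" "\<bar>real_of_int u1\<bar> < Y" "\<bar>u1 * g x1 + w1\<bar> < c / \<bar>of_int u1\<bar>"
    using x(1) by (auto simp: rat_set_def X_def Y_def)
  obtain u2 w2 :: int where L2: "X \<le> \<bar>real_of_int u2\<bar>" "\<bar>real_of_int u2\<bar> < Y" "\<bar>u2 * g x2 + w2\<bar> < c / \<bar>of_int u2\<bar>"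
    using x(2) by (auto simp: rat_set_def X_def Y_def)
  have cX: "c / \<bar>real_of_int u1\<bar> \<le> c / X" "c / \<bar>real_of_int u2\<bar> \<le> c / X"
    using L1 L2 X c by (auto intro!: divide_left_mono)
  \<comment> \<open>This integer is 0: the first two terms contribute at most 1/4 each by the size
    of \<open>c\<close>, the third less than 1/2 by the size of \<open>\<rho>\<close>.\<close>
  have d: "real_of_int (u1 * w2 - u2 * w1) =
      of_int u1 * (of_int u2 * g x2 + of_int w2) - of_int u2 * (of_int u1 * g x1 + of_int w1) + of_int u1 * of_int u2 * (g x1 - g x2)"
    by (simp add: algebra_simps)
  have half: "Y * (c / X) \<le> 1 / 4" using X c by (simp add: mult_ac)
  have 1: "\<bar>of_int u1 * (of_int u2 * g x2 + of_int w2)\<bar> \<le> Y * (c / X)"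
    unfolding abs_mult using L1 L2 cX X(3) by (intro mult_mono) auto
  have 2: "\<bar>of_int u2 * (of_int u1 * g x1 + of_int w1)\<bar> \<le> Y * (c / X)"
    unfolding abs_mult using L1 L2 cX X(3) by (intro mult_mono) auto
  have I: "x1 \<in> {a..a + l}" "x2 \<in> {a..a + l}" using x by (auto simp: rat_set_def)
  have "\<bar>g x1 - g x2\<bar> \<le> K * \<bar>x1 - x2\<bar>" using g[OF I(2,1)] by simp
  also have "\<dots> \<le> K * \<rho>" using x(3) K by (intro mult_left_mono) auto
  finally have g12: "\<bar>g x1 - g x2\<bar> \<le> K * \<rho>" .
  have "\<bar>of_int u1 * of_int u2 * (g x1 - g x2)\<bar> \<le> Y * Y * (K * \<rho>)"
    unfolding abs_mult using L1 L2 g12 X R0 by (intro mult_mono) auto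
  also have "\<dots> < 1 / 2" using \<rho> unfolding Y_def[symmetric] by (simp add: power2_eq_square mult_ac)
  finally have "\<bar>real_of_int (u1 * w2 - u2 * w1)\<bar> < 1" unfolding d using 1 2 half by linarith
  then have "u1 * w2 - u2 * w1 = 0" by linarith
  then have "real_of_int u1 * of_int w2 = of_int u2 * of_int w1" by (metis eq_iff_diff_eq_0 of_int_mult)
  moreover have u0: "of_int u1 \<noteq> (0::real)" "of_int u2 \<noteq> (0::real)" using L1(1) L2(1) X by auto
  ultimately have eq: "of_int w2 / of_int u2 = (of_int w1 / of_int u1 :: real)" by (simp add: field_simps)
  have close: "\<bar>g x + of_int w / of_int u\<bar> \<le> c / X\<^sup>2"
    if "X \<le> \<bar>real_of_int u\<bar>" "\<bar>of_int u * g x + of_int w\<bar> < c / X" for u w :: int and x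
  proof -
    have "of_int u * (g x + of_int w / of_int u) = of_int u * g x + of_int w"
      using that(1) X by (simp add: distrib_left)
    then have "\<bar>real_of_int u\<bar> * \<bar>g x + of_int w / of_int u\<bar> < c / X" using that(2) by (metis abs_mult)
    moreover have "X * \<bar>g x + of_int w / of_int u\<bar> \<le> \<bar>real_of_int u\<bar> * \<bar>g x + of_int w / of_int u\<bar>"
      using that(1) by (intro mult_right_mono) auto
    ultimately have "X * \<bar>g x + of_int w / of_int u\<bar> \<le> c / X" by linarith
    then show ?thesis using X by (simp add: power2_eq_square field_simps)
  qed
  have "\<bar>g x2 - g x1\<bar> \<le> 2 * (c / X\<^sup>2)"
    using close[OF L1(1), of x1 w1] close[OF L2(1), of x2 w2] L1(3) L2(3) cX unfolding eq by linarith
  then have "\<nu> * \<bar>x2 - x1\<bar> \<le> 2 * (c / X\<^sup>2)" using g[OF I] by linarith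
  then have "\<bar>x2 - x1\<bar> \<le> 2 * c / (\<nu> * X\<^sup>2)" using \<nu> X by (simp add: field_simps)
  then show ?thesis by (simp add: rat_width_def X_def)
qed

text \<open>The one-dimensional counterpart, with constant lag \<open>k0\<close>. Each level carries
  at most one class, and a class removes at most 3 cells per counting cell, so the cost is
  \<open>3 / T ^ (k0 - 1)\<close>. It is used with \<open>g = f\<close> for the weights (0, 1) and
  with the identity for (1, 0).\<close>

lemma removable_not_badly_approximable:
  fixes \<nu> K :: real
  assumes g: "\<And>x y. x \<in> {a..a + l} \<Longrightarrow> y \<in> {a..a + l} \<Longrightarrow> \<nu> * \<bar>y - x\<bar> \<le> \<bar>g y - g x\<bar> \<and> \<bar>g y - g x\<bar> \<le> K * \<bar>y - x\<bar>"
    and \<nu>: "0 < \<nu>" and K: "1 \<le> K" and s: "0 < s"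
  shows "removable s {x. \<not> badly_approximable (g x)}"
  unfolding removable_def
proof (intro allI impI)
  fix e :: real assume e: "0 < e"
  define T where "T = real R powr s"
  have R0: "0 < real R" "1 < real R" "1 \<le> real R" using R_pos by auto
  have T: "1 < T" using R0 s unfolding T_def by (intro gr_one_powr) auto
  obtain N where N: "3 / e < T ^ N" using real_arch_pow[OF T] by blast
  define k0 where "k0 = Suc N"
  have cost: "3 / T ^ (k0 - 1) \<le> e" using N e T by (simp add: k0_def field_simps)
  \<comment> \<open>The three bounds serve, in this order, \<open>rat_set_spread\<close>, the
    shortness of the counting cells, and \<open>k0 \<le> Q h\<close>.\<close>
  define c where "c = min (1 / (4 * R)) (min (\<nu> / (8 * K * real R ^ (k0 + 3))) (\<nu> * l / (2 * real R ^ k0)))"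
  have c: "0 < c" using R0 \<nu> K l_pos by (simp add: c_def)
  have c1: "4 * c * R \<le> 1"
  proof -
    have "c \<le> 1 / (4 * R)" by (simp add: c_def)
    then show ?thesis using R0 by (simp add: field_simps)
  qed
  have c2: "8 * K * real R ^ (k0 + 3) * c \<le> \<nu>"
  proof -
    have "c \<le> \<nu> / (8 * K * real R ^ (k0 + 3))" unfolding c_def by (meson min.cobounded1 min.cobounded2 order_trans)
    moreover have "0 < 8 * K * real R ^ (k0 + 3)" using R0 K by simp
    ultimately show ?thesis by (simp only: pos_le_divide_eq mult.commute)
  qed
  have c3: "2 * c * real R ^ k0 \<le> \<nu> * l"
  proof -
    have "c \<le> \<nu> * l / (2 * real R ^ k0)" unfolding c_def by (meson min.cobounded1 min.cobounded2 order_trans)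
    moreover have "0 < 2 * real R ^ k0" using R0 by simp
    ultimately have "c * (2 * real R ^ k0) \<le> \<nu> * l" by (simp only: pos_le_divide_eq)
    then show ?thesis by (simp add: mult_ac)
  qed
  define Q where "Q h = level (rat_width c \<nu> h)" for h
  have w0: "0 < rat_width c \<nu> h" for h using c \<nu> R0 by (simp add: rat_width_def)
  have wk: "rat_width c \<nu> h \<le> l / real R ^ k0" for h
  proof -
    have "1 \<le> (real R ^ h)\<^sup>2" using R0 by (simp add: one_le_power)
    then have "2 * c / (\<nu> * (real R ^ h)\<^sup>2) \<le> 2 * c / (\<nu> * 1)"
      using c \<nu> R0 by (intro divide_left_mono mult_left_mono) auto
    also have "\<dots> \<le> l / real R ^ k0" using c3 \<nu> R0 by (simp add: field_simps)
    finally show ?thesis by (simp add: rat_width_def)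
  qed
  have wl: "rat_width c \<nu> h \<le> l" for h
  proof -
    have "l / real R ^ k0 \<le> l / 1" using R0 l_pos by (intro divide_left_mono one_le_power) auto
    then show ?thesis using wk[of h] by simp
  qed
  have kQ: "k0 \<le> Q h" for h unfolding Q_def by (rule le_level[OF w0 wk])
  have Q_mono: "Q h < Q h'" if "h < h'" for h h'
    unfolding Q_def
  proof (rule level_Suc_le[OF w0 _ wl])
    define X where "X = real R ^ h"
    have X: "0 < X" using R0 by (simp add: X_def)
    have h': "real R * X \<le> real R ^ h'" using power_increasing[of "Suc h" h' "real R"] that R0 by (simp add: X_def)
    have "R * X\<^sup>2 \<le> (R * X) * (R * X)" using R0 X by (simp add: power2_eq_square)
    also have "\<dots> \<le> real R ^ h' * real R ^ h'" using h' R0 X by (intro mult_mono) auto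
    finally have "R * X\<^sup>2 \<le> (real R ^ h')\<^sup>2" by (simp add: power2_eq_square)
    then have "2 * c / (\<nu> * (real R ^ h')\<^sup>2) \<le> 2 * c / (\<nu> * (R * X\<^sup>2))"
      using c \<nu> R0 X by (intro divide_left_mono mult_left_mono) auto
    then have "R * rat_width c \<nu> h' \<le> R * (2 * c / (\<nu> * (R * X\<^sup>2)))"
      unfolding rat_width_def using R0 by (intro mult_left_mono) auto
    also have "\<dots> = rat_width c \<nu> h" using R0 by (simp add: rat_width_def X_def)
    finally show "R * rat_width c \<nu> h' \<le> rat_width c \<nu> h" .
  qed
  have Q_inj: "Q h = Q h' \<Longrightarrow> h = h'" for h h'
    using Q_mono[of h h'] Q_mono[of h' h] by (cases h h' rule: linorder_cases) auto
  define hh where "hh \<iota> = (case \<iota> of Tangential h \<Rightarrow> h | _ \<Rightarrow> 0)" for \<iota>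
  define A where "A = range Tangential"
  have "scheme T e A (\<lambda>\<iota>. Q (hh \<iota>) - k0) (\<lambda>\<iota>. Q (hh \<iota>)) (\<lambda>_. 3) (\<lambda>\<iota>. rat_set g c (hh \<iota>))"
    unfolding scheme_def
  proof (intro conjI ballI allI impI)
    fix \<iota> assume \<iota>: "\<iota> \<in> A"
    define h where "h = hh \<iota>"
    show "Q (hh \<iota>) - k0 < Q (hh \<iota>)" using kQ[of "hh \<iota>"] by (simp add: k0_def)
    show "(0::real) \<le> 3" by simp
    fix k
    define p where "p = Q h - k0"
    define \<rho> where "\<rho> = l / real R ^ p"
    have "\<rho> = real R ^ k0 * (l / real R ^ Q h)" unfolding \<rho>_def p_def using kQ[of h] R0 by (simp add: power_diff)
    also have "\<dots> \<le> real R ^ k0 * (R * rat_width c \<nu> h)"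
      unfolding Q_def using level_size_less[OF w0 wl] R0 by (intro mult_left_mono) (auto simp: less_imp_le)
    finally have \<rho>: "\<rho> \<le> real R ^ (k0 + 1) * rat_width c \<nu> h" by (simp add: mult_ac)
    have \<rho>_small: "2 * K * \<rho> * (real R ^ (h + 1))\<^sup>2 < 1"
    proof -
      have "2 * K * \<rho> * (real R ^ (h + 1))\<^sup>2 \<le> 2 * K * (real R ^ (k0 + 1) * rat_width c \<nu> h) * (real R ^ (h + 1))\<^sup>2"
        using \<rho> K by (intro mult_right_mono mult_left_mono) auto
      also have "\<dots> = 4 * K * real R ^ (k0 + 3) * c / \<nu>"
        using R0 \<nu> by (simp add: rat_width_def power_add power_mult_distrib power2_eq_square power3_eq_cube field_simps)
      also have "\<dots> \<le> 1 / 2" using c2 \<nu> by (simp add: field_simps)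
      finally show ?thesis by simp
    qed
    have "card {k' \<in> hits (rat_set g c h) (Q h). k' div R ^ (Q h - p) = k} \<le> card (hits (rat_set g c h \<inter> cell p k) (Q h))"
      by (intro card_hits_in_cell) (simp add: p_def)
    also have "\<dots> \<le> 3"
    proof (rule card_hits_le_3)
      show "rat_width c \<nu> h \<le> l / real R ^ Q h" unfolding Q_def by (rule le_level_size[OF w0 wl])
      fix x y assume xy: "x \<in> rat_set g c h \<inter> cell p k" "y \<in> rat_set g c h \<inter> cell p k"
      have "\<bar>x - y\<bar> \<le> \<rho>"
        using xy by (auto simp: cell_def \<rho>_def distrib_left add_divide_distrib)
      then show "y - x \<le> rat_width c \<nu> h"
        using xy K by (intro rat_set_spread[OF g \<nu> _ c c1 \<rho>_small]) auto
    qed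
    finally show "real (card {k' \<in> hits (rat_set g c (hh \<iota>)) (Q (hh \<iota>)). k' div R ^ (Q (hh \<iota>) - (Q (hh \<iota>) - k0)) = k}) \<le> 3"
      by (simp add: h_def p_def)
  next
    fix q
    have sub: "{\<iota> \<in> A. Q (hh \<iota>) = q} = {} \<or> (\<exists>h. {\<iota> \<in> A. Q (hh \<iota>) = q} = {Tangential h} \<and> Q h = q)"
    proof (cases "\<exists>h. Q h = q")
      case True
      then obtain h where h: "Q h = q" by blast
      then have "{\<iota> \<in> A. Q (hh \<iota>) = q} = {Tangential h}" using Q_inj by (auto simp: A_def hh_def)
      then show ?thesis using h by blast
    qed (auto simp: A_def hh_def)
    then show "finite {\<iota> \<in> A. Q (hh \<iota>) = q}" by (metis finite.emptyI finite_insert)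
    show "(\<Sum>\<iota> | \<iota> \<in> A \<and> Q (hh \<iota>) = q. 3 / T ^ (q - 1 - (Q (hh \<iota>) - k0))) \<le> e"
      using sub
    proof
      assume "\<exists>h. {\<iota> \<in> A. Q (hh \<iota>) = q} = {Tangential h} \<and> Q h = q"
      then obtain h where h: "{\<iota> \<in> A. Q (hh \<iota>) = q} = {Tangential h}" "Q h = q" by blast
      have "q - 1 - (q - k0) = k0 - 1" using kQ[of h] h(2) by linarith
      then show ?thesis unfolding h(1) using cost h(2) by (simp add: hh_def)
    next
      assume em: "{\<iota> \<in> A. Q (hh \<iota>) = q} = {}"
      show ?thesis unfolding em using e by simp
    qed
  qed
  moreover have "{x. \<not> badly_approximable (g x)} \<inter> {a..a + l} \<subseteq> (\<Union>\<iota>\<in>A. rat_set g c (hh \<iota>))"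
  proof
    fix x assume x: "x \<in> {x. \<not> badly_approximable (g x)} \<inter> {a..a + l}"
    then obtain u w :: int where u: "u \<noteq> 0" "\<bar>of_int u * g x + of_int w\<bar> < c / \<bar>of_int u\<bar>"
      using c by (auto simp: badly_approximable_def not_le)
    have "1 \<le> \<bar>u\<bar>" using u(1) by linarith
    then have U: "1 \<le> \<bar>real_of_int u\<bar>" by linarith
    define y where "y = log R \<bar>real_of_int u\<bar>"
    define h where "h = nat \<lfloor>y\<rfloor>"
    have "0 \<le> y" using U R0 by (simp add: y_def)
    then have "real h \<le> y" "y < real h + 1" by (simp_all add: h_def)
    then have "real h \<le> y" "y < real (h + 1)" by simp_all
    then have b: "real h \<le> log R \<bar>real_of_int u\<bar>" "log R \<bar>real_of_int u\<bar> < real (h + 1)"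
      unfolding y_def .
    have "real R powr real h \<le> \<bar>real_of_int u\<bar>" "\<bar>real_of_int u\<bar> < real R powr real (h + 1)"
      using b U R0 by (simp_all only: le_log_iff log_less_iff)
    then have "real R ^ h \<le> \<bar>real_of_int u\<bar>" "\<bar>real_of_int u\<bar> < real R ^ (h + 1)"
      using R0 by (simp_all only: powr_realpow)
    then have "x \<in> rat_set g c h" using x u(2) unfolding rat_set_def by blast
    then show "x \<in> (\<Union>\<iota>\<in>A. rat_set g c (hh \<iota>))" by (simp add: A_def hh_def) blast
  qed
  ultimately show "\<exists>(A :: removal set) P Q r B. scheme (real R powr s) e A P Q r B \<and>
      {x. \<not> badly_approximable (g x)} \<inter> {a..a + l} \<subseteq> (\<Union>\<iota>\<in>A. B \<iota>)"
    unfolding T_def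
    by (intro exI[of _ A] exI[of _ "\<lambda>\<iota>. Q (hh \<iota>) - k0"] exI[of _ "\<lambda>\<iota>. Q (hh \<iota>)"] exI[of _ "\<lambda>_. 3"]
        exI[of _ "\<lambda>\<iota>. rat_set g c (hh \<iota>)"] conjI)
qed

lemma removable_subset: "removable s X \<Longrightarrow> Y \<subseteq> X \<Longrightarrow> removable s Y"
  unfolding removable_def by (meson Int_mono order_refl order_trans)

end

section \<open>Uniform choice of exponent and grid\<close>

lemma eventually_powr_ge:
  assumes "0 < x"
  shows "eventually (\<lambda>R::nat. C \<le> real R powr x) sequentially"
proof -
  define C' where "C' = max C 1"
  have "eventually (\<lambda>R::nat. C' powr (1 / x) \<le> real R) sequentially"
    using filterlim_real_sequentially by (simp add: filterlim_at_top)
  then show ?thesis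
  proof (rule eventually_mono)
    fix R :: nat assume R: "C' powr (1 / x) \<le> real R"
    have "C' = (C' powr (1 / x)) powr x" using assms by (simp add: powr_powr C'_def)
    also have "\<dots> \<le> real R powr x" using R assms by (intro powr_mono2) auto
    finally show "C \<le> real R powr x" by (simp add: C'_def)
  qed
qed

context curve
begin

lemma f_bilipschitz:
  assumes "x \<in> {a..a + l}" "y \<in> {a..a + l}"
  shows "\<nu> * \<bar>y - x\<bar> \<le> \<bar>f y - f x\<bar> \<and> \<bar>f y - f x\<bar> \<le> K * \<bar>y - x\<bar>"
proof -
  have *: "\<nu> * \<bar>y - x\<bar> \<le> \<bar>f y - f x\<bar> \<and> \<bar>f y - f x\<bar> \<le> K * \<bar>y - x\<bar>"
    if xy: "x < y" "x \<in> {a..a + l}" "y \<in> {a..a + l}" for x y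
  proof -
    obtain t where t: "x < t" "t < y" "f y - f x = f' t * (y - x)" using f_mvt[OF xy(2,3,1)] .
    have "\<nu> \<le> \<bar>f' t\<bar>" "\<bar>f' t\<bar> \<le> K" using slope_bounds[of t] t xy by auto
    then show ?thesis unfolding t(3) abs_mult by (auto intro: mult_right_mono)
  qed
  consider "x < y" | "x = y" | "y < x" by linarith
  then show ?thesis
  proof cases
    case 3
    then show ?thesis using *[of y x] assms by (simp add: abs_minus_commute)
  qed (use * assms in auto)
qed

text \<open>Only the threshold \<open>\<sigma>\<close> depends on the weights. Asking for all large
  \<open>R\<close>, rather than for some \<open>R\<close>, is what lets finitely many weights share
  one grid.\<close>

lemma eventually_removable:
  assumes ij: "0 \<le> i" "0 \<le> j" "i + j = 1"
  shows "\<exists>\<sigma><1. \<forall>s. \<sigma> < s \<and> 1 / 2 \<le> s \<and> s < 1 \<longrightarrow>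
    (\<forall>\<^sub>F R in sequentially. grid.removable a l R s {x. (x, f x) \<notin> Bad i j})"
proof -
  consider "i = 0" | "j = 0" | "0 < i" "0 < j" using ij by linarith
  then show ?thesis
  proof cases
    case 1
    have "grid.removable a l R s {x. (x, f x) \<notin> Bad i j}" if R: "2 \<le> R" and s: "1 / 2 \<le> s" for R s
    proof -
      interpret grid a l R by unfold_locales (use R l_gt_0 in auto)
      have "removable s {x. \<not> badly_approximable (f x)}"
        by (rule removable_not_badly_approximable[OF f_bilipschitz \<nu>(1) K_ge_1]) (use s in auto)
      then show ?thesis by (rule removable_subset) (use 1 ij Bad_0_1I in auto)
    qed
    then show ?thesis
      by (intro exI[of _ 0]) (auto simp: eventually_sequentially)
  next
    case 2
    have "grid.removable a l R s {x. (x, f x) \<notin> Bad i j}" if R: "2 \<le> R" and s: "1 / 2 \<le> s" for R s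
    proof -
      interpret grid a l R by unfold_locales (use R l_gt_0 in auto)
      have "removable s {x. \<not> badly_approximable x}"
        by (rule removable_not_badly_approximable[where \<nu> = 1 and K = 1]) (use s in auto)
      then show ?thesis by (rule removable_subset) (use 2 ij Bad_1_0I in auto)
    qed
    then show ?thesis
      by (intro exI[of _ 0]) (auto simp: eventually_sequentially)
  next
    case 3
    define M where "M = max i j"
    have M: "0 < M" "M < 1" using 3 ij by (auto simp: M_def)
    define \<sigma> where "\<sigma> = 2 * M / (1 + M)"
    have \<sigma>: "\<sigma> < 1" using M by (simp add: \<sigma>_def)
    have "\<forall>\<^sub>F R in sequentially. grid.removable a l R s {x. (x, f x) \<notin> Bad i j}"
      if s: "\<sigma> < s" "1 / 2 \<le> s" "s < 1" for s
    proof -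
      have "eventually (\<lambda>R::nat. 1000 * CK * (K + 3) / \<nu> \<le> real R) sequentially"
        using filterlim_real_sequentially by (simp add: filterlim_at_top)
      moreover have "eventually (\<lambda>R::nat. 4 \<le> real R powr (s / 32)) sequentially"
        using s by (intro eventually_powr_ge) auto
      moreover have "eventually (\<lambda>R::nat. 2 \<le> real R powr ((s - \<sigma>) / 16)) sequentially"
        using s by (intro eventually_powr_ge) auto
      moreover have "eventually (\<lambda>R::nat. 2 \<le> R) sequentially" by (rule eventually_ge_at_top)
      ultimately show ?thesis
      proof eventually_elim
        case (elim R)
        have "1000 * CK * (K + 3) \<le> \<nu> * real R" using elim(1) \<nu> by (simp add: field_simps)
        then interpret weighted a l f f' K \<nu> \<mu> R i j s
          by unfold_locales (use elim l_gt_0 3 ij s in \<open>auto simp: \<sigma>_def M_def\<close>)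
        show ?case by (rule removable_not_Bad)
      qed
    qed
    then show ?thesis using \<sigma> by blast
  qed
qed

end

section \<open>The curve and the main theorem\<close>

lemma interval_mvt:
  fixes g g' :: "real \<Rightarrow> real"
  assumes "\<And>x. x \<in> S \<Longrightarrow> (g has_real_derivative g' x) (at x within S)" "{x..y} \<subseteq> S" "x < y"
  shows "\<exists>t. x < t \<and> t < y \<and> g y - g x = g' t * (y - x)"
proof -
  have "(g has_derivative (*) (g' t)) (at t within {x..y})" if "t \<in> {x..y}" for t
    using has_field_derivative_subset[OF assms(1) assms(2), of t] assms(2) that
    by (auto simp: has_field_derivative_def)
  then obtain t where "t \<in> {x<..<y}" "g y - g x = g' t * (y - x)"
    using mvt_simple[OF assms(3), of g "\<lambda>t. (*) (g' t)"] by auto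
  then show ?thesis by auto
qed

lemma positive_lower_bound:
  fixes g :: "real \<Rightarrow> real"
  assumes "continuous_on {p..q} g" "p \<le> q" "\<And>x. x \<in> {p..q} \<Longrightarrow> g x \<noteq> 0"
  shows "\<exists>\<epsilon>>0. \<forall>x\<in>{p..q}. \<epsilon> \<le> \<bar>g x\<bar>"
proof -
  have "continuous_on {p..q} (\<lambda>x. \<bar>g x\<bar>)" using assms(1) by (intro continuous_on_rabs)
  from continuous_attains_inf[OF _ _ this] assms(2)
  obtain x where "x \<in> {p..q}" "\<forall>y\<in>{p..q}. \<bar>g x\<bar> \<le> \<bar>g y\<bar>" by auto
  then show ?thesis using assms(3)[of x] by (intro exI[of _ "\<bar>g x\<bar>"]) auto
qed

lemma upper_bound_on_interval:
  fixes g :: "real \<Rightarrow> real"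
  assumes "continuous_on {p..q} g"
  shows "\<exists>B. \<forall>x\<in>{p..q}. \<bar>g x\<bar> \<le> B"
proof -
  have "bounded (g ` {p..q})"
    using assms by (intro compact_imp_bounded compact_continuous_image) auto
  then show ?thesis by (auto simp: bounded_iff)
qed

lemma constant_sign:
  fixes g :: "real \<Rightarrow> real"
  assumes "continuous_on {p..q} g" "\<And>x. x \<in> {p..q} \<Longrightarrow> g x \<noteq> 0"
  shows "(\<forall>x\<in>{p..q}. 0 < g x) \<or> (\<forall>x\<in>{p..q}. g x < 0)"
proof (rule ccontr)
  assume "\<not> ?thesis"
  then obtain x y where xy: "x \<in> {p..q}" "y \<in> {p..q}" "g x < 0" "0 < g y"
    using assms(2) by (metis linorder_neqE_linordered_idom)
  have "connected (g ` {p..q})" using assms(1) by (intro connected_continuous_image) auto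
  then have "0 \<in> g ` {p..q}"
    using xy connectedD_interval[of "g ` {p..q}" "g x" "g y" 0] by auto
  then show False using assms(2) by auto
qed

text \<open>The given point \<open>x0\<close> may be an endpoint of \<open>I\<close>, so the first
  move is to a ball inside the interior near \<open>x0\<close> where \<open>f''\<close> has no zero.
  If \<open>f'\<close> vanishes at its centre \<open>z\<close>, it does not at
  \<open>z + r / 2\<close>. Continuity then gives the interval, and compactness the
  constants.\<close>

lemma ex_curve:
  fixes f f' f'' :: "real \<Rightarrow> real"
  assumes I: "is_interval I" "interior I \<noteq> {}"
    and f: "\<And>x. x \<in> I \<Longrightarrow> (f has_real_derivative f' x) (at x within I)"
    and f': "\<And>x. x \<in> I \<Longrightarrow> (f' has_real_derivative f'' x) (at x within I)"
    and cont: "continuous_on I f''" and nz: "\<exists>x\<in>I. f'' x \<noteq> 0"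
  obtains a l K \<nu> \<mu> where "curve a l f f' K \<nu> \<mu>" "{a..a + l} \<subseteq> I"
proof -
  obtain x0 where x0: "x0 \<in> I" "f'' x0 \<noteq> 0" using nz by blast
  have "\<exists>d>0. \<forall>x\<in>I. dist x x0 < d \<longrightarrow> dist (f'' x) (f'' x0) < \<bar>f'' x0\<bar>"
    using cont x0 unfolding continuous_on_iff by (metis zero_less_abs_iff)
  then obtain d where d: "d > 0" "\<And>x. x \<in> I \<Longrightarrow> dist x x0 < d \<Longrightarrow> dist (f'' x) (f'' x0) < \<bar>f'' x0\<bar>"
    by blast
  have nzd: "f'' x \<noteq> 0" if "x \<in> I" "dist x x0 < d" for x
    using d(2)[OF that] by (auto simp: dist_real_def)
  have "x0 \<in> closure (interior I)"
    using convex_closure_interior[OF is_interval_convex[OF I(1)] I(2)] x0(1) closure_subset by blast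
  then have "ball x0 d \<inter> interior I \<noteq> {}"
    using open_Int_closure_eq_empty[of "ball x0 d" "interior I"] d(1) by (metis IntI centre_in_ball empty_iff open_ball)
  then obtain z where z: "z \<in> ball x0 d \<inter> interior I" by blast
  have "open (ball x0 d \<inter> interior I)" by auto
  then obtain r where r: "r > 0" "cball z r \<subseteq> ball x0 d \<inter> interior I"
    using z open_contains_cball by blast
  have rI: "{z - r..z + r} \<subseteq> I" and rnz: "\<And>x. x \<in> {z - r..z + r} \<Longrightarrow> f'' x \<noteq> 0"
    using r(2) interior_subset[of I] nzd by (auto simp: cball_eq_atLeastAtMost subset_eq dist_commute)
  have cf': "continuous_on I f'" using f' by (meson DERIV_continuous_on)
  obtain y where y: "z - r < y" "y < z + r" "f' y \<noteq> 0"
  proof (cases "f' z = 0")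
    case True
    have "{z..z + r / 2} \<subseteq> I" using rI r(1) by auto
    from interval_mvt[where g = f' and g' = f'', OF f' this] r(1)
    obtain t where t: "z < t" "t < z + r / 2" "f' (z + r / 2) - f' z = f'' t * (r / 2)" by auto
    then have "f' (z + r / 2) \<noteq> 0" using rnz[of t] True r(1) by auto
    then show thesis using that[of "z + r / 2"] r(1) by auto
  next
    case False
    then show thesis using that[of z] r(1) by auto
  qed
  have "\<exists>e>0. \<forall>x\<in>I. dist x y < e \<longrightarrow> dist (f' x) (f' y) < \<bar>f' y\<bar>"
    using cf' y rI unfolding continuous_on_iff
    by (metis atLeastAtMost_iff less_imp_le subsetD zero_less_abs_iff)
  then obtain e where e: "e > 0" "\<And>x. x \<in> I \<Longrightarrow> dist x y < e \<Longrightarrow> dist (f' x) (f' y) < \<bar>f' y\<bar>" by blast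
  define l where "l = min (e / 2) (z + r - y)"
  have l: "0 < l" "l < e" "y + l \<le> z + r" using e y by (auto simp: l_def)
  have sub: "{y..y + l} \<subseteq> {z - r..z + r}" using l y by auto
  then have subI: "{y..y + l} \<subseteq> I" using rI by blast
  have f'0: "f' x \<noteq> 0" if "x \<in> {y..y + l}" for x
    using e(2)[of x] that subI l by (force simp: dist_real_def)
  have f''0: "f'' x \<noteq> 0" if "x \<in> {y..y + l}" for x using rnz that sub by blast
  have c': "continuous_on {y..y + l} f'" and c'': "continuous_on {y..y + l} f''"
    using cf' cont subI continuous_on_subset by blast+
  obtain B' where B': "\<And>x. x \<in> {y..y + l} \<Longrightarrow> \<bar>f' x\<bar> \<le> B'" using upper_bound_on_interval[OF c'] by blast
  obtain B'' where B'': "\<And>x. x \<in> {y..y + l} \<Longrightarrow> \<bar>f'' x\<bar> \<le> B''" using upper_bound_on_interval[OF c''] by blast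
  obtain \<nu> where \<nu>: "\<nu> > 0" "\<And>x. x \<in> {y..y + l} \<Longrightarrow> \<nu> \<le> \<bar>f' x\<bar>"
    using positive_lower_bound[OF c' _ f'0] l(1) by auto
  obtain \<mu> where \<mu>: "\<mu> > 0" "\<And>x. x \<in> {y..y + l} \<Longrightarrow> \<mu> \<le> \<bar>f'' x\<bar>"
    using positive_lower_bound[OF c'' _ f''0] l(1) by auto
  define K where "K = max 1 (max B' B'')"
  have mvt': "\<exists>t. t \<in> {y..y + l} \<and> f' v - f' u = f'' t * (v - u)"
    if uv: "u \<in> {y..y + l}" "v \<in> {y..y + l}" "u < v" for u v
  proof -
    have "{u..v} \<subseteq> I" using uv subI by (auto simp: subset_eq)
    then obtain t where "u < t" "t < v" "f' v - f' u = f'' t * (v - u)"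
      using interval_mvt[where g = f' and g' = f'', OF f' _ uv(3)] by blast
    then show ?thesis using uv by (intro exI[of _ t]) auto
  qed
  have lip: "\<bar>f' v - f' u\<bar> \<le> K * \<bar>v - u\<bar>" if uv: "u \<in> {y..y + l}" "v \<in> {y..y + l}" for u v
  proof -
    have *: "\<bar>f' v - f' u\<bar> \<le> K * \<bar>v - u\<bar>" if uv': "u \<in> {y..y + l}" "v \<in> {y..y + l}" "u < v" for u v
    proof -
      obtain t where t: "t \<in> {y..y + l}" "f' v - f' u = f'' t * (v - u)" using mvt'[OF uv'] by blast
      have "\<bar>f'' t\<bar> \<le> K" using B''[OF t(1)] by (simp add: K_def)
      then show ?thesis unfolding t(2) abs_mult by (intro mult_right_mono) auto
    qed
    consider "u < v" | "u = v" | "v < u" by linarith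
    then show ?thesis
    proof cases
      case 3
      then show ?thesis using *[OF uv(2,1)] by (simp add: abs_minus_commute)
    qed (use * uv in auto)
  qed
  have "curve y l f f' K (min 1 \<nu>) \<mu>"
  proof
    show "0 < l" "1 \<le> K" "0 < min 1 \<nu>" "min 1 \<nu> \<le> 1" "0 < \<mu>"
      using l \<nu> \<mu> by (auto simp: K_def)
    show "(f has_real_derivative f' x) (at x within {y..y + l})" if "x \<in> {y..y + l}" for x
      using has_field_derivative_subset[OF f subI] that subI by blast
    show "min 1 \<nu> \<le> \<bar>f' x\<bar> \<and> \<bar>f' x\<bar> \<le> K" if "x \<in> {y..y + l}" for x
      using \<nu>(2)[OF that] B'[OF that] by (auto simp: K_def)
    show "\<bar>f' v - f' u\<bar> \<le> K * \<bar>v - u\<bar>" if "u \<in> {y..y + l}" "v \<in> {y..y + l}" for u v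
      by (rule lip[OF that])
    show "(\<forall>u\<in>{y..y + l}. \<forall>v\<in>{y..y + l}. u \<le> v \<longrightarrow> \<mu> * (v - u) \<le> f' v - f' u) \<or>
      (\<forall>u\<in>{y..y + l}. \<forall>v\<in>{y..y + l}. u \<le> v \<longrightarrow> \<mu> * (v - u) \<le> f' u - f' v)"
      using constant_sign[OF c'' f''0]
    proof
      assume pos: "\<forall>x\<in>{y..y + l}. 0 < f'' x"
      have "\<mu> * (v - u) \<le> f' v - f' u" if uv: "u \<in> {y..y + l}" "v \<in> {y..y + l}" "u \<le> v" for u v
      proof (cases "u = v")
        case False
        then obtain t where t: "t \<in> {y..y + l}" "f' v - f' u = f'' t * (v - u)" using mvt'[OF uv(1,2)] uv(3) by force
        have "\<mu> \<le> f'' t" using \<mu>(2)[OF t(1)] pos t(1) by force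
        then show ?thesis unfolding t(2) using uv by (intro mult_right_mono) auto
      qed simp
      then show ?thesis by blast
    next
      assume neg: "\<forall>x\<in>{y..y + l}. f'' x < 0"
      have "\<mu> * (v - u) \<le> f' u - f' v" if uv: "u \<in> {y..y + l}" "v \<in> {y..y + l}" "u \<le> v" for u v
      proof (cases "u = v")
        case False
        then obtain t where t: "t \<in> {y..y + l}" "f' v - f' u = f'' t * (v - u)" using mvt'[OF uv(1,2)] uv(3) by force
        have "\<mu> \<le> - f'' t" using \<mu>(2)[OF t(1)] neg t(1) by force
        then have "\<mu> * (v - u) \<le> - f'' t * (v - u)" using uv by (intro mult_right_mono) auto
        then show ?thesis using t(2) by simp
      qed simp
      then show ?thesis by blast
    qed
  qed
  then show thesis using that subI by blast
qed

lemma (in curve) hausdorff_measure_Bad_ne_0: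
  fixes i j :: "nat \<Rightarrow> real" and \<gamma> :: "real \<Rightarrow> real \<times> real"
  assumes ij: "\<And>t. t < d \<Longrightarrow> 0 \<le> i t \<and> 0 \<le> j t \<and> i t + j t = 1"
    and s': "0 \<le> s'" "s' < 1"
    and expand: "\<And>x y. \<bar>x - y\<bar> \<le> dist (\<gamma> x) (\<gamma> y)"
    and E: "\<And>x. x \<in> {a..a + l} \<Longrightarrow> (\<And>t. t < d \<Longrightarrow> (x, f x) \<in> Bad (i t) (j t)) \<Longrightarrow> \<gamma> x \<in> E"
  shows "hausdorff_measure s' E \<noteq> 0"
proof -
  define X where "X t = {x. (x, f x) \<notin> Bad (i t) (j t)}" for t
  have "\<forall>t\<in>{..<d}. \<exists>\<sigma>. \<sigma> < 1 \<and> (\<forall>s. \<sigma> < s \<and> 1 / 2 \<le> s \<and> s < 1 \<longrightarrow>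
    (\<forall>\<^sub>F R in sequentially. grid.removable a l R s (X t)))"
  proof
    fix t assume "t \<in> {..<d}"
    then have "0 \<le> i t" "0 \<le> j t" "i t + j t = 1" using ij by auto
    from eventually_removable[OF this] show "\<exists>\<sigma>. \<sigma> < 1 \<and> (\<forall>s. \<sigma> < s \<and> 1 / 2 \<le> s \<and> s < 1 \<longrightarrow>
        (\<forall>\<^sub>F R in sequentially. grid.removable a l R s (X t)))" unfolding X_def .
  qed
  from bchoice[OF this] obtain \<sigma> where \<sigma>_all: "\<forall>t\<in>{..<d}. \<sigma> t < 1 \<and> (\<forall>s. \<sigma> t < s \<and> 1 / 2 \<le> s \<and> s < 1 \<longrightarrow>
      (\<forall>\<^sub>F R in sequentially. grid.removable a l R s (X t)))" ..
  then have \<sigma>: "\<And>t. t < d \<Longrightarrow> \<sigma> t < (1::real)" "\<And>t s. t < d \<Longrightarrow> \<sigma> t < s \<Longrightarrow> 1 / 2 \<le> s \<Longrightarrow> s < 1 \<Longrightarrow>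
      \<forall>\<^sub>F R in sequentially. grid.removable a l R s (X t)" by simp_all
  \<comment> \<open>With \<open>1 / 2\<close>, \<open>s'\<close> and all thresholds in the maximum,
    the midpoint \<open>s\<close> of \<open>b\<close> and 1 is admissible for every weight and at
    least \<open>s'\<close>.\<close>
  define b where "b = Max (insert (1 / 2) (insert s' (\<sigma> ` {..<d})))"
  have fin: "finite (insert (1 / 2) (insert s' (\<sigma> ` {..<d})))" by simp
  have "x < 1" if "x \<in> insert (1 / 2) (insert s' (\<sigma> ` {..<d}))" for x
    using that \<sigma>(1) s'(2) by auto
  then have b1: "b < 1" unfolding b_def by (intro Max_less_iff[OF fin, THEN iffD2] ballI) auto
  have b: "1 / 2 \<le> b" "s' \<le> b" "\<And>t. t < d \<Longrightarrow> \<sigma> t \<le> b"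
    unfolding b_def by (rule Max_ge[OF fin]; simp)+
  define s where "s = (b + 1) / 2"
  have s: "b < s" "s < 1" "1 / 2 \<le> s" "s' \<le> s" "0 < s" using b(1,2) b1 by (auto simp: s_def)
  have "\<forall>\<^sub>F R in sequentially. \<forall>t\<in>{..<d}. grid.removable a l R s (X t)"
    using \<sigma>(2) b(3) s by (intro eventually_ball_finite) (auto intro: le_less_trans)
  moreover have "\<forall>\<^sub>F R::nat in sequentially. 2 \<le> real R powr (1 - s)"
    using s by (intro eventually_powr_ge) auto
  moreover have "\<forall>\<^sub>F R::nat in sequentially. 2 \<le> R" by (rule eventually_ge_at_top)
  ultimately have "\<forall>\<^sub>F R in sequentially. (\<forall>t\<in>{..<d}. grid.removable a l R s (X t)) \<and> 2 \<le> real R powr (1 - s) \<and> 2 \<le> R"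
    by (intro eventually_conj)
  then obtain R where R: "\<forall>t\<in>{..<d}. grid.removable a l R s (X t)" "2 \<le> real R powr (1 - s)" "2 \<le> R"
    using eventually_happens'[OF sequentially_bot] by fast
  interpret grid a l R by unfold_locales (use R l_gt_0 in auto)
  \<comment> \<open>\<open>R powr (1 - s) \<ge> 2\<close> leaves \<open>R / 2\<close> of the growth
    as budget, which is at least the 1 that \<open>avoid_removable\<close> distributes.\<close>
  have RT: "1 \<le> real R - real R powr s"
  proof -
    have "2 * real R powr s \<le> real R powr (1 - s) * real R powr s" using R(2) by (intro mult_right_mono) auto
    also have "\<dots> = real R" using R_pos by (simp flip: powr_add)
    finally have "real R powr s \<le> real R / 2" by simp
    then have "real R / 2 \<le> real R - real R powr s" by linarith
    moreover have "1 \<le> real R / 2" using R_pos(3) by simp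
    ultimately show ?thesis by linarith
  qed
  show ?thesis
  proof (rule hausdorff_measure_pos[OF s(5) s'(1) s(4) _ RT expand])
    show "removable s (X t)" if "t < d" for t using R(1) that by blast
    show "\<gamma> x \<in> E" if "x \<in> {a..a + l}" "\<And>t. t < d \<Longrightarrow> x \<notin> X t" for x
      using E[OF that(1)] that(2) by (auto simp: X_def)
  qed
qed

lemma differentiable_imp_pointwise_lipschitz:
  fixes f :: "real \<Rightarrow> real"
  assumes "(f has_real_derivative D) (at x within I)"
  shows "\<exists>\<delta>>0. \<forall>y\<in>I. \<bar>y - x\<bar> < \<delta> \<longrightarrow> \<bar>f y - f x\<bar> \<le> (\<bar>D\<bar> + 1) * \<bar>y - x\<bar>"
proof -
  have "\<exists>\<delta>>0. \<forall>y\<in>I. norm (y - x) < \<delta> \<longrightarrow> norm (f y - f x - D * (y - x)) \<le> 1 * norm (y - x)"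
    using assms unfolding has_field_derivative_def has_derivative_within_alt
    by (meson zero_less_one)
  then obtain \<delta> where \<delta>: "\<delta> > 0" "\<And>y. y \<in> I \<Longrightarrow> \<bar>y - x\<bar> < \<delta> \<Longrightarrow> \<bar>f y - f x - D * (y - x)\<bar> \<le> \<bar>y - x\<bar>"
    by auto
  have "\<bar>f y - f x\<bar> \<le> (\<bar>D\<bar> + 1) * \<bar>y - x\<bar>" if "y \<in> I" "\<bar>y - x\<bar> < \<delta>" for y
  proof -
    have "\<bar>f y - f x\<bar> \<le> \<bar>f y - f x - D * (y - x)\<bar> + \<bar>D * (y - x)\<bar>" by linarith
    also have "\<dots> \<le> \<bar>y - x\<bar> + \<bar>D\<bar> * \<bar>y - x\<bar>" using \<delta>(2)[OF that] by (simp add: abs_mult)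
    finally show ?thesis by (simp add: algebra_simps)
  qed
  then show ?thesis using \<delta>(1) by blast
qed

lemma dist_real_pair:
  "\<bar>x - x'\<bar> \<le> dist (x, y) (x', y')" "\<bar>y - y'\<bar> \<le> dist (x, y) (x', y')"
  "dist (x, y) (x', y') \<le> \<bar>x - x'\<bar> + \<bar>y - y'\<bar>"
  for x y x' y' :: real
  using dist_fst_le[of "(x, y)" "(x', y')"] dist_snd_le[of "(x, y)" "(x', y')"]
    sqrt_sum_squares_le_sum_abs[of "x - x'" "y - y'"]
  by (auto simp: dist_real_def dist_Pair_Pair)

theorem theorem1:
  fixes d :: nat and i j :: "nat \<Rightarrow> real" and I :: "real set"
    and f f' f'' :: "real \<Rightarrow> real" and C :: "(real \<times> real) set"
  assumes "d \<ge> 1"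
    and "\<And>t. t < d \<Longrightarrow> 0 \<le> i t \<and> i t \<le> 1 \<and> 0 \<le> j t \<and> j t \<le> 1 \<and> i t + j t = 1"
    and "is_interval I" and "interior I \<noteq> {}"
    and "\<And>x. x \<in> I \<Longrightarrow> (f has_real_derivative f' x) (at x within I)"
    and "\<And>x. x \<in> I \<Longrightarrow> (f' has_real_derivative f'' x) (at x within I)"
    and "continuous_on I f''"
    and "\<exists>x\<in>I. f'' x \<noteq> 0"
    and "C = (\<lambda>x. (x, f x)) ` I \<or> C = (\<lambda>x. (f x, x)) ` I"
  shows "hausdorff_dim ((\<Inter>t<d. Bad (i t) (j t)) \<inter> C) = 1"
proof -
  let ?E = "(\<Inter>t<d. Bad (i t) (j t)) \<inter> C"
  obtain a l K \<nu> \<mu> where cv: "curve a l f f' K \<nu> \<mu>" and sub: "{a..a + l} \<subseteq> I"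
    using ex_curve[OF assms(3-8)] by metis
  have graph: "\<exists>\<gamma>. C = \<gamma> ` I \<and> (\<gamma> = (\<lambda>x. (x, f x)) \<or> \<gamma> = (\<lambda>x. (f x, x)))" using assms(9) by blast
  then obtain \<gamma> where \<gamma>: "C = \<gamma> ` I" "\<gamma> = (\<lambda>x. (x, f x)) \<or> \<gamma> = (\<lambda>x. (f x, x))" by blast
  show ?thesis
  proof (rule hausdorff_dim_eq_1I)
    fix s :: real assume s: "0 \<le> s" "s < 1"
    show "hausdorff_measure s ?E \<noteq> 0"
      using \<gamma>(2)
    proof
      assume g: "\<gamma> = (\<lambda>x. (x, f x))"
      show ?thesis
        by (rule curve.hausdorff_measure_Bad_ne_0[OF cv, of d i j s \<gamma>])
           (use assms(2) s sub in \<open>auto simp: \<gamma>(1) g dist_real_pair\<close>)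
    next
      \<comment> \<open>The same function \<open>f\<close> with the weights exchanged;
        \<open>Bad_swap\<close> translates back.\<close>
      assume g: "\<gamma> = (\<lambda>x. (f x, x))"
      show ?thesis
        by (rule curve.hausdorff_measure_Bad_ne_0[OF cv, of d j i s \<gamma>])
           (use assms(2) s sub in \<open>auto simp: \<gamma>(1) g dist_real_pair Bad_swap add.commute\<close>)
    qed
  next
    fix s :: real assume s: "1 < s"
    show "hausdorff_measure s ?E = 0"
    proof (rule hausdorff_measure_curve_eq_0[of I \<gamma>])
      fix x assume x: "x \<in> I"
      obtain \<delta> where \<delta>: "\<delta> > 0" "\<And>y. y \<in> I \<Longrightarrow> \<bar>y - x\<bar> < \<delta> \<Longrightarrow> \<bar>f y - f x\<bar> \<le> (\<bar>f' x\<bar> + 1) * \<bar>y - x\<bar>"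
        using differentiable_imp_pointwise_lipschitz[OF assms(5)[OF x]] by blast
      have "dist (\<gamma> y) (\<gamma> x) \<le> (\<bar>f' x\<bar> + 2) * \<bar>y - x\<bar>" if "y \<in> I" "\<bar>y - x\<bar> < \<delta>" for y
      proof -
        have "dist (\<gamma> y) (\<gamma> x) \<le> \<bar>y - x\<bar> + \<bar>f y - f x\<bar>"
          using \<gamma>(2) dist_real_pair(3)[of y "f y" x "f x"] dist_real_pair(3)[of "f y" y "f x" x] by auto
        then show ?thesis using \<delta>(2)[OF that] by (simp add: algebra_simps)
      qed
      then show "\<exists>K \<delta>. \<delta> > 0 \<and> (\<forall>y\<in>I. \<bar>y - x\<bar> < \<delta> \<longrightarrow> dist (\<gamma> y) (\<gamma> x) \<le> K * \<bar>y - x\<bar>)"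
        using \<delta>(1) by blast
    qed (use \<gamma>(1) s in auto)
  qed
qed

end
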